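(* Let $N=N(n)$ be a sequence of integers with $N/n\to c\in(0,\infty)$ as $n\to\infty$, and assume the following. (A-1) The random variables $(X_{ij}^n;\,1\le i\le N,\,1\le j\le n,\,n\ge1)$ are real, independent and identically distributed, centered, with $\mathbb{E}(X_{ij}^n)^2=1$, and there exists $\varepsilon>0$ such that $\mathbb{E}|X_{ij}^n|^{4+\varepsilon}<\infty$. (A-2) The real numbers $\sigma_{ij}(n)$ satisfy $\sup_{n\ge1}\max_{1\le i\le N,1\le j\le n}|\sigma_{ij}(n)|\le\sigma_{\max}<\infty$. (A-3) $A_n$ is a real deterministic $N\times n$ matrix whose columns $\mathbf a_k^n$ and rows $\tilde{\mathbf a}_\ell^n$ satisfy $\sup_{n\ge1}\max(\|\mathbf a_k^n\|,\|\tilde{\mathbf a}_\ell^n\|;\,1\le k\le n,\,1\le\ell\le N)<\infty$. Let $Y_{ij}^n=\frac{\sigma_{ij}(n)}{\sqrt n}X_{ij}^n$, $\Sigma_n=Y_n+A_n$, $Q_n(z)=(\Sigma_n\Sigma_n^T-zI_N)^{-1}$, $\tilde Q_n(z)=(\Sigma_n^T\Sigma_n-zI_n)^{-1}$, and let $T_n,\tilde T_n$ be as in the context. Denote by $\mathbb{P}_n$ and $\pi_n$ the probability measures whose Stieltjes transforms are respectively $\frac1N\mathrm{Tr}\,Q_n$ and $\frac1N\mathrm{Tr}\,T_n$. Then for every continuous and bounded function $f:\mathbb{R}^+\to\mathbb{R}$, almost surely, $$\int_0^\infty f(\lambda)\,\mathbb{P}_n(d\lambda)-\int_0^\infty f(\lambda)\,\pi_n(d\lambda)\xrightarrow[n\to\infty]{}0.$$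 The same result holds for the probability measures whose Stieltjes transforms are $\frac1n\mathrm{Tr}\,\tilde Q_n$ and $\frac1n\mathrm{Tr}\,\tilde T_n$.
   Context: $\mathbb{R}^+=[0,\infty)$; the Stieltjes transform of a probability measure $\nu$ on $\mathbb{R}^+$ is $z\mapsto\int_{\mathbb{R}^+}\frac{\nu(d\lambda)}{\lambda-z}$, $z\in\mathbb{C}-\mathbb{R}^+$, and $\mathcal{S}(\mathbb{R}^+)$ is the set of all such functions. Definition of $T=T_n$, $\tilde T=\tilde T_n$ (with $A=A_n$, $\sigma_{ij}=\sigma_{ij}(n)$): let $D_j=\mathrm{diag}(\sigma_{ij}^2;1\le i\le N)$, $\tilde D_i=\mathrm{diag}(\sigma_{ij}^2;1\le j\le n)$. The system $$\psi_i(z)=\frac{-1}{z(1+\frac1n\mathrm{Tr}\,\tilde D_i\tilde T(z))}\ (1\le i\le N),\qquad \tilde\psi_j(z)=\frac{-1}{z(1+\frac1n\mathrm{Tr}\,D_jT(z))}\ (1\le j\le n),$$ with $\Psi=\mathrm{diag}(\psi_i)$, $\tilde\Psi=\mathrm{diag}(\tilde\psi_j)$, $T(z)=(\Psi^{-1}(z)-zA\tilde\Psi(z)A^T)^{-1}$, $\tilde T(z)=(\tilde\Psi^{-1}(z)-zA^T\Psi(z)A)^{-1}$, has a unique solution in $\mathcal{S}(\mathbb{R}^+)^{N+n}$; $T_n$ and $\tilde T_n$ are the matrices associated with this solution. The functions $\frac1N\mathrm{Tr}\,T_n$ and $\frac1n\mathrm{Tr}\,\tilde T_n$ belong to $\mathcal{S}(\mathbb{R}^+)$.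 *)

theory Defs
  imports
    "HOL-Probability.Probability"
    "Jordan_Normal_Form.Gauss_Jordan_Elimination"
begin

text \<open>
  Matrices are those of \<open>Jordan_Normal_Form\<close>, whose dimensions are ordinary naturals; all row
  and column indices therefore start at 0. A probability measure on \<open>[0,\<infinity>)\<close> is a
  Borel probability measure on the real line that gives mass 1 to \<open>[0,\<infinity>)\<close>.
\<close>

definition prob_on_nonneg :: "real measure \<Rightarrow> bool" where
  "prob_on_nonneg \<nu> \<longleftrightarrow> real_distribution \<nu> \<and> measure \<nu> {0..} = 1"

definition stieltjes :: "real measure \<Rightarrow> complex \<Rightarrow> complex" where
  "stieltjes \<nu> z = (LINT x|\<nu>. 1 / (complex_of_real x - z))"

text \<open>
  The functions live on the complement of \<open>[0,\<infinity>)\<close>; the values that a HOL function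
  takes on \<open>[0,\<infinity>)\<close> itself are left unconstrained.
\<close>

definition has_stieltjes :: "real measure \<Rightarrow> (complex \<Rightarrow> complex) \<Rightarrow> bool" where
  "has_stieltjes \<nu> g \<longleftrightarrow>
     prob_on_nonneg \<nu> \<and> (\<forall>z \<in> - \<real>\<^sub>\<ge>\<^sub>0. g z = stieltjes \<nu> z)"

definition stieltjes_class :: "(complex \<Rightarrow> complex) set" where
  "stieltjes_class = {g. \<exists>\<nu>. has_stieltjes \<nu> g}"

definition euclid_norm :: "real Matrix.vec \<Rightarrow> real" where
  "euclid_norm v = sqrt (scalar_prod v v)"

definition mtrace :: "'a::comm_monoid_add Matrix.mat \<Rightarrow> 'a" where
  "mtrace B = (\<Sum>i<dim_row B. B $$ (i, i))"

text \<open>Meaningful for invertible matrices only; an unspecified matrix otherwise.\<close>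

definition minv :: "'a::field Matrix.mat \<Rightarrow> 'a Matrix.mat" where
  "minv B = the (mat_inverse B)"

abbreviation cmat :: "real Matrix.mat \<Rightarrow> complex Matrix.mat" where
  "cmat \<equiv> map_mat complex_of_real"

text \<open>
  For an \<open>N \<times> n\<close> matrix \<open>S\<close>, \<open>resolvent (S * S\<^sup>T)\<close> is \<open>Q\<close> and
  \<open>resolvent (S\<^sup>T * S)\<close> is its companion \<open>Q~\<close>.
\<close>

definition resolvent :: "real Matrix.mat \<Rightarrow> complex \<Rightarrow> complex Matrix.mat" where
  "resolvent B z = minv (cmat B - z \<cdot>\<^sub>m 1\<^sub>m (dim_row B))"

text \<open>The random matrix \<open>\<Sigma> = Y + A\<close> for one realisation \<open>x\<close> of the entries.\<close>

definition sigma_mat ::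
  "nat \<Rightarrow> nat \<Rightarrow> (nat \<Rightarrow> nat \<Rightarrow> real) \<Rightarrow> real Matrix.mat \<Rightarrow> (nat \<Rightarrow> nat \<Rightarrow> real) \<Rightarrow> real Matrix.mat" where
  "sigma_mat N n \<sigma> A x = Matrix.mat N n (\<lambda>(i, j). \<sigma> i j / sqrt (real n) * x i j) + A"

definition D_mat :: "nat \<Rightarrow> (nat \<Rightarrow> nat \<Rightarrow> real) \<Rightarrow> nat \<Rightarrow> complex Matrix.mat" where
  "D_mat N \<sigma> j = mat_diag N (\<lambda>i. complex_of_real ((\<sigma> i j)\<^sup>2))"

definition D'_mat :: "nat \<Rightarrow> (nat \<Rightarrow> nat \<Rightarrow> real) \<Rightarrow> nat \<Rightarrow> complex Matrix.mat" where
  "D'_mat n \<sigma> i = mat_diag n (\<lambda>j. complex_of_real ((\<sigma> i j)\<^sup>2))"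

text \<open>
  Primed names stand for the tilded objects: \<open>T_mat\<close> is \<open>T(z)\<close> of size \<open>N\<close>,
  \<open>T'_mat\<close> is \<open>T~(z)\<close> of size \<open>n\<close>.
\<close>

definition T_mat ::
  "nat \<Rightarrow> nat \<Rightarrow> real Matrix.mat \<Rightarrow> (nat \<Rightarrow> complex \<Rightarrow> complex) \<Rightarrow> (nat \<Rightarrow> complex \<Rightarrow> complex)
     \<Rightarrow> complex \<Rightarrow> complex Matrix.mat" where
  "T_mat N n A \<psi> \<psi>' z =
     minv (minv (mat_diag N (\<lambda>i. \<psi> i z))
           - z \<cdot>\<^sub>m (cmat A * mat_diag n (\<lambda>j. \<psi>' j z) * transpose_mat (cmat A)))"

definition T'_mat ::
  "nat \<Rightarrow> nat \<Rightarrow> real Matrix.mat \<Rightarrow> (nat \<Rightarrow> complex \<Rightarrow> complex) \<Rightarrow> (nat \<Rightarrow> complex \<Rightarrow> complex)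
     \<Rightarrow> complex \<Rightarrow> complex Matrix.mat" where
  "T'_mat N n A \<psi> \<psi>' z =
     minv (minv (mat_diag n (\<lambda>j. \<psi>' j z))
           - z \<cdot>\<^sub>m (transpose_mat (cmat A) * mat_diag N (\<lambda>i. \<psi> i z) * cmat A))"

text \<open>
  The members of \<open>stieltjes_class\<close> have no zeros off \<open>[0,\<infinity>)\<close>, and for such
  \<open>\<psi>\<close> and \<open>\<psi>'\<close> all the inverses in \<open>T_mat\<close> and \<open>T'_mat\<close> exist for
  \<open>z\<close> off \<open>[0,\<infinity>)\<close>, so neither \<open>minv\<close> nor division by zero adds
  spurious solutions.
\<close>

definition solves_system ::
  "nat \<Rightarrow> nat \<Rightarrow> (nat \<Rightarrow> nat \<Rightarrow> real) \<Rightarrow> real Matrix.mat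
     \<Rightarrow> (nat \<Rightarrow> complex \<Rightarrow> complex) \<Rightarrow> (nat \<Rightarrow> complex \<Rightarrow> complex) \<Rightarrow> bool" where
  "solves_system N n \<sigma> A \<psi> \<psi>' \<longleftrightarrow>
     (\<forall>i<N. \<psi> i \<in> stieltjes_class) \<and>
     (\<forall>j<n. \<psi>' j \<in> stieltjes_class) \<and>
     (\<forall>z \<in> - \<real>\<^sub>\<ge>\<^sub>0.
        (\<forall>i<N. \<psi> i z =
           -1 / (z * (1 + 1 / of_nat n * mtrace (D'_mat n \<sigma> i * T'_mat N n A \<psi> \<psi>' z)))) \<and>
        (\<forall>j<n. \<psi>' j z =
           -1 / (z * (1 + 1 / of_nat n * mtrace (D_mat N \<sigma> j * T_mat N n A \<psi> \<psi>' z)))))"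

end

theory Submission
  imports Defs "Jordan_Normal_Form.Determinant" "HOL-Real_Asymp.Real_Asymp"
begin

text \<open>
  Only real arguments \<open>z = - s\<^sup>2\<close> are needed. There \<open>Q\<close> and \<open>Q~\<close> are, up to the
  factor \<open>s\<close>, the diagonal blocks of the inverse \<open>G\<close> of \<open>s I + [0, \<Sigma>; - \<Sigma>\<^sup>T, 0]\<close>, and
  \<open>T\<close> and \<open>T~\<close> those of the inverse \<open>\<Gamma>\<close> of \<open>diag d + [0, A; - A\<^sup>T, 0]\<close>, where \<open>d\<close> solves the
  fixed point equation \<open>d p = s + (\<Sum>q. v p q * \<Gamma> q q)\<close>. A matrix \<open>diag d\<close> plus a skew matrix
  has an inverse of norm at most \<open>1 / s\<close> when \<open>d \<ge> s\<close>, whatever the skew part; this is why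
  no bound on the spectral norm of \<open>A\<close> is required.

  The entries of \<open>G\<close> are expanded in a single random entry by the resolvent identity. The
  Efron-Stein inequality then bounds the variance of the traces by a constant (fourth moments),
  and the same expansion shows that \<open>E G\<close> satisfies the fixed point equation up to an error
  \<open>O(sqrt n)\<close> in trace (third moments). For large \<open>s\<close> the fixed point equation contracts.
  After division by \<open>N\<close> the variances are summable in \<open>n\<close>, which gives almost sure
  convergence for countably many \<open>s\<close>, and these suffice by Weierstrass' theorem and tightness.
\<close>

section \<open>Diagonal plus skew matrices\<close>

text \<open>Put K = N + n. An entry has standard deviation at most h, of order 1 / sqrt n, and K h^2
  stays below a constant b. The derivative of Tr (D G) in an entry is a difference of two entries of
  G D G. Bounding these one by one, over K^2 entries of variance h^2, would give a variance of order
  n; the constant bound comes from the Frobenius norm of G D G, whose square is at most K / s^4. The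
  second-order part of an increment contributes h^4 per entry, and K^2 h^4 is bounded too. For the
  expectation, K^2 remainders of size h^3 leave an error of order sqrt n.

  E G and \<Gamma> are compared through a third matrix \<open>R\<close>, the inverse of diag (s + m)
  + B, where B is the deterministic skew part and m is computed from E G instead of from
  \<open>R\<close>. Then \<open>R\<close> - E G is an expansion error only, while \<open>R\<close> -
  \<Gamma> is free of randomness and can be absorbed by contraction.

  The substitution d = 1 / (s psi) turns the bound psi <= 1 / s^2, valid for every Stieltjes
  transform at - s^2, into d >= s. So a solution of the system is automatically in the range where
  the inverse is controlled.\<close>

definition diag_plus :: "(nat \<Rightarrow> real) \<Rightarrow> (nat \<Rightarrow> nat \<Rightarrow> real) \<Rightarrow> nat \<Rightarrow> nat \<Rightarrow> real" where
  "diag_plus d B i j = (if i = j then d i else 0) + B i j"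

text \<open>Adjugate over determinant makes every entry a rational function of the entries of
  \<open>L\<close>, from which measurability follows. The value 0 outside the index range lets
  bounds be stated for all indices.\<close>

definition inv_fun :: "nat \<Rightarrow> (nat \<Rightarrow> nat \<Rightarrow> real) \<Rightarrow> nat \<Rightarrow> nat \<Rightarrow> real" where
  "inv_fun K L a b = (if a < K \<and> b < K
     then adj_mat (Matrix.mat K K (\<lambda>(i, j). L i j)) $$ (a, b) / Determinant.det (Matrix.mat K K (\<lambda>(i, j). L i j))
     else 0)"

lemma sum_delta_mult:
  fixes f :: "nat \<Rightarrow> real"
  assumes "b < K"
  shows "(\<Sum>k<K. f k * (if k = b then 1 else 0)) = f b"
    "(\<Sum>k<K. f k * (if b = k then 1 else 0)) = f b"
    "(\<Sum>k<K. (if k = b then 1 else 0) * f k) = f b"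
    "(\<Sum>k<K. (if b = k then 1 else 0) * f k) = f b"
  using assms by (simp_all add: mult_delta_right mult_delta_left)

lemma inv_fun_outside: "\<not> (a < K \<and> b < K) \<Longrightarrow> inv_fun K L a b = 0"
  by (auto simp: inv_fun_def)

lemma skew_quad_zero:
  fixes B :: "nat \<Rightarrow> nat \<Rightarrow> real"
  assumes "\<And>i j. B i j = - B j i"
  shows "(\<Sum>i<K. \<Sum>j<K. x i * B i j * x j) = 0"
proof -
  have "(\<Sum>i<K. \<Sum>j<K. x i * B i j * x j) = (\<Sum>j<K. \<Sum>i<K. x i * B i j * x j)"
    by (rule sum.swap)
  also have "\<dots> = (\<Sum>j<K. \<Sum>i<K. - (x j * B j i * x i))"
    by (intro sum.cong refl) (subst assms, simp)
  also have "\<dots> = - (\<Sum>i<K. \<Sum>j<K. x i * B i j * x j)"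
    by (simp add: sum_negf)
  finally show ?thesis by simp
qed

lemma diag_plus_mult_vec:
  "a < K \<Longrightarrow> (\<Sum>k<K. diag_plus d B a k * x k) = d a * x a + (\<Sum>k<K. B a k * x k)"
  by (simp add: diag_plus_def distrib_right sum.distrib if_distrib[of "\<lambda>u. u * _"] cong: if_cong)

text \<open>The skew part vanishes in the quadratic form, so only the diagonal contributes.\<close>

lemma diag_plus_coercive:
  assumes "\<And>i. i < K \<Longrightarrow> s \<le> d i" "\<And>i j. B i j = - B j i"
  shows "s * (\<Sum>i<K. (x i)\<^sup>2) \<le> (\<Sum>a<K. x a * (\<Sum>k<K. diag_plus d B a k * x k))"
proof -
  have "(\<Sum>a<K. x a * (\<Sum>k<K. diag_plus d B a k * x k))
      = (\<Sum>a<K. d a * (x a)\<^sup>2) + (\<Sum>i<K. \<Sum>j<K. x i * B i j * x j)"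
    unfolding sum.distrib[symmetric]
    by (intro sum.cong refl)
      (simp add: diag_plus_mult_vec distrib_left sum_distrib_left power2_eq_square mult.assoc mult.left_commute)
  also have "\<dots> = (\<Sum>a<K. d a * (x a)\<^sup>2)"
    using skew_quad_zero[OF assms(2)] by simp
  finally show ?thesis
    using assms(1) by (auto simp: sum_distrib_left intro!: sum_mono mult_right_mono)
qed

text \<open>Pair the equation with its solution: s |u|^2 <= <u, x> by coercivity. The size of
  \<open>B\<close> never enters, so every bound derived from this one is uniform in the skew
  part.\<close>

lemma diag_plus_solution_bound:
  assumes s: "0 < s" and d: "\<And>i. i < K \<Longrightarrow> s \<le> d i" "\<And>i j. B i j = - B j i"
    and u: "\<And>a. a < K \<Longrightarrow> (\<Sum>k<K. diag_plus d B a k * u k) = x a"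
  shows "(\<Sum>i<K. (u i)\<^sup>2) \<le> (\<Sum>i<K. (x i)\<^sup>2) / s\<^sup>2"
proof -
  have "s\<^sup>2 * (\<Sum>i<K. (u i)\<^sup>2) = s * (s * (\<Sum>i<K. (u i)\<^sup>2))"
    by (simp add: power2_eq_square)
  also have "\<dots> \<le> s * (\<Sum>a<K. u a * x a)"
    using diag_plus_coercive[where K = K and s = s and d = d and B = B and x = u, OF d] u s by (intro mult_left_mono) auto
  also have "\<dots> = (\<Sum>a<K. (s * u a) * x a)"
    by (simp add: sum_distrib_left mult.assoc)
  \<comment> \<open>The weights are chosen so that half of the left-hand side reappears and can be
    absorbed.\<close>
  also have "\<dots> \<le> (\<Sum>a<K. ((s * u a)\<^sup>2 + (x a)\<^sup>2) / 2)"
  proof (rule sum_mono)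
    fix a show "(s * u a) * x a \<le> ((s * u a)\<^sup>2 + (x a)\<^sup>2) / 2"
      using sum_squares_bound[of "s * u a" "x a"] by simp
  qed
  also have "\<dots> = (s\<^sup>2 * (\<Sum>i<K. (u i)\<^sup>2) + (\<Sum>i<K. (x i)\<^sup>2)) / 2"
    by (simp add: sum_divide_distrib[symmetric] sum.distrib power_mult_distrib sum_distrib_left)
  finally have "s\<^sup>2 * (\<Sum>i<K. (u i)\<^sup>2) \<le> (\<Sum>i<K. (x i)\<^sup>2)" by simp
  thus ?thesis using s by (simp add: field_simps)
qed

text \<open>A kernel vector solves the system with right-hand side 0, so the solution bound forces
  it to be 0.\<close>

lemma det_dsk_nonzero:
  assumes s: "0 < s" and d: "\<And>i. i < K \<Longrightarrow> s \<le> d i" "\<And>i j. B i j = - B j i"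
  shows "Determinant.det (Matrix.mat K K (\<lambda>(i, j). diag_plus d B i j)) \<noteq> 0"
proof
  let ?L = "Matrix.mat K K (\<lambda>(i, j). diag_plus d B i j)"
  assume "Determinant.det ?L = 0"
  then obtain v where v: "v \<in> carrier_vec K" "v \<noteq> 0\<^sub>v K" "?L *\<^sub>v v = 0\<^sub>v K"
    using det_0_iff_vec_prod_zero[of ?L K] by auto
  have "(\<Sum>k<K. diag_plus d B a k * (v $ k)) = 0" if "a < K" for a
  proof -
    have "(?L *\<^sub>v v) $ a = (\<Sum>k<K. diag_plus d B a k * (v $ k))"
      using that v(1) by (auto simp: scalar_prod_def atLeast0LessThan)
    with v(3) that show ?thesis by simp
  qed
  from diag_plus_solution_bound[OF s d this] have "(\<Sum>i<K. (v $ i)\<^sup>2) \<le> 0" by simp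
  hence "(\<Sum>i<K. (v $ i)\<^sup>2) = 0" by (intro antisym sum_nonneg) auto
  hence "\<And>i. i < K \<Longrightarrow> v $ i = 0"
    by (subst (asm) sum_nonneg_eq_0_iff) auto
  hence "v = 0\<^sub>v K" using v(1) by (intro eq_vecI) auto
  with v(2) show False by simp
qed

lemma
  assumes s: "0 < s" and d: "\<And>i. i < K \<Longrightarrow> s \<le> d i" "\<And>i j. B i j = - B j i"
    and ab: "a < K" "b < K"
  shows inv_fun_right: "(\<Sum>k<K. diag_plus d B a k * inv_fun K (diag_plus d B) k b) = (if a = b then 1 else 0)"
    and inv_fun_left: "(\<Sum>k<K. inv_fun K (diag_plus d B) a k * diag_plus d B k b) = (if a = b then 1 else 0)"
proof -
  let ?L = "Matrix.mat K K (\<lambda>(i, j). diag_plus d B i j)"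
  let ?D = "Determinant.det ?L"
  have L: "?L \<in> carrier_mat K K" by simp
  note adj = adj_mat[OF L]
  have D: "?D \<noteq> 0" by (rule det_dsk_nonzero[OF s d])
  have "(?L * adj_mat ?L) $$ (a, b) = (\<Sum>k<K. diag_plus d B a k * (adj_mat ?L $$ (k, b)))"
    using ab adj(1) by (auto simp: scalar_prod_def atLeast0LessThan intro!: sum.cong)
  with adj(2) ab have e: "(\<Sum>k<K. diag_plus d B a k * (adj_mat ?L $$ (k, b))) = ?D * (if a = b then 1 else 0)"
    by auto
  have "(\<Sum>k<K. diag_plus d B a k * inv_fun K (diag_plus d B) k b)
      = (\<Sum>k<K. diag_plus d B a k * (adj_mat ?L $$ (k, b))) / ?D"
    using ab unfolding sum_divide_distrib by (intro sum.cong) (auto simp: inv_fun_def)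
  with e D show "(\<Sum>k<K. diag_plus d B a k * inv_fun K (diag_plus d B) k b) = (if a = b then 1 else 0)"
    by simp
  have "(adj_mat ?L * ?L) $$ (a, b) = (\<Sum>k<K. (adj_mat ?L $$ (a, k)) * diag_plus d B k b)"
    using ab adj(1) by (auto simp: scalar_prod_def atLeast0LessThan intro!: sum.cong)
  with adj(3) ab have e: "(\<Sum>k<K. (adj_mat ?L $$ (a, k)) * diag_plus d B k b) = ?D * (if a = b then 1 else 0)"
    by auto
  have "(\<Sum>k<K. inv_fun K (diag_plus d B) a k * diag_plus d B k b)
      = (\<Sum>k<K. (adj_mat ?L $$ (a, k)) * diag_plus d B k b) / ?D"
    using ab unfolding sum_divide_distrib by (intro sum.cong) (auto simp: inv_fun_def)
  with e D show "(\<Sum>k<K. inv_fun K (diag_plus d B) a k * diag_plus d B k b) = (if a = b then 1 else 0)"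
    by simp
qed

lemma inv_fun_op_bound:
  assumes s: "0 < s" and d: "\<And>i. i < K \<Longrightarrow> s \<le> d i" "\<And>i j. B i j = - B j i"
  shows "(\<Sum>a<K. (\<Sum>k<K. inv_fun K (diag_plus d B) a k * x k)\<^sup>2) \<le> (\<Sum>k<K. (x k)\<^sup>2) / s\<^sup>2"
proof (rule diag_plus_solution_bound[OF s d])
  fix a assume a: "a < K"
  have "(\<Sum>k<K. diag_plus d B a k * (\<Sum>l<K. inv_fun K (diag_plus d B) k l * x l))
      = (\<Sum>l<K. (\<Sum>k<K. diag_plus d B a k * inv_fun K (diag_plus d B) k l) * x l)"
    by (simp add: sum_distrib_left sum_distrib_right mult.assoc) (rule sum.swap)
  also have "\<dots> = (\<Sum>l<K. (if a = l then 1 else 0) * x l)"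
    using a by (intro sum.cong refl) (simp add: inv_fun_right[OF s d])
  also have "\<dots> = x a"
    using a by (simp add: sum_delta_mult)
  finally show "(\<Sum>k<K. diag_plus d B a k * (\<Sum>l<K. inv_fun K (diag_plus d B) k l * x l)) = x a" .
qed auto

lemma inv_fun_col_bound:
  assumes s: "0 < s" and d: "\<And>i. i < K \<Longrightarrow> s \<le> d i" "\<And>i j. B i j = - B j i"
  shows "(\<Sum>a<K. (inv_fun K (diag_plus d B) a b)\<^sup>2) \<le> 1 / s\<^sup>2"
proof (cases "b < K")
  case True
  have "(\<Sum>a<K. (inv_fun K (diag_plus d B) a b)\<^sup>2)
      = (\<Sum>a<K. (\<Sum>k<K. inv_fun K (diag_plus d B) a k * (if k = b then 1 else 0))\<^sup>2)"
    using True by (simp add: sum_delta_mult)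
  also have "\<dots> \<le> (\<Sum>k<K. (if k = b then 1 else 0 :: real)\<^sup>2) / s\<^sup>2"
    by (rule inv_fun_op_bound[OF s d])
  also have "(\<Sum>k<K. (if k = b then 1 else 0 :: real)\<^sup>2) = 1"
    using True by (simp add: if_distrib[of "\<lambda>u. u\<^sup>2"] cong: if_cong)
  finally show ?thesis .
qed (simp add: inv_fun_outside)

text \<open>A row of the inverse is a column of the inverse of the transpose, and the transpose is
  again diagonal plus skew with the same diagonal.\<close>

lemma inv_fun_row_bound:
  assumes s: "0 < s" and d: "\<And>i. i < K \<Longrightarrow> s \<le> d i" "\<And>i j. B i j = - B j i"
  shows "(\<Sum>b<K. (inv_fun K (diag_plus d B) a b)\<^sup>2) \<le> 1 / s\<^sup>2"
proof (cases "a < K")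
  case True
  let ?G = "inv_fun K (diag_plus d B)"
  have "(\<Sum>b<K. (?G a b)\<^sup>2) \<le> (\<Sum>k<K. (if k = a then 1 else 0 :: real)\<^sup>2) / s\<^sup>2"
  proof (rule diag_plus_solution_bound[OF s d(1), where B = "\<lambda>i j. B j i"])
    fix b assume b: "b < K"
    have "(\<Sum>k<K. diag_plus d (\<lambda>i j. B j i) b k * ?G a k) = (\<Sum>k<K. ?G a k * diag_plus d B k b)"
      by (intro sum.cong refl) (simp add: diag_plus_def)
    thus "(\<Sum>k<K. diag_plus d (\<lambda>i j. B j i) b k * ?G a k) = (if b = a then 1 else 0)"
      using b True by (simp add: inv_fun_left[OF s d] eq_commute)
  qed (simp, rule d(2))
  also have "(\<Sum>k<K. (if k = a then 1 else 0 :: real)\<^sup>2) = 1"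
    using True by (simp add: if_distrib[of "\<lambda>u. u\<^sup>2"] cong: if_cong)
  finally show ?thesis .
qed (simp add: inv_fun_outside)

lemma inv_fun_abs_le:
  assumes s: "0 < s" and d: "\<And>i. i < K \<Longrightarrow> s \<le> d i" "\<And>i j. B i j = - B j i"
  shows "\<bar>inv_fun K (diag_plus d B) a b\<bar> \<le> 1 / s"
proof (cases "a < K \<and> b < K")
  case True
  have "(inv_fun K (diag_plus d B) a b)\<^sup>2 \<le> (\<Sum>a<K. (inv_fun K (diag_plus d B) a b)\<^sup>2)"
    using True by (intro member_le_sum) auto
  also have "\<dots> \<le> 1 / s\<^sup>2" by (rule inv_fun_col_bound[OF s d])
  also have "\<dots> = (1 / s)\<^sup>2" by (simp add: power_divide)
  finally show ?thesis using s abs_le_square_iff[of "inv_fun K (diag_plus d B) a b" "1/s"] by simp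
qed (use s in \<open>simp add: inv_fun_outside\<close>)

text \<open>Coercivity for the vector g = column \<open>a\<close> of the inverse: s |g|^2 <= <g, L
  g>, and L g is the unit vector at \<open>a\<close>, so the right-hand side is the diagonal entry
  itself.\<close>

lemma inv_fun_diag_nonneg:
  assumes s: "0 < s" and d: "\<And>i. i < K \<Longrightarrow> s \<le> d i" "\<And>i j. B i j = - B j i"
  shows "0 \<le> inv_fun K (diag_plus d B) a a"
proof (cases "a < K")
  case True
  let ?G = "inv_fun K (diag_plus d B)"
  have "0 \<le> s * (\<Sum>i<K. (?G i a)\<^sup>2)" using s by (simp add: sum_nonneg)
  also have "\<dots> \<le> (\<Sum>i<K. ?G i a * (\<Sum>k<K. diag_plus d B i k * ?G k a))"
    by (rule diag_plus_coercive[OF d])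
  also have "\<dots> = (\<Sum>i<K. ?G i a * (if i = a then 1 else 0))"
    using True by (intro sum.cong refl) (simp add: inv_fun_right[OF s d])
  also have "\<dots> = ?G a a" using True by (simp add: sum_delta_mult)
  finally show ?thesis .
qed (simp add: inv_fun_outside)

lemma inv_fun_resolvent_identity:
  assumes s: "0 < s" and d: "\<And>i. i < K \<Longrightarrow> s \<le> d i" "\<And>i j. B i j = - B j i"
    and d': "\<And>i. i < K \<Longrightarrow> s \<le> d' i" "\<And>i j. B' i j = - B' j i"
    and ab: "a < K" "b < K"
  shows "inv_fun K (diag_plus d B) a b - inv_fun K (diag_plus d' B') a b =
    (\<Sum>k<K. \<Sum>l<K. inv_fun K (diag_plus d B) a k * (diag_plus d' B' k l - diag_plus d B k l) * inv_fun K (diag_plus d' B') l b)"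
proof -
  let ?G = "inv_fun K (diag_plus d B)" and ?H = "inv_fun K (diag_plus d' B')"
  have "(\<Sum>k<K. \<Sum>l<K. ?G a k * (diag_plus d' B' k l - diag_plus d B k l) * ?H l b) =
      (\<Sum>k<K. \<Sum>l<K. ?G a k * diag_plus d' B' k l * ?H l b) - (\<Sum>k<K. \<Sum>l<K. ?G a k * diag_plus d B k l * ?H l b)"
    by (simp add: sum_subtractf algebra_simps)
  also have "(\<Sum>k<K. \<Sum>l<K. ?G a k * diag_plus d' B' k l * ?H l b) = (\<Sum>k<K. ?G a k * (\<Sum>l<K. diag_plus d' B' k l * ?H l b))"
    by (simp add: sum_distrib_left mult.assoc)
  also have "\<dots> = ?G a b"
    using ab by (simp add: inv_fun_right[OF s d'] sum_delta_mult)
  also have "(\<Sum>k<K. \<Sum>l<K. ?G a k * diag_plus d B k l * ?H l b) = (\<Sum>l<K. (\<Sum>k<K. ?G a k * diag_plus d B k l) * ?H l b)"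
    by (simp add: sum_distrib_right mult.assoc) (rule sum.swap)
  also have "\<dots> = ?H a b"
    using ab by (simp add: inv_fun_left[OF s d] sum_delta_mult)
  finally show ?thesis by simp
qed

text \<open>By the Leibniz formula a determinant is a polynomial in the entries, and a cofactor is,
  up to sign, the determinant of a minor whose entries are entries of \<open>L\<close> at shifted
  indices.\<close>

lemma inv_fun_measurable:
  assumes "\<And>i j. i < K \<Longrightarrow> j < K \<Longrightarrow> (\<lambda>\<omega>. L \<omega> i j) \<in> borel_measurable M"
  shows "(\<lambda>\<omega>. inv_fun K (L \<omega>) a b) \<in> borel_measurable M"
proof (cases "a < K \<and> b < K")
  case True
  have det_meas: "(\<lambda>\<omega>. Determinant.det (Matrix.mat m m (\<lambda>(i, j). F \<omega> i j))) \<in> borel_measurable M"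
    if "\<And>i j. i < m \<Longrightarrow> j < m \<Longrightarrow> (\<lambda>\<omega>. F \<omega> i j) \<in> borel_measurable M"
    for m and F :: "_ \<Rightarrow> nat \<Rightarrow> nat \<Rightarrow> real"
  proof -
    have "(\<lambda>\<omega>. Determinant.det (Matrix.mat m m (\<lambda>(i, j). F \<omega> i j))) =
       (\<lambda>\<omega>. \<Sum>p | p permutes {0..<m}. signof p * (\<Prod>i = 0..<m. F \<omega> i (p i)))"
    proof
      fix \<omega>
      have "i < m \<Longrightarrow> p permutes {0..<m} \<Longrightarrow> p i < m" for i p
        using permutes_in_image[of p "{0..<m}" i] by auto
      thus "Determinant.det (Matrix.mat m m (\<lambda>(i, j). F \<omega> i j)) =
        (\<Sum>p | p permutes {0..<m}. signof p * (\<Prod>i = 0..<m. F \<omega> i (p i)))"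
        by (subst det_def'[of _ m]) (auto intro!: sum.cong prod.cong)
    qed
    moreover have "i < m \<Longrightarrow> p permutes {0..<m} \<Longrightarrow> p i < m" for i p
      using permutes_in_image[of p "{0..<m}" i] by auto
    ultimately show ?thesis
      using that by (auto intro!: borel_measurable_sum borel_measurable_times borel_measurable_prod)
  qed
  have "mat_delete (Matrix.mat K K (\<lambda>(i, j). L \<omega> i j)) b a =
      Matrix.mat (K - 1) (K - 1) (\<lambda>(i, j). L \<omega> (if i < b then i else Suc i) (if j < a then j else Suc j))" for \<omega>
    unfolding mat_delete_def by (rule eq_matI) auto
  hence "inv_fun K (L \<omega>) a b = (-1) ^ (b + a) *
      Determinant.det (Matrix.mat (K - 1) (K - 1) (\<lambda>(i, j). L \<omega> (if i < b then i else Suc i) (if j < a then j else Suc j)))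
      / Determinant.det (Matrix.mat K K (\<lambda>(i, j). L \<omega> i j))" for \<omega>
    using True by (simp add: inv_fun_def adj_mat_def cofactor_def)
  thus ?thesis
    using True by (auto intro!: borel_measurable_divide borel_measurable_times det_meas assms)
qed (simp add: inv_fun_outside)

section \<open>Finite product measures\<close>

text \<open>Bias-variance decomposition. With two different centres \<open>c\<close> it lets
  \<open>efron_stein\<close> compare the second moment about the global mean with the one about a
  reference value.\<close>

lemma (in prob_space) second_moment_about:
  fixes X :: "'a \<Rightarrow> real"
  assumes [measurable]: "X \<in> borel_measurable M" and bd: "\<And>x. x \<in> space M \<Longrightarrow> \<bar>X x\<bar> \<le> C"
  shows "(\<integral>x. (X x - c)\<^sup>2 \<partial>M) = (\<integral>x. (X x - expectation X)\<^sup>2 \<partial>M) + (expectation X - c)\<^sup>2"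
proof -
  have [simp]: "integrable M X"
    by (rule integrable_const_bound[of _ C]) (auto simp: bd)
  have [simp]: "integrable M (\<lambda>x. (X x)\<^sup>2)"
  proof (rule integrable_const_bound[of _ "C\<^sup>2"])
    show "AE x in M. norm ((X x)\<^sup>2) \<le> C\<^sup>2"
      using bd abs_le_square_iff by (intro AE_I2) (fastforce simp: abs_le_square_iff[symmetric])
  qed simp
  have *: "(\<integral>x. (X x - k)\<^sup>2 \<partial>M) = expectation (\<lambda>x. (X x)\<^sup>2) - 2 * k * expectation X + k\<^sup>2" for k
  proof -
    have "(\<lambda>x. (X x - k)\<^sup>2) = (\<lambda>x. ((X x)\<^sup>2 - (2 * k) * X x) + k\<^sup>2)"
      by (auto simp: power2_eq_square algebra_simps)
    thus ?thesis by (simp add: prob_space)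
  qed
  show ?thesis unfolding * by (simp add: power2_eq_square algebra_simps)
qed

lemma (in prob_space) expectation_square_le:
  fixes X :: "'a \<Rightarrow> real"
  assumes "X \<in> borel_measurable M" and "\<And>x. x \<in> space M \<Longrightarrow> \<bar>X x\<bar> \<le> C"
  shows "(expectation X)\<^sup>2 \<le> expectation (\<lambda>x. (X x)\<^sup>2)"
  using second_moment_about[OF assms, of 0] by (auto intro!: integral_nonneg_AE)

lemma measurable_coordinate_update:
  assumes "e \<in> J" "a \<in> space (M e)"
  shows "(\<lambda>x. x(e := a)) \<in> measurable (PiM J M) (PiM J M)"
  by (rule measurable_fun_upd[of J J e]) (use assms in auto)

text \<open>Fubini for one coordinate, bundled with the measurability and the uniform bounds that
  make all the integrals exist. \<open>efron_stein\<close> applies it to \<open>f\<close> and to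
  several squared differences.\<close>

lemma PiM_integral_insert_bounded:
  fixes F :: "('i \<Rightarrow> 'a) \<Rightarrow> real"
  assumes prob: "\<And>i. prob_space (M i)" and J: "finite J" "i \<notin> J"
    and F [measurable]: "F \<in> borel_measurable (PiM (insert i J) M)"
    and bd: "\<forall>x\<in>space (PiM (insert i J) M). \<bar>F x\<bar> \<le> C"
  shows "integral\<^sup>L (PiM (insert i J) M) F = (\<integral>x. (\<integral>y. F (x(i := y)) \<partial>M i) \<partial>PiM J M)"
    and "(\<lambda>x. \<integral>y. F (x(i := y)) \<partial>M i) \<in> borel_measurable (PiM J M)"
    and "\<And>x. x \<in> space (PiM J M) \<Longrightarrow> (\<lambda>y. F (x(i := y))) \<in> borel_measurable (M i)"
    and "\<And>x y. x \<in> space (PiM J M) \<Longrightarrow> y \<in> space (M i) \<Longrightarrow> \<bar>F (x(i := y))\<bar> \<le> C"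
    and "\<And>x. x \<in> space (PiM J M) \<Longrightarrow> \<bar>\<integral>y. F (x(i := y)) \<partial>M i\<bar> \<le> C"
proof -
  interpret Mi: prob_space "M i" by (rule prob)
  interpret product_prob_space M J
    by (rule product_prob_spaceI) (rule prob)
  interpret PI: prob_space "PiM (insert i J) M" by (rule prob_space_PiM) (rule prob)
  have "integrable (PiM (insert i J) M) F"
    by (rule PI.integrable_const_bound[of _ C]) (auto simp: bd)
  thus "integral\<^sup>L (PiM (insert i J) M) F = (\<integral>x. (\<integral>y. F (x(i := y)) \<partial>M i) \<partial>PiM J M)"
    by (rule product_integral_insert[OF J])
  have *: "(\<lambda>(x, y). F (x(i := y))) \<in> borel_measurable (PiM J M \<Otimes>\<^sub>M M i)"
    using measurable_comp[OF measurable_add_dim[of i J M] F]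
    by (simp add: comp_def case_prod_unfold)
  from Mi.borel_measurable_lebesgue_integral[OF this]
  show "(\<lambda>x. \<integral>y. F (x(i := y)) \<partial>M i) \<in> borel_measurable (PiM J M)" .
  have up: "x(i := y) \<in> space (PiM (insert i J) M)" if "x \<in> space (PiM J M)" "y \<in> space (M i)" for x y
    using that by (auto simp: space_PiM PiE_def extensional_def Pi_def)
  show meas: "\<And>x. x \<in> space (PiM J M) \<Longrightarrow> (\<lambda>y. F (x(i := y))) \<in> borel_measurable (M i)"
    using measurable_compose[OF measurable_Pair1' *] by fastforce
  show bd': "\<And>x y. x \<in> space (PiM J M) \<Longrightarrow> y \<in> space (M i) \<Longrightarrow> \<bar>F (x(i := y))\<bar> \<le> C"
    using up bd by blast
  fix x assume x: "x \<in> space (PiM J M)"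
  have int: "integrable (M i) (\<lambda>y. F (x(i := y)))"
    by (rule Mi.integrable_const_bound[of _ C]) (use meas bd' x in auto)
  have "\<bar>\<integral>y. F (x(i := y)) \<partial>M i\<bar> \<le> (\<integral>y. \<bar>F (x(i := y))\<bar> \<partial>M i)"
    by (rule integral_abs_bound)
  also have "\<dots> \<le> (\<integral>y. C \<partial>M i)"
    by (rule integral_mono) (use int bd' x in auto)
  finally show "\<bar>\<integral>y. F (x(i := y)) \<partial>M i\<bar> \<le> C" by (simp add: Mi.prob_space)
qed

text \<open>Increments are taken towards a fixed value \<open>a i\<close> instead of an independent
  copy: a second moment about any point dominates the variance in that coordinate. Induction on the
  coordinates splits the variance into the mean of the variance in coordinate i and the variance of
  the average over i, to which the induction hypothesis applies.\<close>

theorem efron_stein: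
  fixes M :: "'i \<Rightarrow> 'a measure" and f :: "('i \<Rightarrow> 'a) \<Rightarrow> real"
  assumes prob: "\<And>i. prob_space (M i)" and "finite J" and a: "\<And>i. a i \<in> space (M i)"
    and "f \<in> borel_measurable (PiM J M)" "\<And>x. x \<in> space (PiM J M) \<Longrightarrow> \<bar>f x\<bar> \<le> C"
  shows "(\<integral>x. (f x - integral\<^sup>L (PiM J M) f)\<^sup>2 \<partial>PiM J M) \<le> (\<Sum>i\<in>J. \<integral>x. (f x - f (x(i := a i)))\<^sup>2 \<partial>PiM J M)"
  using assms(2,4,5)
proof (induction J arbitrary: f rule: finite_induct)
  case (empty f)
  interpret P: prob_space "PiM {} M" by (rule prob_space_PiM) (rule prob)
  let ?c = "f (\<lambda>_. undefined)"
  have "integral\<^sup>L (PiM {} M) f = (\<integral>x. ?c \<partial>PiM {} M)"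
    by (rule Bochner_Integration.integral_cong) (auto simp: space_PiM)
  hence "integral\<^sup>L (PiM {} M) f = ?c" by (simp add: P.prob_space)
  hence "(\<integral>x. (f x - integral\<^sup>L (PiM {} M) f)\<^sup>2 \<partial>PiM {} M) = (\<integral>x. 0 \<partial>PiM {} M)"
    by (intro Bochner_Integration.integral_cong) (auto simp: space_PiM)
  thus ?case by simp
next
  case (insert i J f)
  note f [measurable] = insert.prems(1) and bd = insert.prems(2)
  let ?P = "PiM J M" and ?P' = "PiM (insert i J) M"
  define g where "g x = (\<integral>y. f (x(i := y)) \<partial>M i)" for x
  define m where "m = integral\<^sup>L ?P' f"
  interpret Mi: prob_space "M i" by (rule prob)
  interpret P: prob_space ?P by (rule prob_space_PiM) (rule prob)
  note fub = PiM_integral_insert_bounded[where M = M, OF prob insert.hyps]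
  have "\<forall>x\<in>space ?P'. \<bar>f x\<bar> \<le> C" using bd by blast
  note ff = fub[where F = f and C = C, OF f this]
  have bdi: "\<bar>F\<bar> \<le> C \<Longrightarrow> \<bar>G\<bar> \<le> C \<Longrightarrow> \<bar>(F - G)\<^sup>2\<bar> \<le> (2 * C)\<^sup>2" for F G :: real
    using abs_le_square_iff[of "F - G" "2 * C"] by auto
  have [measurable]: "g \<in> borel_measurable ?P" unfolding g_def using ff(2) .
  have g_bd: "\<bar>g x\<bar> \<le> C" if "x \<in> space ?P" for x
    unfolding g_def using ff(5)[OF that] .
  have m: "m = integral\<^sup>L ?P g" unfolding m_def g_def using ff(1) .
  have m_bd: "\<bar>m\<bar> \<le> C"
  proof -
    have "\<bar>m\<bar> \<le> (\<integral>x. \<bar>g x\<bar> \<partial>?P)" unfolding m by (rule integral_abs_bound)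
    also have "\<dots> \<le> (\<integral>x. C \<partial>?P)"
      by (rule integral_mono) (auto intro!: P.integrable_const_bound[of _ C] simp: g_bd)
    finally show ?thesis by (simp add: P.prob_space)
  qed
  have upd_sp: "x(e := a e) \<in> space (PiM L M)" if "e \<in> L" "x \<in> space (PiM L M)" for e x L
    by (rule measurable_space[OF measurable_coordinate_update that(2)]) (use that(1) a in auto)
  have [measurable]: "(\<lambda>x. f (x(e := a e))) \<in> borel_measurable ?P'" if "e \<in> insert i J" for e
    by (rule measurable_compose[OF measurable_coordinate_update[OF that a] f])
  have [measurable]: "(\<lambda>x. g (x(e := a e))) \<in> borel_measurable ?P" if "e \<in> J" for e
    by (rule measurable_compose[OF measurable_coordinate_update[OF that a]]) measurable
  define h where "h e x = (\<integral>y. (f (x(i := y)) - f ((x(i := y))(e := a e)))\<^sup>2 \<partial>M i)" for e x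
  have h: "(\<integral>x. (f x - f (x(e := a e)))\<^sup>2 \<partial>?P') = (\<integral>x. h e x \<partial>?P)"
    "h e \<in> borel_measurable ?P" "\<And>x. x \<in> space ?P \<Longrightarrow> \<bar>h e x\<bar> \<le> (2 * C)\<^sup>2"
    if "e \<in> insert i J" for e
  proof -
    have bb: "\<forall>x\<in>space ?P'. \<bar>(f x - f (x(e := a e)))\<^sup>2\<bar> \<le> (2 * C)\<^sup>2"
      using bdi bd upd_sp[OF \<open>e \<in> insert i J\<close>] by blast
    have mm: "(\<lambda>x. (f x - f (x(e := a e)))\<^sup>2) \<in> borel_measurable ?P'"
      using that by measurable
    show "(\<integral>x. (f x - f (x(e := a e)))\<^sup>2 \<partial>?P') = (\<integral>x. h e x \<partial>?P)"
      unfolding h_def by (rule fub(1)[OF mm bb])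
    show "h e \<in> borel_measurable ?P"
      unfolding h_def by (rule fub(2)[OF mm bb])
    show "\<And>x. x \<in> space ?P \<Longrightarrow> \<bar>h e x\<bar> \<le> (2 * C)\<^sup>2"
      unfolding h_def by (rule fub(5)[OF mm bb])
  qed
  have h_int: "integrable ?P (h e)" if "e \<in> insert i J" for e
    by (rule P.integrable_const_bound[of _ "(2 * C)\<^sup>2"]) (use h[OF that] in auto)
  have g_int: "integrable ?P (\<lambda>x. (g x - m)\<^sup>2)"
    by (rule P.integrable_const_bound[of _ "(2 * C)\<^sup>2"]) (use bdi g_bd m_bd in auto)
  have meas2: "(\<lambda>x. (f x - m)\<^sup>2) \<in> borel_measurable ?P'" by measurable
  have bd2: "\<forall>x\<in>space ?P'. \<bar>(f x - m)\<^sup>2\<bar> \<le> (2 * C)\<^sup>2"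
    using bdi bd m_bd by blast
  have "(\<integral>x. (f x - m)\<^sup>2 \<partial>?P') = (\<integral>x. (\<integral>y. (f (x(i := y)) - m)\<^sup>2 \<partial>M i) \<partial>?P)"
    by (rule fub(1)[OF meas2 bd2])
  also have "\<dots> \<le> (\<integral>x. h i x + (g x - m)\<^sup>2 \<partial>?P)"
  proof (rule integral_mono)
    show "integrable ?P (\<lambda>x. \<integral>y. (f (x(i := y)) - m)\<^sup>2 \<partial>M i)"
      by (rule P.integrable_const_bound[of _ "(2 * C)\<^sup>2"]) (use fub(2,5)[OF meas2 bd2] in auto)
    show "integrable ?P (\<lambda>x. h i x + (g x - m)\<^sup>2)" using h_int g_int by auto
    fix x assume x: "x \<in> space ?P"
    \<comment> \<open>Used with two centres: about f (x(i := a i)) it bounds the variance in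
      coordinate i by \<open>h i x\<close>, about \<open>m\<close> it splits off (g x -
      m)^2.\<close>
    note ma = Mi.second_moment_about[OF ff(3)[OF x] ff(4)[OF x]]
    have "h i x = (\<integral>y. (f (x(i := y)) - f (x(i := a i)))\<^sup>2 \<partial>M i)"
      by (simp add: h_def)
    with ma[of "f (x(i := a i))"] ma[of m]
    show "(\<integral>y. (f (x(i := y)) - m)\<^sup>2 \<partial>M i) \<le> h i x + (g x - m)\<^sup>2"
      by (simp add: g_def)
  qed
  also have "\<dots> = (\<integral>x. h i x \<partial>?P) + (\<integral>x. (g x - m)\<^sup>2 \<partial>?P)"
    using h_int g_int by simp
  also have "(\<integral>x. (g x - m)\<^sup>2 \<partial>?P) \<le> (\<Sum>e\<in>J. \<integral>x. (g x - g (x(e := a e)))\<^sup>2 \<partial>?P)"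
    unfolding m by (rule insert.IH) (use g_bd in auto)
  also have "\<dots> \<le> (\<Sum>e\<in>J. \<integral>x. h e x \<partial>?P)"
  proof (intro sum_mono integral_mono)
    fix e assume e: "e \<in> J"
    show "integrable ?P (\<lambda>x. (g x - g (x(e := a e)))\<^sup>2)"
      by (rule P.integrable_const_bound[of _ "(2 * C)\<^sup>2"]) (use e bdi g_bd upd_sp in auto)
    show "integrable ?P (h e)" using h_int e by auto
    fix x assume x: "x \<in> space ?P"
    have x': "x(e := a e) \<in> space ?P" by (rule upd_sp[OF e x])
    have int: "integrable (M i) (\<lambda>y. f (z(i := y)))" if "z \<in> space ?P" for z
      by (rule Mi.integrable_const_bound[of _ C]) (use ff(3,4)[OF that] in auto)
    have ne: "i \<noteq> e" using e insert.hyps by auto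
    have "(g x - g (x(e := a e)))\<^sup>2 = (\<integral>y. f (x(i := y)) - f ((x(e := a e))(i := y)) \<partial>M i)\<^sup>2"
      using int[OF x] int[OF x'] by (simp add: g_def)
    \<comment> \<open>Jensen: averaging over coordinate i does not increase the squared increment in
      coordinate e.\<close>
    also have "\<dots> \<le> (\<integral>y. (f (x(i := y)) - f ((x(e := a e))(i := y)))\<^sup>2 \<partial>M i)"
    proof (rule Mi.expectation_square_le[of _ "2 * C"])
      show "(\<lambda>y. f (x(i := y)) - f ((x(e := a e))(i := y))) \<in> borel_measurable (M i)"
        using ff(3)[OF x] ff(3)[OF x'] by measurable
      show "\<And>y. y \<in> space (M i) \<Longrightarrow> \<bar>f (x(i := y)) - f ((x(e := a e))(i := y))\<bar> \<le> 2 * C"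
        using ff(4)[OF x] ff(4)[OF x'] by (smt (verit, best))
    qed
    also have "\<dots> = h e x"
      unfolding h_def fun_upd_twist[OF ne] ..
    finally show "(g x - g (x(e := a e)))\<^sup>2 \<le> h e x" .
  qed
  also have "(\<integral>x. h i x \<partial>?P) + (\<Sum>e\<in>J. \<integral>x. h e x \<partial>?P) = (\<Sum>e\<in>insert i J. \<integral>x. (f x - f (x(e := a e)))\<^sup>2 \<partial>?P')"
    using insert.hyps by (simp add: h(1) cong: sum.cong)
  finally show ?case unfolding m_def by (simp del: fun_upd_apply)
qed

text \<open>Factorisation for independent factors; that \<phi> ignores coordinate e is expressed by
  invariance under updates. \<open>g\<close> may be unbounded, so the product is dominated by C
  |g|.\<close>

lemma PiM_integral_coordinate_split:
  fixes M :: "'i \<Rightarrow> 'a measure" and \<phi> :: "('i \<Rightarrow> 'a) \<Rightarrow> real" and g :: "'a \<Rightarrow> real"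
  assumes prob: "\<And>i. prob_space (M i)" and J: "finite J" "e \<in> J"
    and g: "integrable (M e) g"
    and \<phi> [measurable]: "\<phi> \<in> borel_measurable (PiM J M)"
    and bd: "\<And>x. x \<in> space (PiM J M) \<Longrightarrow> \<bar>\<phi> x\<bar> \<le> C"
    and indep: "\<And>x y. x \<in> space (PiM J M) \<Longrightarrow> y \<in> space (M e) \<Longrightarrow> \<phi> (x(e := y)) = \<phi> x"
  shows "integrable (PiM J M) (\<lambda>x. g (x e) * \<phi> x)"
    and "(\<integral>x. g (x e) * \<phi> x \<partial>PiM J M) = integral\<^sup>L (M e) g * integral\<^sup>L (PiM J M) \<phi>"
proof -
  interpret Me: prob_space "M e" by (rule prob)
  interpret product_prob_space M J
    by (rule product_prob_spaceI) (rule prob)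
  define J' where "J' = J - {e}"
  have J': "finite J'" "e \<notin> J'" "J = insert e J'" using J by (auto simp: J'_def)
  have "integrable (distr (PiM J M) (M e) (\<lambda>\<omega>. \<omega> e)) g"
    using g PiM_component[OF J(2)] by simp
  hence ge: "integrable (PiM J M) (\<lambda>x. g (x e))"
    by (rule integrable_distr[OF measurable_component_singleton[OF J(2)]])
  have [measurable]: "(\<lambda>x. g (x e)) \<in> borel_measurable (PiM J M)" using ge by auto
  show int: "integrable (PiM J M) (\<lambda>x. g (x e) * \<phi> x)"
  proof (rule Bochner_Integration.integrable_bound)
    show "integrable (PiM J M) (\<lambda>x. C * g (x e))" using ge by simp
    show "AE x in PiM J M. norm (g (x e) * \<phi> x) \<le> norm (C * g (x e))"
    proof (rule AE_I2)
      fix x assume "x \<in> space (PiM J M)"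
      from bd[OF this] have "\<bar>\<phi> x\<bar> \<le> \<bar>C\<bar>" by linarith
      thus "norm (g (x e) * \<phi> x) \<le> norm (C * g (x e))"
        by (simp add: abs_mult mult.commute[of "\<bar>C\<bar>"] mult_left_mono)
    qed
  qed measurable
  \<comment> \<open>A dummy value for coordinate e: it moves the argument of \<phi> into the full
    product space without affecting the value of \<phi>.\<close>
  obtain a where a: "a \<in> space (M e)" using Me.not_empty by auto
  have up: "x(e := y) \<in> space (PiM J M)" if "x \<in> space (PiM J' M)" "y \<in> space (M e)" for x y
    using that unfolding J'(3) by (auto simp: space_PiM PiE_def extensional_def Pi_def)
  have eq: "\<phi> (x(e := y)) = \<phi> (x(e := a))" if "x \<in> space (PiM J' M)" "y \<in> space (M e)" for x y
    using indep[OF up[OF that(1) a] that(2)] by simp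
  have "(\<integral>x. g (x e) * \<phi> x \<partial>PiM J M) = (\<integral>x. (\<integral>y. g y * \<phi> (x(e := y)) \<partial>M e) \<partial>PiM J' M)"
    using product_integral_insert[OF J'(1,2), of "\<lambda>x. g (x e) * \<phi> x"] int unfolding J'(3) by simp
  also have "\<dots> = (\<integral>x. (\<integral>y. g y * \<phi> (x(e := a)) \<partial>M e) \<partial>PiM J' M)"
    by (intro Bochner_Integration.integral_cong refl) (simp add: eq)
  also have "\<dots> = integral\<^sup>L (M e) g * (\<integral>x. \<phi> (x(e := a)) \<partial>PiM J' M)" by simp
  also have "(\<integral>x. \<phi> (x(e := a)) \<partial>PiM J' M) = (\<integral>x. (\<integral>y. \<phi> (x(e := y)) \<partial>M e) \<partial>PiM J' M)"
  proof (rule Bochner_Integration.integral_cong[OF refl])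
    fix x assume "x \<in> space (PiM J' M)"
    hence "(\<integral>y. \<phi> (x(e := y)) \<partial>M e) = (\<integral>y. \<phi> (x(e := a)) \<partial>M e)"
      by (intro Bochner_Integration.integral_cong refl) (simp add: eq)
    thus "\<phi> (x(e := a)) = (\<integral>y. \<phi> (x(e := y)) \<partial>M e)" by (simp add: Me.prob_space)
  qed
  also have "\<dots> = integral\<^sup>L (PiM J M) \<phi>"
    using PiM_integral_insert_bounded(1)[where M = M and F = \<phi> and C = C, OF prob J'(1,2)] \<phi> bd unfolding J'(3) by simp
  finally show "(\<integral>x. g (x e) * \<phi> x \<partial>PiM J M) = integral\<^sup>L (M e) g * integral\<^sup>L (PiM J M) \<phi>" .
qed

section \<open>Random skew matrices\<close>

text \<open>With inverses for \<open>A\<close> and \<open>R\<close>, such products are what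
  differentiating a trace weighted by \<open>D\<close> produces; the weight stays between the two
  factors.\<close>

definition wprod :: "nat \<Rightarrow> (nat \<Rightarrow> nat \<Rightarrow> real) \<Rightarrow> (nat \<Rightarrow> real) \<Rightarrow> (nat \<Rightarrow> nat \<Rightarrow> real) \<Rightarrow> nat \<Rightarrow> nat \<Rightarrow> real" where
  "wprod K A D R a b = (\<Sum>k<K. A a k * D k * R k b)"

text \<open>Cauchy-Schwarz for a row of \<open>A\<close> against a column of \<open>R\<close>;
  weights of modulus at most 1 do not enlarge it.\<close>

lemma wprod_abs_le:
  assumes A: "(\<Sum>k<K. (A a k)\<^sup>2) \<le> \<alpha>\<^sup>2" and R: "(\<Sum>k<K. (R k b)\<^sup>2) \<le> \<rho>\<^sup>2"
    and D: "\<forall>k. \<bar>D k\<bar> \<le> 1" and nn: "0 \<le> \<alpha>" "0 \<le> \<rho>"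
  shows "\<bar>wprod K A D R a b\<bar> \<le> \<alpha> * \<rho>"
proof -
  have "(wprod K A D R a b)\<^sup>2 \<le> (\<Sum>k<K. (A a k)\<^sup>2) * (\<Sum>k<K. (D k * R k b)\<^sup>2)"
    using Cauchy_Schwarz_ineq_sum[of "\<lambda>k. A a k" "\<lambda>k. D k * R k b" "{..<K}"]
    by (simp add: wprod_def mult.assoc)
  also have "(\<Sum>k<K. (D k * R k b)\<^sup>2) \<le> (\<Sum>k<K. (R k b)\<^sup>2)"
  proof (rule sum_mono)
    fix k
    have "(D k)\<^sup>2 \<le> 1" using D by (simp add: abs_square_le_1)
    thus "(D k * R k b)\<^sup>2 \<le> (R k b)\<^sup>2"
      by (simp add: power_mult_distrib mult_left_le_one_le)
  qed
  also have "(\<Sum>k<K. (A a k)\<^sup>2) * (\<Sum>k<K. (R k b)\<^sup>2) \<le> \<alpha>\<^sup>2 * \<rho>\<^sup>2"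
    using A R by (intro mult_mono) (auto intro: sum_nonneg)
  finally have "(wprod K A D R a b)\<^sup>2 \<le> (\<alpha> * \<rho>)\<^sup>2"
    by (simp add: power_mult_distrib mult_left_mono sum_nonneg)
  thus ?thesis using nn abs_le_square_iff[of "wprod K A D R a b" "\<alpha> * \<rho>"] by simp
qed

text \<open>\<open>E\<close> holds the positions of the random entries above the diagonal, so each
  variable occurs once, together with its negative below the diagonal. \<open>h\<close> is the scale
  of the entries, \<kappa> a scale-free moment constant, and \<open>b\<close> dominates the sum of
  the variances along any row. All final bounds are in terms of s, h, \<kappa> and b; the dimension
  K does not occur in them.\<close>

locale skew_ensemble =
  fixes K :: nat and s :: real and B :: "nat \<Rightarrow> nat \<Rightarrow> real" and E :: "(nat \<times> nat) set"
    and \<mu> :: "nat \<times> nat \<Rightarrow> real measure" and h \<kappa> b :: real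
  assumes s_pos: "0 < s" and B_skew: "\<And>i j. B i j = - B j i"
    and E_sub: "\<And>p q. (p, q) \<in> E \<Longrightarrow> p < q \<and> q < K"
    and prob_\<mu>: "\<And>e. prob_space (\<mu> e)" and sets_\<mu>: "\<And>e. sets (\<mu> e) = sets borel"
    and mean: "\<And>e. e \<in> E \<Longrightarrow> (\<integral>x. x \<partial>\<mu> e) = 0"
    and second: "\<And>e. e \<in> E \<Longrightarrow> (\<integral>x. x\<^sup>2 \<partial>\<mu> e) \<le> h\<^sup>2"
    and third: "\<And>e. e \<in> E \<Longrightarrow> (\<integral>x. \<bar>x\<bar> ^ 3 \<partial>\<mu> e) \<le> \<kappa> * h ^ 3"
    and fourth: "\<And>e. e \<in> E \<Longrightarrow> (\<integral>x. x ^ 4 \<partial>\<mu> e) \<le> \<kappa> * h ^ 4"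
    and fourth_int: "\<And>e. e \<in> E \<Longrightarrow> integrable (\<mu> e) (\<lambda>x. x ^ 4)"
    and h_pos: "0 < h" and \<kappa>_nonneg: "0 \<le> \<kappa>" and Kh: "real K * h\<^sup>2 \<le> b"
begin

declare fun_upd_apply [simp del] \<comment> \<open>would rewrite inside \<open>G (y(e := 0))\<close>\<close>

definition S :: "(nat \<times> nat \<Rightarrow> real) \<Rightarrow> nat \<Rightarrow> nat \<Rightarrow> real" where
  "S y p q = B p q + (if (p, q) \<in> E then y (p, q) else 0) - (if (q, p) \<in> E then y (q, p) else 0)"

definition G :: "(nat \<times> nat \<Rightarrow> real) \<Rightarrow> nat \<Rightarrow> nat \<Rightarrow> real" where
  "G y = inv_fun K (diag_plus (\<lambda>_. s) (S y))"

definition \<P> :: "(nat \<times> nat \<Rightarrow> real) measure" where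
  "\<P> = PiM E \<mu>"

definition w :: "nat \<times> nat \<Rightarrow> real" where
  "w e = (\<integral>x. x\<^sup>2 \<partial>\<mu> e)"

text \<open>At most one summand is nonzero, because edges are ordered pairs p < q; the result is the
  symmetric variance profile of the whole skew matrix.\<close>

definition v :: "nat \<Rightarrow> nat \<Rightarrow> real" where
  "v p q = (if (p, q) \<in> E then w (p, q) else 0) + (if (q, p) \<in> E then w (q, p) else 0)"

text \<open>The first term is K h^2 times the Frobenius bound 1 / s^4, from the linear part of the
  increments. The second collects K^2 h^4: 32 \<kappa> from the quadratic part, and 256 = 2 * 4 * 32
  from restoring the removed entry in two matrix entries.\<close>

definition var_const :: real where
  "var_const = 8 * b / s ^ 4 + (256 + 32 * \<kappa>) * b\<^sup>2 / s ^ 6"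

lemma S_skew: "S y p q = - S y q p"
  using B_skew[of p q] by (simp add: S_def)

lemmas G_abs_le =
  inv_fun_abs_le[where d = "\<lambda>_. s" and s = s and K = K and B = "S y" for y, OF s_pos order.refl S_skew, folded G_def]
lemmas G_row =
  inv_fun_row_bound[where d = "\<lambda>_. s" and s = s and K = K and B = "S y" for y, OF s_pos order.refl S_skew, folded G_def]
lemmas G_col =
  inv_fun_col_bound[where d = "\<lambda>_. s" and s = s and K = K and B = "S y" for y, OF s_pos order.refl S_skew, folded G_def]
lemmas G_op =
  inv_fun_op_bound[where d = "\<lambda>_. s" and s = s and K = K and B = "S y" for y, OF s_pos order.refl S_skew, folded G_def]
lemmas G_nonneg =
  inv_fun_diag_nonneg[where d = "\<lambda>_. s" and s = s and K = K and B = "S y" for y, OF s_pos order.refl S_skew, folded G_def]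

lemma G_outside: "\<not> (a < K \<and> c < K) \<Longrightarrow> G y a c = 0"
  by (simp add: G_def inv_fun_outside)

lemma E_lt: "e \<in> E \<Longrightarrow> fst e < K" "e \<in> E \<Longrightarrow> snd e < K" "e \<in> E \<Longrightarrow> fst e \<noteq> snd e"
  using E_sub[of "fst e" "snd e"] by auto

lemma finite_E: "finite E"
  by (rule finite_subset[of _ "{..<K} \<times> {..<K}"]) (use E_lt in auto)

lemma card_E: "card E \<le> K\<^sup>2"
proof -
  have "card E \<le> card ({..<K} \<times> {..<K})"
    by (rule card_mono) (use E_lt in auto)
  thus ?thesis by (simp add: card_cartesian_product power2_eq_square)
qed

section \<open>Sums over edges and the effect of changing a single entry\<close>

lemma edge_sum:
  fixes F :: "nat \<Rightarrow> nat \<Rightarrow> real"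
  shows "(\<Sum>i<K. \<Sum>j<K. if (i, j) \<in> E then F i j else 0) = (\<Sum>e\<in>E. F (fst e) (snd e))"
proof -
  have "(\<Sum>i<K. \<Sum>j<K. if (i, j) \<in> E then F i j else 0)
      = (\<Sum>e\<in>{..<K} \<times> {..<K}. if e \<in> E then F (fst e) (snd e) else 0)"
    by (simp add: sum.cartesian_product case_prod_unfold)
  also have "\<dots> = (\<Sum>e\<in>({..<K} \<times> {..<K}) \<inter> E. F (fst e) (snd e))"
    by (rule sum.inter_restrict[symmetric]) simp
  also have "({..<K} \<times> {..<K}) \<inter> E = E" using E_lt by auto
  finally show ?thesis .
qed

text \<open>Every ordered pair of indices is met at most once on the left, since edges satisfy p <
  q. This is how sums over random entries become squared Frobenius norms.\<close>

lemma edge_sum_le: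
  fixes F :: "nat \<Rightarrow> nat \<Rightarrow> real"
  assumes "\<And>i j. 0 \<le> F i j"
  shows "(\<Sum>e\<in>E. F (fst e) (snd e) + F (snd e) (fst e)) \<le> (\<Sum>i<K. \<Sum>j<K. F i j)"
proof -
  have "(\<Sum>e\<in>E. F (fst e) (snd e) + F (snd e) (fst e))
     = (\<Sum>i<K. \<Sum>j<K. if (i, j) \<in> E then F i j else 0) + (\<Sum>i<K. \<Sum>j<K. if (i, j) \<in> E then F j i else 0)"
    by (simp add: edge_sum sum.distrib)
  also have "(\<Sum>i<K. \<Sum>j<K. if (i, j) \<in> E then F j i else 0) = (\<Sum>i<K. \<Sum>j<K. if (j, i) \<in> E then F i j else 0)"
    by (rule sum.swap)
  also have "(\<Sum>i<K. \<Sum>j<K. if (i, j) \<in> E then F i j else 0) + (\<Sum>i<K. \<Sum>j<K. if (j, i) \<in> E then F i j else 0)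
      \<le> (\<Sum>i<K. \<Sum>j<K. F i j)"
    unfolding sum.distrib[symmetric]
    using assms E_sub by (intro sum_mono) (fastforce dest: E_sub)
  finally show ?thesis .
qed

text \<open>One entry occurs at two positions of the skew matrix, so its change is a rank-two
  perturbation and the resolvent identity reduces to two terms. The formula is exact, with the old
  inverse still on the right, and iterating it gives expansions of higher order.\<close>

lemma G_update:
  assumes e: "e = (p, q)" "e \<in> E"
  shows "G y a c = G (y(e := u)) a c
    - (y e - u) * (G (y(e := u)) a p * G y q c - G (y(e := u)) a q * G y p c)"
proof (cases "a < K \<and> c < K")
  case True
  \<comment> \<open>That (q, p) is not an edge matters: each of the two positions of
    \<open>S\<close> then changes through one term only.\<close>
  have pq: "p < K" "q < K" "p \<noteq> q" "(q, p) \<notin> E" using E_sub[of p q] E_sub[of q p] e by auto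
  let ?H = "G (y(e := u))"
  have D: "diag_plus (\<lambda>_. s) (S y) k l - diag_plus (\<lambda>_. s) (S (y(e := u))) k l =
      (if k = p then if l = q then y e - u else 0 else 0) - (if k = q then if l = p then y e - u else 0 else 0)" for k l
    using pq e by (auto simp: diag_plus_def S_def fun_upd_apply)
  have "?H a c - G y a c = (\<Sum>k<K. \<Sum>l<K. ?H a k * (diag_plus (\<lambda>_. s) (S y) k l - diag_plus (\<lambda>_. s) (S (y(e := u))) k l) * G y l c)"
    unfolding G_def
    by (rule inv_fun_resolvent_identity[OF s_pos order.refl S_skew order.refl S_skew]) (use True in auto)
  also have "\<dots> = (\<Sum>k<K. \<Sum>l<K. (if k = p then if l = q then ?H a k * (y e - u) * G y l c else 0 else 0))
      - (\<Sum>k<K. \<Sum>l<K. (if k = q then if l = p then ?H a k * (y e - u) * G y l c else 0 else 0))"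
    unfolding D sum_subtractf[symmetric] by (intro sum.cong refl) (auto simp: algebra_simps)
  also have "(\<Sum>k<K. \<Sum>l<K. (if k = p then if l = q then ?H a k * (y e - u) * G y l c else 0 else 0))
      = (\<Sum>k<K. if k = p then ?H a k * (y e - u) * G y q c else 0)"
    using pq by (intro sum.cong refl) auto
  also have "\<dots> = ?H a p * (y e - u) * G y q c"
    using pq by simp
  also have "(\<Sum>k<K. \<Sum>l<K. (if k = q then if l = p then ?H a k * (y e - u) * G y l c else 0 else 0))
      = (\<Sum>k<K. if k = q then ?H a k * (y e - u) * G y p c else 0)"
    using pq by (intro sum.cong refl) auto
  also have "\<dots> = ?H a q * (y e - u) * G y p c"
    using pq by simp
  finally show ?thesis by (simp add: algebra_simps)
qed (auto simp: G_outside)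

lemma G_update_le:
  assumes e: "e \<in> E"
  shows "\<bar>G y a c - G (y(e := 0)) a c\<bar> \<le> 2 * \<bar>y e\<bar> / s\<^sup>2"
proof -
  obtain p q where pq: "e = (p, q)" by (cases e)
  let ?H = "G (y(e := 0))"
  have "\<bar>?H a p * G y q c - ?H a q * G y p c\<bar> \<le> \<bar>?H a p\<bar> * \<bar>G y q c\<bar> + \<bar>?H a q\<bar> * \<bar>G y p c\<bar>"
    by (metis abs_mult abs_triangle_ineq4)
  also have "\<dots> \<le> (1 / s) * (1 / s) + (1 / s) * (1 / s)"
    by (intro add_mono mult_mono G_abs_le) (use s_pos in auto)
  finally have "\<bar>?H a p * G y q c - ?H a q * G y p c\<bar> \<le> 2 / s\<^sup>2"
    by (simp add: power2_eq_square)
  hence "\<bar>y e\<bar> * \<bar>?H a p * G y q c - ?H a q * G y p c\<bar> \<le> \<bar>y e\<bar> * (2 / s\<^sup>2)"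
    by (intro mult_left_mono) auto
  hence "\<bar>y e * (?H a p * G y q c - ?H a q * G y p c)\<bar> \<le> 2 * \<bar>y e\<bar> / s\<^sup>2"
    by (simp add: abs_mult mult.commute)
  moreover have "G y a c - ?H a c = - y e * (?H a p * G y q c - ?H a q * G y p c)"
    using G_update[OF pq e, of y a c 0] by simp
  ultimately show ?thesis by (metis abs_minus_cancel mult_minus_left)
qed

text \<open>\<open>G_update\<close> multiplied from the right by the weight and \<open>R\<close>.
  The product itself reappears on the right-hand side, so this formula can be iterated as
  well.\<close>

lemma wprod_update_left:
  assumes e: "e = (p, q)" "e \<in> E"
  shows "wprod K (G y) D R a c = wprod K (G (y(e := 0))) D R a c
    - y e * (G (y(e := 0)) a p * wprod K (G y) D R q c - G (y(e := 0)) a q * wprod K (G y) D R p c)"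
proof -
  let ?H = "G (y(e := 0))"
  have "wprod K (G y) D R a c = (\<Sum>k<K. ?H a k * D k * R k c
     - y e * (?H a p * (G y q k * D k * R k c) - ?H a q * (G y p k * D k * R k c)))"
    unfolding wprod_def
    by (intro sum.cong refl) (subst G_update[OF e, of y _ _ 0], simp add: algebra_simps)
  thus ?thesis
    by (simp only: wprod_def sum_subtractf sum_distrib_left[symmetric])
qed

lemma wprod_update_right:
  assumes e: "e = (p, q)" "e \<in> E"
  shows "wprod K A D (G y) a c = wprod K A D (G (y(e := 0))) a c
    - y e * (wprod K A D (G (y(e := 0))) a p * G y q c - wprod K A D (G (y(e := 0))) a q * G y p c)"
proof -
  let ?H = "G (y(e := 0))"
  have "wprod K A D (G y) a c = (\<Sum>k<K. A a k * D k * ?H k c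
     - y e * ((A a k * D k * ?H k p) * G y q c - (A a k * D k * ?H k q) * G y p c))"
    unfolding wprod_def
    by (intro sum.cong refl) (subst G_update[OF e, of y _ _ 0], simp add: algebra_simps)
  thus ?thesis
    by (simp only: wprod_def sum_subtractf sum_distrib_left[symmetric] sum_distrib_right[symmetric])
qed

lemma G_row': "(\<Sum>k<K. (G y a k)\<^sup>2) \<le> (1 / s)\<^sup>2" and G_col': "(\<Sum>k<K. (G y k a)\<^sup>2) \<le> (1 / s)\<^sup>2"
  using G_row G_col by (simp_all add: power_divide)

lemma wprod_G_le:
  assumes "(\<Sum>k<K. (R k c)\<^sup>2) \<le> (1 / s)\<^sup>2" "\<forall>k. \<bar>D k\<bar> \<le> 1"
  shows "\<bar>wprod K (G y) D R a c\<bar> \<le> 1 / s\<^sup>2"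
proof -
  have "\<bar>wprod K (G y) D R a c\<bar> \<le> (1 / s) * (1 / s)"
    using s_pos by (intro wprod_abs_le G_row' assms) auto
  thus ?thesis by (simp add: power2_eq_square)
qed

lemma wprod_left_diff_le:
  assumes e: "e \<in> E" and R: "(\<Sum>k<K. (R k c)\<^sup>2) \<le> (1 / s)\<^sup>2" and D: "\<forall>k. \<bar>D k\<bar> \<le> 1"
  shows "\<bar>wprod K (G y) D R a c - wprod K (G (y(e := 0))) D R a c\<bar> \<le> 2 * \<bar>y e\<bar> / s ^ 3"
proof -
  obtain p q where pq: "e = (p, q)" by (cases e)
  let ?H = "G (y(e := 0))" and ?U = "wprod K (G y) D R"
  have "\<bar>?H a p * ?U q c - ?H a q * ?U p c\<bar> \<le> \<bar>?H a p\<bar> * \<bar>?U q c\<bar> + \<bar>?H a q\<bar> * \<bar>?U p c\<bar>"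
    by (metis abs_mult abs_triangle_ineq4)
  also have "\<dots> \<le> (1 / s) * (1 / s\<^sup>2) + (1 / s) * (1 / s\<^sup>2)"
    by (intro add_mono mult_mono G_abs_le wprod_G_le R D) (use s_pos in auto)
  finally have "\<bar>?H a p * ?U q c - ?H a q * ?U p c\<bar> \<le> 2 / s ^ 3"
    by (simp add: power2_eq_square power3_eq_cube)
  hence "\<bar>y e\<bar> * \<bar>?H a p * ?U q c - ?H a q * ?U p c\<bar> \<le> \<bar>y e\<bar> * (2 / s ^ 3)"
    by (intro mult_left_mono) auto
  thus ?thesis
    using wprod_update_left[OF pq e, of y D R a c] by (simp add: abs_mult mult.commute)
qed

lemma wprod_right_diff_le:
  assumes e: "e \<in> E" and D: "\<forall>k. \<bar>D k\<bar> \<le> 1"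
  shows "\<bar>wprod K (G y') D (G y) a c - wprod K (G y') D (G (y(e := 0))) a c\<bar> \<le> 2 * \<bar>y e\<bar> / s ^ 3"
proof -
  obtain p q where pq: "e = (p, q)" by (cases e)
  let ?H = "G (y(e := 0))" let ?U = "wprod K (G y') D ?H"
  have "\<bar>?U a p * G y q c - ?U a q * G y p c\<bar> \<le> \<bar>?U a p\<bar> * \<bar>G y q c\<bar> + \<bar>?U a q\<bar> * \<bar>G y p c\<bar>"
    by (metis abs_mult abs_triangle_ineq4)
  also have "\<dots> \<le> (1 / s\<^sup>2) * (1 / s) + (1 / s\<^sup>2) * (1 / s)"
    by (intro add_mono mult_mono G_abs_le wprod_G_le G_col' D) (use s_pos in auto)
  finally have "\<bar>?U a p * G y q c - ?U a q * G y p c\<bar> \<le> 2 / s ^ 3"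
    by (simp add: power2_eq_square power3_eq_cube)
  hence "\<bar>y e\<bar> * \<bar>?U a p * G y q c - ?U a q * G y p c\<bar> \<le> \<bar>y e\<bar> * (2 / s ^ 3)"
    by (intro mult_left_mono) auto
  thus ?thesis
    using wprod_update_right[OF pq e, of "G y'" D y a c] by (simp add: abs_mult mult.commute)
qed

text \<open>\<open>G\<close> has operator norm at most 1 / s and acts on K columns of norm at most 1
  / s. The entrywise bound 1 / s^2 would only give K^2 / s^4; the factor K saved here is what keeps
  the variance bounded.\<close>

lemma wprod_frobenius:
  assumes R: "\<forall>c. (\<Sum>k<K. (R k c)\<^sup>2) \<le> (1 / s)\<^sup>2" and D: "\<forall>k. \<bar>D k\<bar> \<le> 1"
  shows "(\<Sum>a<K. \<Sum>c<K. (wprod K (G y) D R a c)\<^sup>2) \<le> real K / s ^ 4"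
proof -
  have "(\<Sum>a<K. \<Sum>c<K. (wprod K (G y) D R a c)\<^sup>2) = (\<Sum>c<K. \<Sum>a<K. (\<Sum>k<K. G y a k * (D k * R k c))\<^sup>2)"
    by (subst sum.swap) (simp add: wprod_def mult.assoc)
  also have "\<dots> \<le> (\<Sum>c<K. 1 / s ^ 4)"
  proof (rule sum_mono)
    fix c
    have "(\<Sum>a<K. (\<Sum>k<K. G y a k * (D k * R k c))\<^sup>2) \<le> (\<Sum>k<K. (D k * R k c)\<^sup>2) / s\<^sup>2"
      by (rule G_op)
    also have "(\<Sum>k<K. (D k * R k c)\<^sup>2) \<le> (\<Sum>k<K. (R k c)\<^sup>2)"
    proof (rule sum_mono)
      fix k
      have "(D k)\<^sup>2 \<le> 1" using D by (simp add: abs_square_le_1)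
      thus "(D k * R k c)\<^sup>2 \<le> (R k c)\<^sup>2"
        by (simp add: power_mult_distrib mult_left_le_one_le)
    qed
    also have "\<dots> \<le> (1 / s)\<^sup>2" using R by blast
    also have "(1 / s)\<^sup>2 / s\<^sup>2 = 1 / s ^ 4" by (simp add: power_divide power_add[symmetric])
    finally show "(\<Sum>a<K. (\<Sum>k<K. G y a k * (D k * R k c))\<^sup>2) \<le> 1 / s ^ 4"
      using s_pos by (simp add: divide_right_mono)
  qed
  finally show ?thesis by simp
qed

section \<open>Measurability, integrability and moments under the product law\<close>

lemma space_\<mu>: "space (\<mu> e) = UNIV"
  using sets_eq_imp_space_eq[OF sets_\<mu>[of e]] by simp

lemma prob_\<P>: "prob_space \<P>"
  unfolding \<P>_def by (rule prob_space_PiM) (rule prob_\<mu>)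

sublocale P: prob_space \<P>
  by (rule prob_\<P>)

lemma coordinate_measurable [measurable]: "e \<in> E \<Longrightarrow> (\<lambda>y. y e) \<in> borel_measurable \<P>"
  unfolding \<P>_def using measurable_component_singleton[of e E \<mu>] sets_\<mu>[of e]
  by (simp cong: measurable_cong_sets)

lemma G_measurable [measurable]: "(\<lambda>y. G y a c) \<in> borel_measurable \<P>"
  unfolding G_def
proof (rule inv_fun_measurable)
  fix i j
  have "(\<lambda>y. S y i j) \<in> borel_measurable \<P>"
    unfolding S_def by (cases "(i, j) \<in> E"; cases "(j, i) \<in> E") auto
  thus "(\<lambda>y. diag_plus (\<lambda>_. s) (S y) i j) \<in> borel_measurable \<P>"
    unfolding diag_plus_def by simp
qed

lemma update_measurable:
  assumes "e \<in> E" "f \<in> borel_measurable \<P>"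
  shows "(\<lambda>y. f (y(e := 0))) \<in> borel_measurable \<P>"
  using assms unfolding \<P>_def
  by (intro measurable_compose[OF measurable_coordinate_update]) (auto simp: space_\<mu>)

lemma wprod_measurable [measurable]:
  assumes "\<And>i j. (\<lambda>y. A y i j) \<in> borel_measurable \<P>" "\<And>i j. (\<lambda>y. R y i j) \<in> borel_measurable \<P>"
  shows "(\<lambda>y. wprod K (A y) D (R y) a c) \<in> borel_measurable \<P>"
  unfolding wprod_def using assms by auto

lemma moment_integrable_\<mu>:
  assumes "e \<in> E" "k \<le> 4"
  shows "integrable (\<mu> e) (\<lambda>x. x ^ k)"
proof -
  interpret M: prob_space "\<mu> e" by (rule prob_\<mu>)
  show ?thesis
  proof (rule Bochner_Integration.integrable_bound[of _ "\<lambda>x. 1 + x ^ 4"])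
    show "integrable (\<mu> e) (\<lambda>x. 1 + x ^ 4)" using fourth_int[OF assms(1)] by simp
    show "(\<lambda>x. x ^ k) \<in> borel_measurable (\<mu> e)"
      using sets_\<mu>[of e] by (simp cong: measurable_cong_sets)
    show "AE x in \<mu> e. norm (x ^ k) \<le> norm (1 + x ^ 4)"
    proof (rule AE_I2)
      fix x :: real
      have "\<bar>x\<bar> ^ k \<le> 1 + \<bar>x\<bar> ^ 4"
      proof (cases "\<bar>x\<bar> \<le> 1")
        case True
        hence "\<bar>x\<bar> ^ k \<le> 1" by (intro power_le_one) auto
        thus ?thesis by (smt (verit) zero_le_power abs_ge_zero)
      next
        case False
        hence "\<bar>x\<bar> ^ k \<le> \<bar>x\<bar> ^ 4" using assms(2) by (intro power_increasing) auto
        thus ?thesis by simp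
      qed
      thus "norm (x ^ k) \<le> norm (1 + x ^ 4)" by (simp add: power_abs)
    qed
  qed
qed

text \<open>Setting the entry to 0 turns the second factor into a function of the other entries,
  hence independent of \<open>y e\<close>.\<close>

lemma split_expectation:
  fixes g :: "real \<Rightarrow> real"
  assumes e: "e \<in> E" and g: "integrable (\<mu> e) g"
    and \<phi>: "\<phi> \<in> borel_measurable \<P>" "\<And>y. \<bar>\<phi> y\<bar> \<le> C"
  shows "integrable \<P> (\<lambda>y. g (y e) * \<phi> (y(e := 0)))"
    and "P.expectation (\<lambda>y. g (y e) * \<phi> (y(e := 0))) = integral\<^sup>L (\<mu> e) g * P.expectation (\<lambda>y. \<phi> (y(e := 0)))"
  unfolding \<P>_def
  by (rule PiM_integral_coordinate_split[where M = \<mu> and J = E and e = e and g = g and C = C and \<phi> = "\<lambda>y. \<phi> (y(e := 0))",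
      OF prob_\<mu> finite_E e g update_measurable[OF e \<phi>(1), unfolded \<P>_def] \<phi>(2)]; simp)+

lemma
  fixes g :: "real \<Rightarrow> real"
  assumes e: "e \<in> E" and g: "integrable (\<mu> e) g"
  shows moment_integrable: "integrable \<P> (\<lambda>y. g (y e))"
    and moment_eq: "P.expectation (\<lambda>y. g (y e)) = integral\<^sup>L (\<mu> e) g"
  using split_expectation[OF e g, of "\<lambda>_. 1" 1] by (simp_all add: P.prob_space)

lemma bounded_integrable:
  fixes f :: "_ \<Rightarrow> real"
  shows "f \<in> borel_measurable \<P> \<Longrightarrow> (\<And>y. \<bar>f y\<bar> \<le> C) \<Longrightarrow> integrable \<P> f"
  by (rule P.integrable_const_bound[of _ C]) auto

lemma power_integrable:
  assumes "e \<in> E"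
  shows "integrable \<P> (\<lambda>y. (y e)\<^sup>2)" "integrable \<P> (\<lambda>y. (y e) ^ 4)" "integrable \<P> (\<lambda>y. \<bar>y e\<bar>)"
    "integrable \<P> (\<lambda>y. \<bar>y e\<bar> ^ 3)" "integrable \<P> (\<lambda>y. y e)"
  using moment_integrable[OF assms moment_integrable_\<mu>[OF assms], of 1]
    moment_integrable[OF assms moment_integrable_\<mu>[OF assms], of 2]
    integrable_abs[OF moment_integrable[OF assms moment_integrable_\<mu>[OF assms]], of 3]
    moment_integrable[OF assms moment_integrable_\<mu>[OF assms], of 4]
  by (simp_all add: power_abs)

lemma power_expectation:
  assumes e: "e \<in> E"
  shows "P.expectation (\<lambda>y. (y e)\<^sup>2) \<le> h\<^sup>2" "P.expectation (\<lambda>y. (y e) ^ 4) \<le> \<kappa> * h ^ 4"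
    "P.expectation (\<lambda>y. \<bar>y e\<bar> ^ 3) \<le> \<kappa> * h ^ 3" "P.expectation (\<lambda>y. \<bar>y e\<bar>) \<le> h"
proof -
  show 2: "P.expectation (\<lambda>y. (y e)\<^sup>2) \<le> h\<^sup>2" and "P.expectation (\<lambda>y. (y e) ^ 4) \<le> \<kappa> * h ^ 4"
    using moment_eq[OF e moment_integrable_\<mu>[OF e]] second[OF e] fourth[OF e] by simp_all
  have "integrable (\<mu> e) (\<lambda>x. \<bar>x\<bar> ^ 3)"
    using integrable_abs[OF moment_integrable_\<mu>[OF e, of 3]] by (simp add: power_abs)
  from moment_eq[OF e this] third[OF e]
  show "P.expectation (\<lambda>y. \<bar>y e\<bar> ^ 3) \<le> \<kappa> * h ^ 3" by simp
  \<comment> \<open>AM-GM balanced at the scale \<open>h\<close>, so that the second moment bound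
    gives exactly \<open>h\<close>.\<close>
  have "P.expectation (\<lambda>y. \<bar>y e\<bar>) \<le> P.expectation (\<lambda>y. ((y e)\<^sup>2 / h + h) / 2)"
  proof (rule integral_mono)
    fix y :: "nat \<times> nat \<Rightarrow> real"
    have "2 * (\<bar>y e\<bar> * h) \<le> (y e)\<^sup>2 + h\<^sup>2" using sum_squares_bound[of "\<bar>y e\<bar>" h] by simp
    thus "\<bar>y e\<bar> \<le> ((y e)\<^sup>2 / h + h) / 2"
      using h_pos by (simp add: field_simps power2_eq_square)
  qed (use power_integrable[OF e] in auto)
  also have "\<dots> = (P.expectation (\<lambda>y. (y e)\<^sup>2) / h + h) / 2"
    using power_integrable[OF e] by (simp add: P.prob_space)
  also have "\<dots> \<le> (h\<^sup>2 / h + h) / 2"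
    using 2 h_pos by (intro divide_right_mono add_mono) auto
  also have "\<dots> = h" using h_pos by (simp add: power2_eq_square)
  finally show "P.expectation (\<lambda>y. \<bar>y e\<bar>) \<le> h" .
qed

subsection \<open>Variance of the traces\<close>

text \<open>Weights serve two purposes: 0/1 weights give the traces of the two diagonal blocks, and
  a row of \<open>v\<close> divided by h^2 gives the sum that enters the fixed point
  equation.\<close>

definition diag_stat :: "(nat \<Rightarrow> real) \<Rightarrow> (nat \<times> nat \<Rightarrow> real) \<Rightarrow> real" where
  "diag_stat D y = (\<Sum>k<K. D k * G y k k)"

lemma diag_stat_measurable [measurable]: "diag_stat D \<in> borel_measurable \<P>"
  unfolding diag_stat_def[abs_def] by measurable

lemma diag_stat_abs_le: "\<forall>k. \<bar>D k\<bar> \<le> 1 \<Longrightarrow> \<bar>diag_stat D y\<bar> \<le> real K / s"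
proof -
  assume D: "\<forall>k. \<bar>D k\<bar> \<le> 1"
  have "\<bar>diag_stat D y\<bar> \<le> (\<Sum>k<K. \<bar>D k * G y k k\<bar>)" unfolding diag_stat_def by (rule sum_abs)
  also have "\<dots> \<le> (\<Sum>k<K. 1 * (1 / s))"
    unfolding abs_mult by (intro sum_mono mult_mono G_abs_le) (use D s_pos in auto)
  finally show ?thesis by simp
qed

lemma wprod_G_left_diff_le:
  assumes "e \<in> E" "\<forall>k. \<bar>D k\<bar> \<le> 1"
  shows "\<bar>wprod K (G y) D (G y') a c - wprod K (G (y(e := 0))) D (G y') a c\<bar> \<le> 2 * \<bar>y e\<bar> / s ^ 3"
  by (rule wprod_left_diff_le[OF assms(1) _ assms(2)]) (rule G_col')

text \<open>The exact increment contains the inverse at \<open>y\<close> in one factor. Replacing it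
  by the inverse without the entry costs a quadratic term in \<open>y e\<close>, and makes the
  coefficient of the linear term independent of \<open>y e\<close>.\<close>

lemma diag_stat_update_le:
  assumes e: "e = (p, q)" "e \<in> E" and D: "\<forall>k. \<bar>D k\<bar> \<le> 1"
  shows "(diag_stat D y - diag_stat D (y(e := 0)))\<^sup>2 \<le>
    4 * (y e)\<^sup>2 * ((wprod K (G (y(e := 0))) D (G (y(e := 0))) q p)\<^sup>2 + (wprod K (G (y(e := 0))) D (G (y(e := 0))) p q)\<^sup>2)
    + 32 * (y e) ^ 4 / s ^ 6"
proof -
  let ?H = "G (y(e := 0))" let ?V = "wprod K ?H D ?H" let ?U = "wprod K (G y) D ?H"
  have "diag_stat D y - diag_stat D (y(e := 0)) = (\<Sum>k<K. D k * (G y k k - ?H k k))"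
    by (simp add: diag_stat_def sum_subtractf algebra_simps)
  also have "\<dots> = (\<Sum>k<K. - y e * (G y q k * D k * ?H k p - G y p k * D k * ?H k q))"
  proof (intro sum.cong refl)
    fix k
    have "G y k k - ?H k k = - y e * (?H k p * G y q k - ?H k q * G y p k)"
      using G_update[OF e, of y k k 0] by simp
    thus "D k * (G y k k - ?H k k) = - y e * (G y q k * D k * ?H k p - G y p k * D k * ?H k q)"
      by (simp only:) (simp add: algebra_simps)
  qed
  also have "\<dots> = - y e * (?U q p - ?U p q)"
    by (simp only: wprod_def sum_subtractf sum_distrib_left[symmetric])
  finally have eq: "diag_stat D y - diag_stat D (y(e := 0)) = - y e * (?U q p - ?U p q)" .
  define t where "t = \<bar>y e\<bar>"
  define \<alpha> where "\<alpha> = \<bar>?V q p\<bar>"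
  define \<beta> where "\<beta> = \<bar>?V p q\<bar>"
  have t: "t \<ge> 0" "\<alpha> \<ge> 0" "\<beta> \<ge> 0" by (simp_all add: t_def \<alpha>_def \<beta>_def)
  have "\<bar>?U i j\<bar> \<le> \<bar>?V i j\<bar> + 2 * t / s ^ 3" for i j
    using wprod_G_left_diff_le[OF e(2) D, of y "y(e := 0)" i j] unfolding t_def by linarith
  from this[of q p] this[of p q] have "\<bar>?U q p - ?U p q\<bar> \<le> \<alpha> + \<beta> + 4 * t / s ^ 3"
    unfolding \<alpha>_def \<beta>_def by simp
  hence "\<bar>diag_stat D y - diag_stat D (y(e := 0))\<bar> \<le> t * (\<alpha> + \<beta> + 4 * t / s ^ 3)"
    unfolding eq abs_mult abs_minus_cancel t_def[symmetric] using t by (intro mult_left_mono)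
  hence "(diag_stat D y - diag_stat D (y(e := 0)))\<^sup>2 \<le> (t * (\<alpha> + \<beta> + 4 * t / s ^ 3))\<^sup>2"
    using t s_pos by (subst abs_le_square_iff[symmetric]) (simp add: abs_of_nonneg)
  also have "\<dots> = (t * (\<alpha> + \<beta>) + 4 * t\<^sup>2 / s ^ 3)\<^sup>2"
    by (simp add: algebra_simps power2_eq_square)
  also have "\<dots> \<le> 2 * (t * (\<alpha> + \<beta>))\<^sup>2 + 2 * (4 * t\<^sup>2 / s ^ 3)\<^sup>2"
    using sum_squares_bound[of "t * (\<alpha> + \<beta>)" "4 * t\<^sup>2 / s ^ 3"] by (simp add: power2_sum)
  also have "(t * (\<alpha> + \<beta>))\<^sup>2 \<le> t\<^sup>2 * (2 * (\<alpha>\<^sup>2 + \<beta>\<^sup>2))"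
    unfolding power_mult_distrib using sum_squares_bound[of \<alpha> \<beta>]
    by (intro mult_left_mono) (auto simp: power2_sum)
  also have "2 * (4 * t\<^sup>2 / s ^ 3)\<^sup>2 = 32 * t ^ 4 / s ^ 6"
    by (simp add: power_divide power_mult_distrib power_mult[symmetric])
  finally show ?thesis
    by (simp add: t_def \<alpha>_def \<beta>_def algebra_simps)
qed

text \<open>The Efron-Stein increments involve \<open>?V\<close> at a configuration with the entry
  removed, which differs from edge to edge, whereas the Frobenius bound concerns all entries at one
  configuration. So after the expectation has been factorised, the removed entry is put back before
  summing.\<close>

lemma variance_bound:
  assumes D: "\<forall>k. \<bar>D k\<bar> \<le> 1"
  shows "P.expectation (\<lambda>y. (diag_stat D y - P.expectation (diag_stat D))\<^sup>2) \<le> var_const"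
proof -
  let ?V = "\<lambda>y. wprod K (G y) D (G y)"
  have V_bd: "\<bar>(?V y a c)\<^sup>2\<bar> \<le> (1 / s\<^sup>2)\<^sup>2" for y a c
    using wprod_G_le[OF _ D, of "G y" c y a] G_col' by (simp add: abs_le_square_iff[symmetric])
  have V_meas: "(\<lambda>y. (?V y a c)\<^sup>2) \<in> borel_measurable \<P>" for a c by measurable
  note V_int = bounded_integrable[OF V_meas V_bd]
  have "P.expectation (\<lambda>y. (diag_stat D y - P.expectation (diag_stat D))\<^sup>2) \<le> (\<Sum>e\<in>E. P.expectation (\<lambda>y. (diag_stat D y - diag_stat D (y(e := 0)))\<^sup>2))"
    unfolding \<P>_def
    by (rule efron_stein[where C = "real K / s", OF prob_\<mu> finite_E])
      (use diag_stat_measurable diag_stat_abs_le D in \<open>auto simp: \<P>_def space_\<mu>\<close>)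
  also have "\<dots> \<le> (\<Sum>e\<in>E. 8 * h\<^sup>2 * (P.expectation (\<lambda>y. (?V y (fst e) (snd e))\<^sup>2) + P.expectation (\<lambda>y. (?V y (snd e) (fst e))\<^sup>2))
      + (256 + 32 * \<kappa>) * h ^ 4 / s ^ 6)"
  proof (rule sum_mono)
    fix e assume e: "e \<in> E"
    obtain p q where pq: "e = (p, q)" by (cases e)
    have step: "P.expectation (\<lambda>y. (y e)\<^sup>2 * (?V (y(e := 0)) a c)\<^sup>2) \<le> h\<^sup>2 * (2 * P.expectation (\<lambda>y. (?V y a c)\<^sup>2) + 32 * h\<^sup>2 / s ^ 6)"
      and int: "integrable \<P> (\<lambda>y. (y e)\<^sup>2 * (?V (y(e := 0)) a c)\<^sup>2)" for a c
    proof -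
      have \<mu>2: "integrable (\<mu> e) (\<lambda>x. x\<^sup>2)" using moment_integrable_\<mu>[OF e] by simp
      note sp = split_expectation[OF e \<mu>2 V_meas[of a c] V_bd]
      show "integrable \<P> (\<lambda>y. (y e)\<^sup>2 * (?V (y(e := 0)) a c)\<^sup>2)" by (rule sp(1))
      have int0: "integrable \<P> (\<lambda>y. (?V (y(e := 0)) a c)\<^sup>2)"
        by (rule bounded_integrable[OF update_measurable[OF e V_meas] V_bd])
      \<comment> \<open>Puts the entry back: both factors of \<open>?V\<close> change, each by at
        most 2 |y e| / s^3.\<close>
      have "P.expectation (\<lambda>y. (?V (y(e := 0)) a c)\<^sup>2) \<le> P.expectation (\<lambda>y. 2 * (?V y a c)\<^sup>2 + 32 * (y e)\<^sup>2 / s ^ 6)"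
      proof (rule integral_mono)
        fix y :: "nat \<times> nat \<Rightarrow> real"
        let ?t = "\<bar>y e\<bar>"
        have "\<bar>?V y a c - ?V (y(e := 0)) a c\<bar> \<le> 2 * ?t / s ^ 3 + 2 * ?t / s ^ 3"
          using wprod_G_left_diff_le[OF e D, of y y a c] wprod_right_diff_le[OF e D, of "y(e := 0)" y a c]
          by linarith
        hence "(?V y a c - ?V (y(e := 0)) a c)\<^sup>2 \<le> (4 * ?t / s ^ 3)\<^sup>2"
          using s_pos by (subst abs_le_square_iff[symmetric]) simp
        hence "2 * (?V y a c - ?V (y(e := 0)) a c)\<^sup>2 \<le> 32 * (y e)\<^sup>2 / s ^ 6"
          by (simp add: power_divide power_mult_distrib power_mult[symmetric])
        \<comment> \<open>With \<open>A\<close> for the value at y and \<open>B\<close> for the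
          value without the entry, (2 A - B)^2 >= 0 rearranges to B^2 <= 2 A^2 + 2 (A -
          B)^2.\<close>
        moreover have "0 \<le> (2 * ?V y a c - ?V (y(e := 0)) a c)\<^sup>2" by simp
        hence "(?V (y(e := 0)) a c)\<^sup>2 \<le> 2 * (?V y a c)\<^sup>2 + 2 * (?V y a c - ?V (y(e := 0)) a c)\<^sup>2"
          by (simp add: power2_eq_square algebra_simps)
        ultimately show "(?V (y(e := 0)) a c)\<^sup>2 \<le> 2 * (?V y a c)\<^sup>2 + 32 * (y e)\<^sup>2 / s ^ 6" by linarith
      qed (use int0 V_int power_integrable[OF e] in auto)
      also have "\<dots> = 2 * P.expectation (\<lambda>y. (?V y a c)\<^sup>2) + 32 * P.expectation (\<lambda>y. (y e)\<^sup>2) / s ^ 6"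
        using V_int power_integrable[OF e] by simp
      also have "\<dots> \<le> 2 * P.expectation (\<lambda>y. (?V y a c)\<^sup>2) + 32 * h\<^sup>2 / s ^ 6"
        using power_expectation[OF e] s_pos by (intro add_left_mono divide_right_mono) auto
      finally have "P.expectation (\<lambda>y. (?V (y(e := 0)) a c)\<^sup>2) \<le> 2 * P.expectation (\<lambda>y. (?V y a c)\<^sup>2) + 32 * h\<^sup>2 / s ^ 6" .
      thus "P.expectation (\<lambda>y. (y e)\<^sup>2 * (?V (y(e := 0)) a c)\<^sup>2) \<le> h\<^sup>2 * (2 * P.expectation (\<lambda>y. (?V y a c)\<^sup>2) + 32 * h\<^sup>2 / s ^ 6)"
        unfolding sp(2) using second[OF e]
        by (intro mult_mono) (auto intro!: integral_nonneg_AE)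
    qed
    have f_int: "integrable \<P> (\<lambda>y. (diag_stat D y - diag_stat D (y(e := 0)))\<^sup>2)"
    proof (rule bounded_integrable)
      show "(\<lambda>y. (diag_stat D y - diag_stat D (y(e := 0)))\<^sup>2) \<in> borel_measurable \<P>"
        using update_measurable[OF e diag_stat_measurable] by measurable
      fix y
      have "\<bar>diag_stat D y - diag_stat D (y(e := 0))\<bar> \<le> 2 * (real K / s)"
        using diag_stat_abs_le[OF D, of y] diag_stat_abs_le[OF D, of "y(e := 0)"] by linarith
      thus "\<bar>(diag_stat D y - diag_stat D (y(e := 0)))\<^sup>2\<bar> \<le> (2 * (real K / s))\<^sup>2"
        using s_pos by (simp add: abs_le_square_iff[symmetric])
    qed
    have "P.expectation (\<lambda>y. (diag_stat D y - diag_stat D (y(e := 0)))\<^sup>2)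
       \<le> P.expectation (\<lambda>y. 4 * ((y e)\<^sup>2 * (?V (y(e := 0)) q p)\<^sup>2) + 4 * ((y e)\<^sup>2 * (?V (y(e := 0)) p q)\<^sup>2) + 32 * (y e) ^ 4 / s ^ 6)"
    proof (rule integral_mono)
      fix y show "(diag_stat D y - diag_stat D (y(e := 0)))\<^sup>2 \<le> 4 * ((y e)\<^sup>2 * (?V (y(e := 0)) q p)\<^sup>2) + 4 * ((y e)\<^sup>2 * (?V (y(e := 0)) p q)\<^sup>2) + 32 * (y e) ^ 4 / s ^ 6"
        using diag_stat_update_le[OF pq e D, of y] by (simp add: algebra_simps)
    qed (use f_int int power_integrable[OF e] in auto)
    also have "\<dots> = 4 * P.expectation (\<lambda>y. (y e)\<^sup>2 * (?V (y(e := 0)) q p)\<^sup>2)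
        + 4 * P.expectation (\<lambda>y. (y e)\<^sup>2 * (?V (y(e := 0)) p q)\<^sup>2) + 32 * P.expectation (\<lambda>y. (y e) ^ 4) / s ^ 6"
      using int power_integrable[OF e] by simp
    also have "\<dots> \<le> 4 * (h\<^sup>2 * (2 * P.expectation (\<lambda>y. (?V y q p)\<^sup>2) + 32 * h\<^sup>2 / s ^ 6))
        + 4 * (h\<^sup>2 * (2 * P.expectation (\<lambda>y. (?V y p q)\<^sup>2) + 32 * h\<^sup>2 / s ^ 6)) + 32 * (\<kappa> * h ^ 4) / s ^ 6"
      using step power_expectation[OF e] s_pos by (intro add_mono mult_left_mono divide_right_mono) auto
    also have "\<dots> = 8 * h\<^sup>2 * (P.expectation (\<lambda>y. (?V y (fst e) (snd e))\<^sup>2) + P.expectation (\<lambda>y. (?V y (snd e) (fst e))\<^sup>2))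
      + (256 + 32 * \<kappa>) * h ^ 4 / s ^ 6"
      using s_pos by (simp add: pq field_simps power4_eq_xxxx power2_eq_square)
    finally show "P.expectation (\<lambda>y. (diag_stat D y - diag_stat D (y(e := 0)))\<^sup>2) \<le> \<dots>" .
  qed
  also have "\<dots> = 8 * h\<^sup>2 * (\<Sum>e\<in>E. P.expectation (\<lambda>y. (?V y (fst e) (snd e))\<^sup>2) + P.expectation (\<lambda>y. (?V y (snd e) (fst e))\<^sup>2))
      + real (card E) * ((256 + 32 * \<kappa>) * h ^ 4 / s ^ 6)"
    by (simp only: sum.distrib sum_distrib_left[symmetric] sum_constant)
  also have "\<dots> \<le> 8 * h\<^sup>2 * (real K / s ^ 4) + (real K)\<^sup>2 * ((256 + 32 * \<kappa>) * h ^ 4 / s ^ 6)"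
  proof (intro add_mono mult_left_mono mult_right_mono)
    have "(\<Sum>e\<in>E. P.expectation (\<lambda>y. (?V y (fst e) (snd e))\<^sup>2) + P.expectation (\<lambda>y. (?V y (snd e) (fst e))\<^sup>2))
      \<le> (\<Sum>i<K. \<Sum>j<K. P.expectation (\<lambda>y. (?V y i j)\<^sup>2))"
      by (rule edge_sum_le) (auto intro!: integral_nonneg_AE)
    also have "\<dots> = P.expectation (\<lambda>y. \<Sum>i<K. \<Sum>j<K. (?V y i j)\<^sup>2)"
      using V_int by simp
    also have "\<dots> \<le> P.expectation (\<lambda>y. real K / s ^ 4)"
      using V_int by (intro integral_mono wprod_frobenius) (use G_col' D in auto)
    finally show "(\<Sum>e\<in>E. P.expectation (\<lambda>y. (?V y (fst e) (snd e))\<^sup>2) + P.expectation (\<lambda>y. (?V y (snd e) (fst e))\<^sup>2)) \<le> real K / s ^ 4"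
      by (simp add: P.prob_space)
    show "real (card E) \<le> (real K)\<^sup>2"
      using card_E by (metis of_nat_le_iff of_nat_power)
  qed (use \<kappa>_nonneg h_pos s_pos in auto)
  also have "\<dots> = 8 * (real K * h\<^sup>2) / s ^ 4 + (256 + 32 * \<kappa>) * (real K * h\<^sup>2)\<^sup>2 / s ^ 6"
    by (simp add: power_mult_distrib power4_eq_xxxx power2_eq_square mult_ac)
  also have "\<dots> \<le> 8 * b / s ^ 4 + (256 + 32 * \<kappa>) * b\<^sup>2 / s ^ 6"
    using Kh \<kappa>_nonneg s_pos h_pos by (intro add_mono divide_right_mono mult_left_mono power_mono) auto
  finally show ?thesis by (simp add: var_const_def)
qed

subsection \<open>Expectation of the traces\<close>

text \<open>
  First-order integration by parts in a single entry: third moments control the Taylor remainder,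
  so no Gaussian assumption is needed.
\<close>

lemma entry_expansion:
  assumes e: "e = (p, q)" "e \<in> E" and R: "\<forall>c. (\<Sum>k<K. (R k c)\<^sup>2) \<le> (1 / s)\<^sup>2" and D: "\<forall>k. \<bar>D k\<bar> \<le> 1"
  defines "U \<equiv> \<lambda>y. wprod K (G y) D R"
  shows "\<bar>P.expectation (\<lambda>y. y e * U y a c) + w e * P.expectation (\<lambda>y. G y a p * U y q c - G y a q * U y p c)\<bar>
    \<le> (4 * \<kappa> + 8) * h ^ 3 / s ^ 4"
proof -
  have U_bd: "\<bar>U y i j\<bar> \<le> 1 / s\<^sup>2" for y i j
    unfolding U_def by (rule wprod_G_le) (use R D in auto)
  have U_diff: "\<bar>U y i j - U (y(e := 0)) i j\<bar> \<le> 2 * \<bar>y e\<bar> / s ^ 3" for y i j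
    unfolding U_def by (rule wprod_left_diff_le[OF e(2)]) (use R D in auto)
  have U_meas [measurable]: "(\<lambda>y. U y i j) \<in> borel_measurable \<P>" for i j
    unfolding U_def by measurable
  \<comment> \<open>Minus the derivative of \<open>U y a c\<close> in the entry e.\<close>
  define X where "X y = G y a p * U y q c - G y a q * U y p c" for y
  have X_meas [measurable]: "X \<in> borel_measurable \<P>" unfolding X_def by measurable
  have prod_le: "\<bar>x * y - x' * y'\<bar> \<le> a1 + a2" if "\<bar>x * y\<bar> \<le> a1" "\<bar>x' * y'\<bar> \<le> a2" for x y x' y' a1 a2 :: real
    using that by linarith
  have GU: "\<bar>G y i j * U y' k l\<bar> \<le> 1 / s ^ 3" for y y' i j k l
  proof -
    have "\<bar>G y i j\<bar> * \<bar>U y' k l\<bar> \<le> (1 / s) * (1 / s\<^sup>2)"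
      by (intro mult_mono G_abs_le U_bd) (use s_pos in auto)
    thus ?thesis by (simp add: abs_mult power2_eq_square power3_eq_cube)
  qed
  have X_bd: "\<bar>X y\<bar> \<le> 2 / s ^ 3" for y
    using prod_le[OF GU GU] by (simp add: X_def)
  have GU_diff: "\<bar>G y i j * U y k l - G (y(e := 0)) i j * U (y(e := 0)) k l\<bar> \<le> 4 * \<bar>y e\<bar> / s ^ 4" for y i j k l
  proof -
    let ?H = "G (y(e := 0))" and ?W = "U (y(e := 0))"
    have "\<bar>G y i j * U y k l - ?H i j * ?W k l\<bar> = \<bar>(G y i j - ?H i j) * ?W k l + G y i j * (U y k l - ?W k l)\<bar>"
      by (rule arg_cong[where f = abs]) (simp add: algebra_simps)
    also have "\<dots> \<le> \<bar>G y i j - ?H i j\<bar> * \<bar>?W k l\<bar> + \<bar>G y i j\<bar> * \<bar>U y k l - ?W k l\<bar>"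
      unfolding abs_mult[symmetric] by (rule abs_triangle_ineq)
    also have "\<dots> \<le> (2 * \<bar>y e\<bar> / s\<^sup>2) * (1 / s\<^sup>2) + (1 / s) * (2 * \<bar>y e\<bar> / s ^ 3)"
      by (rule add_mono[OF mult_mono[OF G_update_le[OF e(2)] U_bd] mult_mono[OF G_abs_le U_diff]]) (use s_pos in auto)
    also have "\<dots> = 4 * \<bar>y e\<bar> / s ^ 4"
      using s_pos by (simp add: field_simps power2_eq_square power3_eq_cube power4_eq_xxxx)
    finally show ?thesis .
  qed
  have X_diff: "\<bar>X y - X (y(e := 0))\<bar> \<le> 8 * \<bar>y e\<bar> / s ^ 4" for y
    using GU_diff[of y a p q c] GU_diff[of y a q p c] unfolding X_def by (simp add: abs_le_iff)
  \<comment> \<open>Second-order expansion of y U in the entry, with both coefficients taken at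
    entry 0 so that they are independent of \<open>y e\<close>.\<close>
  have exp: "\<bar>y e * U y a c - (y e * U (y(e := 0)) a c - (y e)\<^sup>2 * X (y(e := 0)))\<bar> \<le> 4 * \<bar>y e\<bar> ^ 3 / s ^ 4" for y
  proof -
    let ?H = "G (y(e := 0))" and ?W = "U (y(e := 0))" let ?t = "\<bar>y e\<bar>"
    have upd: "U y a c = ?W a c - y e * (?H a p * U y q c - ?H a q * U y p c)"
      using wprod_update_left[OF e, of y D R a c] unfolding U_def .
    have "y e * U y a c - (y e * ?W a c - (y e)\<^sup>2 * X (y(e := 0)))
        = - (y e)\<^sup>2 * (?H a p * (U y q c - ?W q c) - ?H a q * (U y p c - ?W p c))"
      unfolding X_def by (subst upd) (simp add: power2_eq_square algebra_simps)
    hence "\<bar>y e * U y a c - (y e * ?W a c - (y e)\<^sup>2 * X (y(e := 0)))\<bar> = ?t\<^sup>2 * \<bar>?H a p * (U y q c - ?W q c) - ?H a q * (U y p c - ?W p c)\<bar>"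
      by (simp add: abs_mult)
    also have "\<bar>?H a p * (U y q c - ?W q c) - ?H a q * (U y p c - ?W p c)\<bar> \<le> (1 / s) * (2 * ?t / s ^ 3) + (1 / s) * (2 * ?t / s ^ 3)"
      by (rule prod_le; unfold abs_mult; rule mult_mono[OF G_abs_le U_diff]) (use s_pos in auto)
    also have "?t\<^sup>2 * ((1 / s) * (2 * ?t / s ^ 3) + (1 / s) * (2 * ?t / s ^ 3)) = 4 * ?t ^ 3 / s ^ 4"
      using s_pos by (simp add: field_simps power2_eq_square power3_eq_cube power4_eq_xxxx)
    finally show ?thesis by (simp add: mult_left_mono)
  qed
  have \<mu>1: "integrable (\<mu> e) (\<lambda>x. x)" and \<mu>2: "integrable (\<mu> e) (\<lambda>x. x\<^sup>2)"
    using moment_integrable_\<mu>[OF e(2), of 1] moment_integrable_\<mu>[OF e(2), of 2] by simp_all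
  note sp1 = split_expectation[OF e(2) \<mu>1 U_meas[of a c] U_bd]
  note sp2 = split_expectation[OF e(2) \<mu>2 X_meas X_bd]
  \<comment> \<open>The linear term disappears because the entry is centred and independent of its
    coefficient.\<close>
  have sp1z: "P.expectation (\<lambda>y. y e * U (y(e := 0)) a c) = 0"
    using sp1(2) mean[OF e(2)] by simp
  have int: "integrable \<P> (\<lambda>y. y e * U y a c)"
  proof (rule Bochner_Integration.integrable_bound)
    show "integrable \<P> (\<lambda>y. (1 / s\<^sup>2) * \<bar>y e\<bar>)" using power_integrable[OF e(2)] by simp
    show "(\<lambda>y. y e * U y a c) \<in> borel_measurable \<P>" using e(2) by measurable
    show "AE y in \<P>. norm (y e * U y a c) \<le> norm ((1 / s\<^sup>2) * \<bar>y e\<bar>)"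
      using U_bd[of _ a c] mult_left_mono[OF U_bd[of _ a c], of "\<bar>_ e\<bar>"]
      by (intro AE_I2) (simp add: abs_mult mult.commute)
  qed
  have 1: "\<bar>P.expectation (\<lambda>y. y e * U y a c) + w e * P.expectation (\<lambda>y. X (y(e := 0)))\<bar> \<le> 4 * \<kappa> * h ^ 3 / s ^ 4"
  proof -
    have "P.expectation (\<lambda>y. y e * U y a c) + w e * P.expectation (\<lambda>y. X (y(e := 0)))
        = P.expectation (\<lambda>y. y e * U y a c - (y e * U (y(e := 0)) a c - (y e)\<^sup>2 * X (y(e := 0))))" (is "?A = _")
      using sp1 sp2 sp1z int by (simp add: w_def)
    hence "\<bar>?A\<bar> = \<bar>\<dots>\<bar>" by (rule arg_cong)
    also have "\<dots> \<le> P.expectation (\<lambda>y. \<bar>y e * U y a c - (y e * U (y(e := 0)) a c - (y e)\<^sup>2 * X (y(e := 0)))\<bar>)"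
      by (rule integral_abs_bound)
    also have "\<dots> \<le> P.expectation (\<lambda>y. 4 * \<bar>y e\<bar> ^ 3 / s ^ 4)"
      by (intro integral_mono exp) (use sp1 sp2 int power_integrable[OF e(2)] in auto)
    also have "\<dots> = 4 * P.expectation (\<lambda>y. \<bar>y e\<bar> ^ 3) / s ^ 4" by simp
    also have "\<dots> \<le> 4 * (\<kappa> * h ^ 3) / s ^ 4"
      using power_expectation[OF e(2)] s_pos by (intro divide_right_mono mult_left_mono) auto
    finally show ?thesis by simp
  qed
  have X_int: "integrable \<P> X" "integrable \<P> (\<lambda>y. X (y(e := 0)))"
    using bounded_integrable[OF X_meas X_bd] bounded_integrable[OF update_measurable[OF e(2) X_meas] X_bd] by auto
  \<comment> \<open>Returns from entry 0 to the full configuration; after multiplication by the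
    variance this costs h^3 again, the 8 in the final constant.\<close>
  have 2: "\<bar>P.expectation X - P.expectation (\<lambda>y. X (y(e := 0)))\<bar> \<le> 8 * h / s ^ 4"
  proof -
    have "P.expectation X - P.expectation (\<lambda>y. X (y(e := 0))) = P.expectation (\<lambda>y. X y - X (y(e := 0)))" (is "?A = _")
      using X_int by simp
    hence "\<bar>?A\<bar> = \<bar>\<dots>\<bar>" by (rule arg_cong)
    also have "\<dots> \<le> P.expectation (\<lambda>y. \<bar>X y - X (y(e := 0))\<bar>)" by (rule integral_abs_bound)
    also have "\<dots> \<le> P.expectation (\<lambda>y. 8 * \<bar>y e\<bar> / s ^ 4)"
      by (intro integral_mono X_diff) (use X_int power_integrable[OF e(2)] in auto)
    also have "\<dots> = 8 * P.expectation (\<lambda>y. \<bar>y e\<bar>) / s ^ 4" by simp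
    also have "\<dots> \<le> 8 * h / s ^ 4"
      using power_expectation[OF e(2)] s_pos by (intro divide_right_mono mult_left_mono) auto
    finally show ?thesis .
  qed
  have w: "0 \<le> w e" "w e \<le> h\<^sup>2" using second[OF e(2)] by (auto simp: w_def intro!: integral_nonneg_AE)
  have "\<bar>P.expectation (\<lambda>y. y e * U y a c) + w e * P.expectation X\<bar>
      \<le> \<bar>P.expectation (\<lambda>y. y e * U y a c) + w e * P.expectation (\<lambda>y. X (y(e := 0)))\<bar>
        + w e * \<bar>P.expectation X - P.expectation (\<lambda>y. X (y(e := 0)))\<bar>"
    (is "\<bar>?A + ?w * ?x\<bar> \<le> \<bar>?A + ?w * ?x'\<bar> + _")
  proof -
    have "\<bar>?A + ?w * ?x\<bar> = \<bar>(?A + ?w * ?x') + ?w * (?x - ?x')\<bar>"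
      by (rule arg_cong[where f = abs]) (simp add: right_diff_distrib)
    also have "\<dots> \<le> \<bar>?A + ?w * ?x'\<bar> + \<bar>?w * (?x - ?x')\<bar>" by (rule abs_triangle_ineq)
    finally show ?thesis using w by (simp only: abs_mult abs_of_nonneg)
  qed
  also have "\<dots> \<le> 4 * \<kappa> * h ^ 3 / s ^ 4 + h\<^sup>2 * (8 * h / s ^ 4)"
    using 1 2 w by (intro add_mono mult_mono) auto
  also have "\<dots> = (4 * \<kappa> + 8) * h ^ 3 / s ^ 4"
    by (simp add: add_divide_distrib power2_eq_square power3_eq_cube algebra_simps)
  finally show ?thesis by (simp add: X_def[abs_def])
qed

section \<open>Comparison of the expected inverse with the deterministic matrix
  \<open>R\<close>\<close>

lemma v_bounds: "0 \<le> v p q" "v p q \<le> h\<^sup>2"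
proof -
  have w: "0 \<le> w e" "e \<in> E \<Longrightarrow> w e \<le> h\<^sup>2" for e
    using second[of e] by (auto simp: w_def intro!: integral_nonneg_AE)
  show "0 \<le> v p q" using w by (simp add: v_def)
  show "v p q \<le> h\<^sup>2" using w E_sub[of p q] E_sub[of q p] by (fastforce simp: v_def)
qed

definition m :: "nat \<Rightarrow> real" where
  "m p = (\<Sum>q<K. v p q * P.expectation (\<lambda>y. G y q q))"

definition R :: "nat \<Rightarrow> nat \<Rightarrow> real" where
  "R = inv_fun K (diag_plus (\<lambda>p. s + m p) B)"

text \<open>Three errors: the third-order remainders over at most K^2 edges, K^2 h^3 = (K h^2)^2 /
  h; the fluctuation of the sums over the diagonal around \<open>m\<close>; and the products of
  entries at equal off-diagonal positions. Only the first grows with n, through 1 / h.\<close>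

definition bias_const :: real where
  "bias_const = b\<^sup>2 * (8 * \<kappa> + 16) / (s ^ 4 * h) + b * (var_const + 1) / (2 * s\<^sup>2) + b / s ^ 3"

lemma m_nonneg: "0 \<le> m p"
  unfolding m_def using v_bounds G_nonneg
  by (intro sum_nonneg mult_nonneg_nonneg integral_nonneg_AE) auto

lemma sm: "i < K \<Longrightarrow> s \<le> s + m i"
  using m_nonneg by simp

lemma R_col: "\<forall>c. (\<Sum>k<K. (R k c)\<^sup>2) \<le> (1 / s)\<^sup>2"
  unfolding R_def using inv_fun_col_bound[OF s_pos sm B_skew] by (simp add: power_divide)

text \<open>The resolvent identity between \<open>R\<close> and \<open>G y\<close>, followed by
  cyclicity of the trace. \<open>B\<close> and \<open>s\<close> cancel in the difference of the two
  inverted matrices, which leaves the random entries against the diagonal \<open>m\<close>.\<close>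

lemma trace_expansion:
  "(\<Sum>k<K. D k * (R k k - G y k k)) =
    (\<Sum>e\<in>E. y e * (wprod K (G y) D R (snd e) (fst e) - wprod K (G y) D R (fst e) (snd e)))
    - (\<Sum>p<K. m p * wprod K (G y) D R p p)"
proof -
  let ?U = "wprod K (G y) D R"
  have "(\<Sum>k<K. D k * (R k k - G y k k)) =
    (\<Sum>k<K. \<Sum>i<K. \<Sum>j<K. (diag_plus (\<lambda>_. s) (S y) i j - diag_plus (\<lambda>p. s + m p) B i j) * (G y j k * D k * R k i))"
  proof (rule sum.cong[OF refl])
    fix k assume k: "k \<in> {..<K}"
    have "R k k - G y k k = (\<Sum>i<K. \<Sum>j<K. R k i * (diag_plus (\<lambda>_. s) (S y) i j - diag_plus (\<lambda>p. s + m p) B i j) * G y j k)"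
      unfolding R_def G_def
      by (rule inv_fun_resolvent_identity[OF s_pos sm B_skew order.refl S_skew]) (use k in auto)
    thus "D k * (R k k - G y k k) = (\<Sum>i<K. \<Sum>j<K. (diag_plus (\<lambda>_. s) (S y) i j - diag_plus (\<lambda>p. s + m p) B i j) * (G y j k * D k * R k i))"
      by (simp add: sum_distrib_left mult_ac)
  qed
  also have "\<dots> = (\<Sum>i<K. \<Sum>j<K. (diag_plus (\<lambda>_. s) (S y) i j - diag_plus (\<lambda>p. s + m p) B i j) * ?U j i)"
    unfolding wprod_def sum_distrib_left
    by (rule trans[OF sum.swap]) (intro sum.cong refl sum.swap)
  also have "\<dots> = (\<Sum>i<K. \<Sum>j<K. (if (i, j) \<in> E then y (i, j) * ?U j i else 0)
      - (if (j, i) \<in> E then y (j, i) * ?U j i else 0) - (if i = j then m i * ?U i i else 0))"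
    by (intro sum.cong refl) (auto simp: diag_plus_def S_def algebra_simps)
  also have "\<dots> = (\<Sum>i<K. \<Sum>j<K. if (i, j) \<in> E then y (i, j) * ?U j i else 0)
      - (\<Sum>i<K. \<Sum>j<K. if (j, i) \<in> E then y (j, i) * ?U j i else 0) - (\<Sum>i<K. m i * ?U i i)"
    by (simp add: sum_subtractf)
  also have "(\<Sum>i<K. \<Sum>j<K. if (j, i) \<in> E then y (j, i) * ?U j i else 0)
      = (\<Sum>j<K. \<Sum>i<K. if (j, i) \<in> E then y (j, i) * ?U j i else 0)"
    by (rule sum.swap)
  finally show ?thesis
    unfolding edge_sum by (simp add: sum_subtractf right_diff_distrib)
qed

lemma weighted_edge_sum:
  fixes F :: "nat \<Rightarrow> nat \<Rightarrow> real"
  shows "(\<Sum>e\<in>E. w e * (F (snd e) (fst e) + F (fst e) (snd e))) = (\<Sum>p<K. \<Sum>q<K. v p q * F q p)"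
proof -
  have "(\<Sum>p<K. \<Sum>q<K. v p q * F q p) = (\<Sum>p<K. \<Sum>q<K. (if (p, q) \<in> E then w (p, q) * F q p else 0))
     + (\<Sum>p<K. \<Sum>q<K. (if (q, p) \<in> E then w (q, p) * F q p else 0))"
    unfolding sum.distrib[symmetric] by (intro sum.cong refl) (auto simp: v_def algebra_simps)
  also have "(\<Sum>p<K. \<Sum>q<K. (if (q, p) \<in> E then w (q, p) * F q p else 0)) = (\<Sum>q<K. \<Sum>p<K. (if (q, p) \<in> E then w (q, p) * F q p else 0))"
    by (rule sum.swap)
  finally show ?thesis unfolding edge_sum by (simp add: sum.distrib distrib_left)
qed

text \<open>Integration by parts turns each edge term into \<open>w e\<close> times products of
  diagonal entries (\<open>Y\<close>) minus products of entries at the same position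
  (\<open>Z\<close>). The \<open>Y\<close> sum reproduces the \<open>m\<close> term of
  \<open>trace_expansion\<close> up to replacing a random sum by its mean, which is the reason for
  the definition of \<open>m\<close>; the \<open>Z\<close> sum is small.\<close>

lemma bias_bound:
  assumes D: "\<forall>k. \<bar>D k\<bar> \<le> 1"
  shows "\<bar>\<Sum>k<K. D k * (R k k - P.expectation (\<lambda>y. G y k k))\<bar> \<le> bias_const"
proof -
  define U where "U y = wprod K (G y) D R" for y
  have U_bd: "\<bar>U y i j\<bar> \<le> 1 / s\<^sup>2" for y i j
    unfolding U_def by (rule wprod_G_le) (use R_col D in auto)
  have U_meas [measurable]: "(\<lambda>y. U y i j) \<in> borel_measurable \<P>" for i j
    unfolding U_def by measurable
  have U_int [simp]: "integrable \<P> (\<lambda>y. U y i j)" for i j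
    by (rule bounded_integrable[OF U_meas U_bd])
  have G_int [simp]: "integrable \<P> (\<lambda>y. G y i j)" for i j
    by (rule bounded_integrable[OF G_measurable G_abs_le])
  have GU_int [simp]: "integrable \<P> (\<lambda>y. G y i j * U y k l)" for i j k l
  proof (rule bounded_integrable)
    fix y
    show "\<bar>G y i j * U y k l\<bar> \<le> (1 / s) * (1 / s\<^sup>2)"
      unfolding abs_mult by (intro mult_mono G_abs_le U_bd) (use s_pos in auto)
  qed measurable
  have yU_int [simp]: "integrable \<P> (\<lambda>y. y e * U y i j)" if "e \<in> E" for e i j
  proof (rule Bochner_Integration.integrable_bound)
    show "integrable \<P> (\<lambda>y. (1 / s\<^sup>2) * \<bar>y e\<bar>)" using power_integrable[OF that] by simp
    show "(\<lambda>y. y e * U y i j) \<in> borel_measurable \<P>" using that by measurable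
    show "AE y in \<P>. norm (y e * U y i j) \<le> norm ((1 / s\<^sup>2) * \<bar>y e\<bar>)"
      using mult_left_mono[OF U_bd[of _ i j], of "\<bar>_ e\<bar>"]
      by (intro AE_I2) (simp add: abs_mult mult.commute)
  qed
  define X where "X e = P.expectation (\<lambda>y. y e * (U y (snd e) (fst e) - U y (fst e) (snd e)))" for e
  define Y where "Y i j = P.expectation (\<lambda>y. G y i i * U y j j)" for i j
  define Z where "Z i j = P.expectation (\<lambda>y. G y i j * U y i j)" for i j
  have main: "(\<Sum>k<K. D k * (R k k - P.expectation (\<lambda>y. G y k k))) =
      (\<Sum>e\<in>E. X e) - (\<Sum>p<K. m p * P.expectation (\<lambda>y. U y p p))"
  proof -
    have "(\<Sum>k<K. D k * (R k k - P.expectation (\<lambda>y. G y k k))) = P.expectation (\<lambda>y. \<Sum>k<K. D k * (R k k - G y k k))"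
      by (simp add: P.prob_space)
    also have "\<dots> = P.expectation (\<lambda>y. (\<Sum>e\<in>E. y e * U y (snd e) (fst e) - y e * U y (fst e) (snd e)) - (\<Sum>p<K. m p * U y p p))"
      unfolding trace_expansion U_def by (simp add: right_diff_distrib)
    also have "\<dots> = (\<Sum>e\<in>E. P.expectation (\<lambda>y. y e * U y (snd e) (fst e) - y e * U y (fst e) (snd e))) - (\<Sum>p<K. m p * P.expectation (\<lambda>y. U y p p))"
      by (subst Bochner_Integration.integral_diff) auto
    finally show ?thesis by (simp add: X_def right_diff_distrib)
  qed
  have edge: "\<bar>X e - w e * (Y (snd e) (fst e) + Y (fst e) (snd e)) + w e * (Z (snd e) (fst e) + Z (fst e) (snd e))\<bar>
      \<le> (8 * \<kappa> + 16) * h ^ 3 / s ^ 4" if e: "e \<in> E" for e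
  proof -
    obtain p q where pq: "e = (p, q)" by (cases e)
    note ee = entry_expansion[OF pq e R_col D, folded U_def]
    have 1: "\<bar>P.expectation (\<lambda>y. y e * U y q p) + w e * (Z q p - Y q p)\<bar> \<le> (4 * \<kappa> + 8) * h ^ 3 / s ^ 4"
      using ee[of q p] by (simp add: Z_def Y_def)
    have 2: "\<bar>P.expectation (\<lambda>y. y e * U y p q) + w e * (Y p q - Z p q)\<bar> \<le> (4 * \<kappa> + 8) * h ^ 3 / s ^ 4"
      using ee[of p q] by (simp add: Z_def Y_def)
    have "X e = P.expectation (\<lambda>y. y e * U y q p) - P.expectation (\<lambda>y. y e * U y p q)"
      using e by (simp add: X_def pq right_diff_distrib)
    hence "X e - w e * (Y (snd e) (fst e) + Y (fst e) (snd e)) + w e * (Z (snd e) (fst e) + Z (fst e) (snd e))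
       = (P.expectation (\<lambda>y. y e * U y q p) + w e * (Z q p - Y q p)) - (P.expectation (\<lambda>y. y e * U y p q) + w e * (Y p q - Z p q))" (is "?A = _")
      by (simp add: pq algebra_simps)
    hence "\<bar>?A\<bar> = \<bar>\<dots>\<bar>" by (rule arg_cong)
    also have "\<dots> \<le> (4 * \<kappa> + 8) * h ^ 3 / s ^ 4 + (4 * \<kappa> + 8) * h ^ 3 / s ^ 4"
      using 1 2 by linarith
    also have "\<dots> = (8 * \<kappa> + 16) * h ^ 3 / s ^ 4" by (simp add: add_divide_distrib[symmetric] algebra_simps)
    finally show ?thesis .
  qed
  have b_pos: "0 \<le> b" using Kh h_pos by (smt (verit) mult_nonneg_nonneg of_nat_0_le_iff zero_le_power2)
  \<comment> \<open>Remainders of the integration by parts, summed over all edges.\<close>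
  have t1: "\<bar>(\<Sum>e\<in>E. X e) - (\<Sum>p<K. \<Sum>q<K. v p q * Y q p) + (\<Sum>p<K. \<Sum>q<K. v p q * Z q p)\<bar> \<le> b\<^sup>2 * (8 * \<kappa> + 16) / (s ^ 4 * h)"
  proof -
    have "(\<Sum>e\<in>E. X e) - (\<Sum>p<K. \<Sum>q<K. v p q * Y q p) + (\<Sum>p<K. \<Sum>q<K. v p q * Z q p)
       = (\<Sum>e\<in>E. X e - w e * (Y (snd e) (fst e) + Y (fst e) (snd e)) + w e * (Z (snd e) (fst e) + Z (fst e) (snd e)))" (is "?A = _")
      unfolding weighted_edge_sum[symmetric] by (simp add: sum.distrib sum_subtractf)
    hence "\<bar>?A\<bar> = \<bar>\<dots>\<bar>" by (rule arg_cong)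
    also have "\<dots> \<le> (\<Sum>e\<in>E. (8 * \<kappa> + 16) * h ^ 3 / s ^ 4)"
      by (rule order.trans[OF sum_abs]) (intro sum_mono edge)
    also have "\<dots> = real (card E) * ((8 * \<kappa> + 16) * h ^ 3 / s ^ 4)" by simp
    also have "\<dots> \<le> (real K)\<^sup>2 * ((8 * \<kappa> + 16) * h ^ 3 / s ^ 4)"
    proof (rule mult_right_mono)
      show "real (card E) \<le> (real K)\<^sup>2" using card_E by (metis of_nat_le_iff of_nat_power)
    qed (use \<kappa>_nonneg h_pos s_pos in auto)
    also have "\<dots> = (real K * h\<^sup>2)\<^sup>2 * ((8 * \<kappa> + 16) / (s ^ 4 * h))"
      using h_pos s_pos by (simp add: field_simps power2_eq_square power3_eq_cube)
    also have "\<dots> \<le> b\<^sup>2 * ((8 * \<kappa> + 16) / (s ^ 4 * h))"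
      using Kh \<kappa>_nonneg h_pos s_pos by (intro mult_right_mono power_mono) auto
    finally show ?thesis by simp
  qed
  \<comment> \<open>\<open>g p\<close> - \<open>m p\<close> is h^2 times a centred weighted trace,
    so \<open>variance_bound\<close> applies; |z| <= (z^2 + 1) / 2 explains the form of the bound.
    The factor h^2 compensates the sum over p.\<close>
  have t2: "\<bar>(\<Sum>p<K. \<Sum>q<K. v p q * Y q p) - (\<Sum>p<K. m p * P.expectation (\<lambda>y. U y p p))\<bar> \<le> b * (var_const + 1) / (2 * s\<^sup>2)"
  proof -
    define g where "g p y = (\<Sum>q<K. v p q * G y q q)" for p y
    have g_int: "integrable \<P> (g p)" for p unfolding g_def by simp
    have m_g: "m p = P.expectation (g p)" for p by (simp add: m_def g_def[abs_def])
    have gU_int: "integrable \<P> (\<lambda>y. g p y * U y p p)" for p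
      unfolding g_def sum_distrib_right by (simp add: mult.assoc)
    have "(\<Sum>p<K. \<Sum>q<K. v p q * Y q p) - (\<Sum>p<K. m p * P.expectation (\<lambda>y. U y p p))
       = (\<Sum>p<K. P.expectation (\<lambda>y. (g p y - m p) * U y p p))" (is "?A = _")
      using gU_int by (simp add: left_diff_distrib sum_subtractf)
        (simp add: g_def Y_def sum_distrib_right mult.assoc)
    hence "\<bar>?A\<bar> = \<bar>\<dots>\<bar>" by (rule arg_cong)
    also have "\<dots> \<le> (\<Sum>p<K. h\<^sup>2 * (var_const + 1) / (2 * s\<^sup>2))"
    proof (rule order.trans[OF sum_abs], rule sum_mono)
      fix p
      define D' where "D' q = v p q / h\<^sup>2" for q
      have D': "\<forall>k. \<bar>D' k\<bar> \<le> 1" using v_bounds[of p] h_pos by (simp add: D'_def)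
      have gf: "g p y = h\<^sup>2 * diag_stat D' y" for y
        using h_pos by (simp add: g_def diag_stat_def D'_def sum_distrib_left)
      have mf: "m p = h\<^sup>2 * P.expectation (diag_stat D')"
        unfolding m_g gf[abs_def] by simp
      have f_bd: "\<bar>diag_stat D' y - P.expectation (diag_stat D')\<bar> \<le> 2 * (real K / s)" for y
      proof -
        have fi: "integrable \<P> (diag_stat D')" by (rule bounded_integrable[OF diag_stat_measurable diag_stat_abs_le[OF D']])
        have "\<bar>P.expectation (diag_stat D')\<bar> \<le> P.expectation (\<lambda>y. \<bar>diag_stat D' y\<bar>)" by (rule integral_abs_bound)
        also have "\<dots> \<le> P.expectation (\<lambda>_. real K / s)"
          by (intro integral_mono diag_stat_abs_le[OF D']) (use fi in auto)
        finally show ?thesis using diag_stat_abs_le[OF D', of y] by (simp add: P.prob_space)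
      qed
      have f_int: "integrable \<P> (\<lambda>y. diag_stat D' y - P.expectation (diag_stat D'))"
        by (rule bounded_integrable[OF _ f_bd]) measurable
      have f2_int: "integrable \<P> (\<lambda>y. (diag_stat D' y - P.expectation (diag_stat D'))\<^sup>2)"
      proof (rule bounded_integrable)
        fix y show "\<bar>(diag_stat D' y - P.expectation (diag_stat D'))\<^sup>2\<bar> \<le> (2 * (real K / s))\<^sup>2"
          using f_bd[of y] s_pos by (simp add: abs_le_square_iff[symmetric])
      qed measurable
      have "\<bar>P.expectation (\<lambda>y. (g p y - m p) * U y p p)\<bar> \<le> P.expectation (\<lambda>y. \<bar>(g p y - m p) * U y p p\<bar>)"
        by (rule integral_abs_bound)
      also have "\<dots> \<le> P.expectation (\<lambda>y. (h\<^sup>2 / (2 * s\<^sup>2)) * ((diag_stat D' y - P.expectation (diag_stat D'))\<^sup>2 + 1))"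
      proof (rule integral_mono)
        fix y
        let ?z = "diag_stat D' y - P.expectation (diag_stat D')"
        have "\<bar>(g p y - m p) * U y p p\<bar> = h\<^sup>2 * \<bar>?z\<bar> * \<bar>U y p p\<bar>"
          unfolding gf mf by (simp add: abs_mult right_diff_distrib[symmetric])
        also have "\<dots> \<le> h\<^sup>2 * ((?z\<^sup>2 + 1) / 2) * (1 / s\<^sup>2)"
          using sum_squares_bound[of "\<bar>?z\<bar>" 1]
          by (intro mult_mono mult_left_mono U_bd) auto
        finally show "\<bar>(g p y - m p) * U y p p\<bar> \<le> (h\<^sup>2 / (2 * s\<^sup>2)) * (?z\<^sup>2 + 1)" by simp
      qed (use gU_int f2_int in \<open>auto simp: left_diff_distrib\<close>)
      also have "\<dots> = (h\<^sup>2 / (2 * s\<^sup>2)) * (P.expectation (\<lambda>y. (diag_stat D' y - P.expectation (diag_stat D'))\<^sup>2) + 1)"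
        using f2_int by (simp add: P.prob_space)
      also have "\<dots> \<le> (h\<^sup>2 / (2 * s\<^sup>2)) * (var_const + 1)"
        using variance_bound[OF D'] by (intro mult_left_mono) auto
      finally show "\<bar>P.expectation (\<lambda>y. (g p y - m p) * U y p p)\<bar> \<le> h\<^sup>2 * (var_const + 1) / (2 * s\<^sup>2)" by simp
    qed
    also have "\<dots> = (real K * h\<^sup>2) * ((var_const + 1) / (2 * s\<^sup>2))" by simp
    also have "\<dots> \<le> b * ((var_const + 1) / (2 * s\<^sup>2))"
      using Kh b_pos \<kappa>_nonneg s_pos by (intro mult_right_mono) (auto simp: var_const_def)
    finally show ?thesis by simp
  qed
  have sq_int: "integrable \<P> (\<lambda>y. ((G y q p)\<^sup>2 / s + s * (U y q p)\<^sup>2) / 2)" for p q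
    proof (rule bounded_integrable)
      fix y
      have "(G y q p)\<^sup>2 \<le> (1 / s)\<^sup>2" "(U y q p)\<^sup>2 \<le> (1 / s\<^sup>2)\<^sup>2"
        using G_abs_le[of y q p] U_bd[of y q p] s_pos by (simp_all add: abs_le_square_iff[symmetric])
      hence "((G y q p)\<^sup>2 / s + s * (U y q p)\<^sup>2) / 2 \<le> ((1 / s)\<^sup>2 / s + s * (1 / s\<^sup>2)\<^sup>2) / 2"
        using s_pos by (intro divide_right_mono add_mono mult_left_mono) auto
      thus "\<bar>((G y q p)\<^sup>2 / s + s * (U y q p)\<^sup>2) / 2\<bar> \<le> ((1 / s)\<^sup>2 / s + s * (1 / s\<^sup>2)\<^sup>2) / 2"
        using s_pos by simp
    qed measurable
  \<comment> \<open>A Frobenius inner product of \<open>G\<close> and \<open>U\<close> with weights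
    at most h^2. AM-GM with parameter s balances the squared norms K / s^2 and K / s^4.\<close>
  have t3: "\<bar>\<Sum>p<K. \<Sum>q<K. v p q * Z q p\<bar> \<le> b / s ^ 3"
  proof -
    have "\<bar>\<Sum>p<K. \<Sum>q<K. v p q * Z q p\<bar> \<le> (\<Sum>p<K. \<Sum>q<K. h\<^sup>2 * P.expectation (\<lambda>y. ((G y q p)\<^sup>2 / s + s * (U y q p)\<^sup>2) / 2))"
    proof (rule order.trans[OF sum_abs], rule sum_mono, rule order.trans[OF sum_abs], rule sum_mono)
      fix p q
      have "\<bar>Z q p\<bar> \<le> P.expectation (\<lambda>y. \<bar>G y q p * U y q p\<bar>)" unfolding Z_def by (rule integral_abs_bound)
      also have "\<dots> \<le> P.expectation (\<lambda>y. ((G y q p)\<^sup>2 / s + s * (U y q p)\<^sup>2) / 2)"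
      proof (rule integral_mono)
        show "integrable \<P> (\<lambda>y. ((G y q p)\<^sup>2 / s + s * (U y q p)\<^sup>2) / 2)" by (rule sq_int)
        fix y
        have "2 * (\<bar>G y q p\<bar> * (s * \<bar>U y q p\<bar>)) \<le> (G y q p)\<^sup>2 + (s * \<bar>U y q p\<bar>)\<^sup>2"
          using sum_squares_bound[of "\<bar>G y q p\<bar>" "s * \<bar>U y q p\<bar>"] by simp
        thus "\<bar>G y q p * U y q p\<bar> \<le> ((G y q p)\<^sup>2 / s + s * (U y q p)\<^sup>2) / 2"
          using s_pos by (simp add: field_simps abs_mult power2_eq_square power_mult_distrib)
      qed simp
      finally show "\<bar>v p q * Z q p\<bar> \<le> h\<^sup>2 * P.expectation (\<lambda>y. ((G y q p)\<^sup>2 / s + s * (U y q p)\<^sup>2) / 2)"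
        unfolding abs_mult using v_bounds[of p q] by (intro mult_mono) auto
    qed
    also have "\<dots> = h\<^sup>2 * P.expectation (\<lambda>y. \<Sum>p<K. \<Sum>q<K. ((G y q p)\<^sup>2 / s + s * (U y q p)\<^sup>2) / 2)"
      by (simp only: sum_distrib_left[symmetric] Bochner_Integration.integral_sum Bochner_Integration.integrable_sum sq_int)
    also have "\<dots> \<le> h\<^sup>2 * (real K / s ^ 3)"
    proof (rule mult_left_mono)
      have "P.expectation (\<lambda>y. \<Sum>p<K. \<Sum>q<K. ((G y q p)\<^sup>2 / s + s * (U y q p)\<^sup>2) / 2) \<le> P.expectation (\<lambda>y. real K / s ^ 3)"
      proof (rule integral_mono')
        fix y
        have "(\<Sum>p<K. \<Sum>q<K. ((G y q p)\<^sup>2 / s + s * (U y q p)\<^sup>2) / 2)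
            = ((\<Sum>p<K. \<Sum>q<K. (G y q p)\<^sup>2) / s + s * (\<Sum>p<K. \<Sum>q<K. (U y q p)\<^sup>2)) / 2"
          by (simp only: sum_divide_distrib[symmetric] sum.distrib sum_distrib_left[symmetric])
        also have "(\<Sum>p<K. \<Sum>q<K. (G y q p)\<^sup>2) \<le> (\<Sum>p<K. (1 / s)\<^sup>2)"
          by (intro sum_mono G_col')
        also have "(\<Sum>p<K. \<Sum>q<K. (U y q p)\<^sup>2) \<le> real K / s ^ 4"
          unfolding U_def by (subst sum.swap) (rule wprod_frobenius[OF R_col D])
        also have "((\<Sum>p<K. (1 / s)\<^sup>2) / s + s * (real K / s ^ 4)) / 2 = real K / s ^ 3"
          using s_pos by (simp add: field_simps power2_eq_square power3_eq_cube power4_eq_xxxx)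
        finally show "(\<Sum>p<K. \<Sum>q<K. ((G y q p)\<^sup>2 / s + s * (U y q p)\<^sup>2) / 2) \<le> real K / s ^ 3"
          using s_pos by (simp add: divide_right_mono mult_left_mono)
      qed (use s_pos in auto)
      thus "P.expectation (\<lambda>y. \<Sum>p<K. \<Sum>q<K. ((G y q p)\<^sup>2 / s + s * (U y q p)\<^sup>2) / 2) \<le> real K / s ^ 3"
        by (simp add: P.prob_space)
    qed simp
    also have "\<dots> = (real K * h\<^sup>2) / s ^ 3" by simp
    also have "\<dots> \<le> b / s ^ 3" using Kh s_pos by (intro divide_right_mono) auto
    finally show ?thesis .
  qed
  show ?thesis unfolding main bias_const_def using t1 t2 t3 by linarith
qed

text \<open>The map defining the deterministic equivalent contracts once \<open>b \<le> s\<^sup>2 / 2\<close>.\<close>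

theorem deterministic_equivalent:
  fixes d :: "nat \<Rightarrow> real"
  defines "\<Gamma> \<equiv> inv_fun K (diag_plus d B)"
  assumes d_ge: "\<And>p. p < K \<Longrightarrow> s \<le> d p" and fixpt: "\<And>p. p < K \<Longrightarrow> d p = s + (\<Sum>q<K. v p q * \<Gamma> q q)"
    and bs: "2 * b \<le> s\<^sup>2" and D: "\<forall>k. \<bar>D k\<bar> \<le> 1"
  shows "\<bar>P.expectation (diag_stat D) - (\<Sum>k<K. D k * \<Gamma> k k)\<bar> \<le> 2 * bias_const"
proof (cases "K = 0")
  case True
  have "0 \<le> bias_const" using bias_bound[OF D] by linarith
  thus ?thesis unfolding diag_stat_def[abs_def] by (simp add: True)
next
  case False
  \<comment> \<open>The largest difference between the two diagonals \<open>d\<close> and s +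
    \<open>m\<close>; the contraction argument shows that it is of order h^2.\<close>
  define \<theta> where "\<theta> = Max ((\<lambda>p. \<bar>d p - s - m p\<bar>) ` {..<K})"
  have \<theta>: "\<bar>d p - s - m p\<bar> \<le> \<theta>" if "p < K" for p
    unfolding \<theta>_def using that by (intro Max_ge) auto
  have "\<theta> \<in> (\<lambda>p. \<bar>d p - s - m p\<bar>) ` {..<K}"
    unfolding \<theta>_def using False by (intro Max_in) auto
  then obtain p where p: "p < K" "\<theta> = \<bar>d p - s - m p\<bar>" by auto
  have \<theta>_nn: "0 \<le> \<theta>" using p by simp
  have R\<Gamma>: "\<bar>R k k - \<Gamma> k k\<bar> \<le> \<theta> / s\<^sup>2" if k: "k < K" for k
  proof -
    have "R k k - \<Gamma> k k = (\<Sum>i<K. \<Sum>j<K. R k i * (diag_plus d B i j - diag_plus (\<lambda>p. s + m p) B i j) * \<Gamma> j k)" (is "?A = _")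
      unfolding R_def \<Gamma>_def by (rule inv_fun_resolvent_identity[OF s_pos sm B_skew d_ge B_skew k k])
    also have "\<dots> = (\<Sum>i<K. \<Sum>j<K. if j = i then R k i * (d i - s - m i) * \<Gamma> i k else 0)"
      by (intro sum.cong refl) (auto simp: diag_plus_def)
    also have "\<dots> = (\<Sum>i<K. R k i * (d i - s - m i) * \<Gamma> i k)" by simp
    finally have "\<bar>?A\<bar> = \<bar>\<Sum>i<K. R k i * (d i - s - m i) * \<Gamma> i k\<bar>" by (rule arg_cong)
    also have "\<dots> \<le> (\<Sum>i<K. \<theta> * ((R k i)\<^sup>2 + (\<Gamma> i k)\<^sup>2) / 2)"
    proof (rule order.trans[OF sum_abs], rule sum_mono)
      fix i assume i: "i \<in> {..<K}"
      have "\<bar>R k i * (d i - s - m i) * \<Gamma> i k\<bar> = \<bar>d i - s - m i\<bar> * (\<bar>R k i\<bar> * \<bar>\<Gamma> i k\<bar>)"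
        by (simp add: abs_mult)
      also have "\<dots> \<le> \<theta> * (((R k i)\<^sup>2 + (\<Gamma> i k)\<^sup>2) / 2)"
        using i \<theta> sum_squares_bound[of "\<bar>R k i\<bar>" "\<bar>\<Gamma> i k\<bar>"] \<theta>_nn by (intro mult_mono) auto
      finally show "\<bar>R k i * (d i - s - m i) * \<Gamma> i k\<bar> \<le> \<theta> * ((R k i)\<^sup>2 + (\<Gamma> i k)\<^sup>2) / 2" by simp
    qed
    also have "\<dots> = \<theta> * ((\<Sum>i<K. (R k i)\<^sup>2) + (\<Sum>i<K. (\<Gamma> i k)\<^sup>2)) / 2"
      by (simp only: sum_divide_distrib[symmetric] sum_distrib_left[symmetric] sum.distrib)
    also have "\<dots> \<le> \<theta> * (1 / s\<^sup>2 + 1 / s\<^sup>2) / 2"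
      unfolding R_def \<Gamma>_def
      by (intro divide_right_mono mult_left_mono add_mono \<theta>_nn inv_fun_row_bound[OF s_pos sm B_skew]
          inv_fun_col_bound[OF s_pos d_ge B_skew]) auto
    finally show ?thesis by simp
  qed
  have b_nn: "0 \<le> b" using Kh h_pos by (smt (verit) mult_nonneg_nonneg of_nat_0_le_iff zero_le_power2)
  have D': "\<forall>k. \<bar>v p k / h\<^sup>2\<bar> \<le> 1" using v_bounds[of p] h_pos by simp
  \<comment> \<open>At an index where \<theta> is attained. The first sum is at most \<theta> / 2
    and is absorbed; the second is \<open>bias_bound\<close> with a row of \<open>v\<close>, scaled
    by h^2 to be an admissible weight.\<close>
  have "d p - s - m p = (\<Sum>q<K. v p q * (\<Gamma> q q - R q q)) + h\<^sup>2 * (\<Sum>q<K. v p q / h\<^sup>2 * (R q q - P.expectation (\<lambda>y. G y q q)))"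
    using h_pos by (simp add: fixpt[OF p(1)] m_def sum_distrib_left right_diff_distrib sum_subtractf)
  moreover have "\<bar>\<Sum>q<K. v p q * (\<Gamma> q q - R q q)\<bar> \<le> \<theta> / 2"
  proof -
    have "\<bar>\<Sum>q<K. v p q * (\<Gamma> q q - R q q)\<bar> \<le> (\<Sum>q<K. h\<^sup>2 * (\<theta> / s\<^sup>2))"
    proof (rule order.trans[OF sum_abs], rule sum_mono)
      fix q assume "q \<in> {..<K}"
      thus "\<bar>v p q * (\<Gamma> q q - R q q)\<bar> \<le> h\<^sup>2 * (\<theta> / s\<^sup>2)"
        unfolding abs_mult using v_bounds[of p q] R\<Gamma>[of q] by (intro mult_mono) (auto simp: abs_minus_commute)
    qed
    also have "\<dots> = (real K * h\<^sup>2) * (\<theta> / s\<^sup>2)" by simp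
    also have "\<dots> \<le> (s\<^sup>2 / 2) * (\<theta> / s\<^sup>2)"
      using Kh bs \<theta>_nn by (intro mult_right_mono) auto
    finally show ?thesis using s_pos by simp
  qed
  moreover have "\<bar>h\<^sup>2 * (\<Sum>q<K. v p q / h\<^sup>2 * (R q q - P.expectation (\<lambda>y. G y q q)))\<bar> \<le> h\<^sup>2 * bias_const"
    unfolding abs_mult using bias_bound[OF D'] by (simp add: mult_left_mono)
  ultimately have \<theta>_le: "\<theta> \<le> 2 * h\<^sup>2 * bias_const" using p(2) by linarith
  have G_int: "integrable \<P> (\<lambda>y. G y i j)" for i j
    by (rule bounded_integrable[OF G_measurable G_abs_le])
  have "P.expectation (diag_stat D) - (\<Sum>k<K. D k * \<Gamma> k k)
      = (\<Sum>k<K. D k * (R k k - \<Gamma> k k)) - (\<Sum>k<K. D k * (R k k - P.expectation (\<lambda>y. G y k k)))"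
    using G_int by (simp add: diag_stat_def[abs_def] right_diff_distrib sum_subtractf)
  \<comment> \<open>Summing over K indices is affordable because \<theta> carries a factor h^2, and
    K h^2 <= b <= s^2 / 2.\<close>
  moreover have "\<bar>\<Sum>k<K. D k * (R k k - \<Gamma> k k)\<bar> \<le> bias_const"
  proof -
    have "\<bar>\<Sum>k<K. D k * (R k k - \<Gamma> k k)\<bar> \<le> (\<Sum>k<K. 1 * (\<theta> / s\<^sup>2))"
    proof (rule order.trans[OF sum_abs], rule sum_mono)
      fix k assume "k \<in> {..<K}"
      thus "\<bar>D k * (R k k - \<Gamma> k k)\<bar> \<le> 1 * (\<theta> / s\<^sup>2)"
        unfolding abs_mult using D R\<Gamma>[of k] by (intro mult_mono) auto
    qed
    also have "\<dots> = real K * (\<theta> / s\<^sup>2)" by simp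
    also have "\<dots> \<le> real K * (2 * h\<^sup>2 * bias_const / s\<^sup>2)"
      using \<theta>_le s_pos by (intro mult_left_mono divide_right_mono) auto
    also have "\<dots> = (real K * h\<^sup>2) * (2 * bias_const / s\<^sup>2)" by simp
    also have "\<dots> \<le> (s\<^sup>2 / 2) * (2 * bias_const / s\<^sup>2)"
      using Kh bs bias_bound[OF D] by (intro mult_right_mono) auto
    finally show ?thesis using s_pos by simp
  qed
  ultimately show ?thesis using bias_bound[OF D] by linarith
qed

end

section \<open>Linearisation of the resolvents\<close>

definition skew_block :: "nat \<Rightarrow> real Matrix.mat \<Rightarrow> nat \<Rightarrow> nat \<Rightarrow> real" where
  "skew_block N A p q = (if p < N \<and> N \<le> q then A $$ (p, q - N) else if q < N \<and> N \<le> p then - (A $$ (q, p - N)) else 0)"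

definition variance_profile :: "nat \<Rightarrow> nat \<Rightarrow> (nat \<Rightarrow> nat \<Rightarrow> real) \<Rightarrow> nat \<Rightarrow> nat \<Rightarrow> real" where
  "variance_profile N n \<sigma> p q = (if p < N \<and> N \<le> q then (\<sigma> p (q - N))\<^sup>2 / real n
     else if q < N \<and> N \<le> p then (\<sigma> q (p - N))\<^sup>2 / real n else 0)"

lemma skew_block_skew: "skew_block N A p q = - skew_block N A q p"
  by (auto simp: skew_block_def)

lemma sum_split_block:
  fixes f :: "nat \<Rightarrow> real"
  shows "(\<Sum>k<N + n. f k) = (\<Sum>k<N. f k) + (\<Sum>j<n. f (N + j))"
  by (simp add: lessThan_atLeast0 sum.nat_group[symmetric] sum.atLeastLessThan_concat[of 0 N "N + n", symmetric]
      sum.shift_bounds_nat_ivl[of f 0 N n, simplified, symmetric] add.commute)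

text \<open>For square matrices a one-sided inverse makes \<open>X\<close> a unit, so
  \<open>mat_inverse\<close> succeeds, and its result is \<open>Y\<close> by uniqueness of
  inverses.\<close>

lemma minv_eq:
  assumes X: "X \<in> carrier_mat n n" "Y \<in> carrier_mat n n" "X * Y = 1\<^sub>m n"
  shows "minv X = Y"
proof -
  have YX: "Y * X = 1\<^sub>m n" by (rule mat_mult_left_right_inverse[OF X])
  have "X \<in> Units (ring_mat TYPE('a) n ())"
    using X YX by (auto simp: Units_def ring_mat_simps)
  with mat_inverse(1)[OF X(1), where b = "()"] obtain Z where Z: "mat_inverse X = Some Z" by (cases "mat_inverse X") auto
  note Zp = mat_inverse(2)[OF X(1) Z]
  have "Z = Z * (X * Y)" using Zp X(3) right_mult_one_mat[of Z n n] by simp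
  also have "\<dots> = (Z * X) * Y" using Zp X by (intro assoc_mult_mat[symmetric]) auto
  also have "\<dots> = Y" using Zp X by simp
  finally show ?thesis by (simp add: minv_def Z)
qed

lemma minv_of_real:
  fixes x y :: "nat \<Rightarrow> nat \<Rightarrow> real"
  assumes "\<And>i j. i < n \<Longrightarrow> j < n \<Longrightarrow> (\<Sum>l<n. x i l * y l j) = (if i = j then 1 else 0)"
  shows "minv (Matrix.mat n n (\<lambda>(i, j). complex_of_real (x i j))) = Matrix.mat n n (\<lambda>(i, j). complex_of_real (y i j))"
proof (rule minv_eq)
  show "Matrix.mat n n (\<lambda>(i, j). complex_of_real (x i j)) * Matrix.mat n n (\<lambda>(i, j). complex_of_real (y i j)) = 1\<^sub>m n"
  proof (rule eq_matI)
    fix i j assume ij: "i < dim_row (1\<^sub>m n :: complex Matrix.mat)" "j < dim_col (1\<^sub>m n :: complex Matrix.mat)"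
    have "(\<Sum>l<n. complex_of_real (x i l) * complex_of_real (y l j)) = complex_of_real (\<Sum>l<n. x i l * y l j)"
      by simp
    also have "\<dots> = (if i = j then 1 else 0)" using assms[of i j] ij by simp
    finally show "(Matrix.mat n n (\<lambda>(i, j). complex_of_real (x i j)) * Matrix.mat n n (\<lambda>(i, j). complex_of_real (y i j))) $$ (i, j) = 1\<^sub>m n $$ (i, j)"
      using ij by (simp add: scalar_prod_def atLeast0LessThan)
  qed auto
qed auto

lemma minv_mat_diag:
  assumes "\<And>i. i < n \<Longrightarrow> f i \<noteq> (0 :: complex)"
  shows "minv (mat_diag n f) = mat_diag n (\<lambda>i. 1 / f i)"
proof (rule minv_eq)
  show "mat_diag n f * mat_diag n (\<lambda>i. 1 / f i) = 1\<^sub>m n"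
    unfolding mat_diag_diag using assms by (intro eq_matI) (auto simp: mat_diag_def)
qed auto

text \<open>Used with \<open>P\<close> equal to the deterministic matrix for T and to its transpose
  for T~.\<close>

lemma diag_plus_sandwich:
  fixes P :: "real Matrix.mat"
  assumes P: "P \<in> carrier_mat N n"
  shows "mat_diag N (\<lambda>i. complex_of_real (x i)) - complex_of_real (- t) \<cdot>\<^sub>m
      (cmat P * mat_diag n (\<lambda>k. complex_of_real (y k)) * transpose_mat (cmat P))
    = Matrix.mat N N (\<lambda>(i, l). complex_of_real ((if i = l then x i else 0) + t * (\<Sum>k<n. P $$ (i, k) * y k * P $$ (l, k))))"
    (is "?D - _ \<cdot>\<^sub>m ?M = ?R")
proof (rule eq_matI)
  have dP: "dim_row P = N" "dim_col P = n" and cP: "cmat P \<in> carrier_mat N n" using P by auto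
  show "dim_row (?D - complex_of_real (- t) \<cdot>\<^sub>m ?M) = dim_row ?R" "dim_col (?D - complex_of_real (- t) \<cdot>\<^sub>m ?M) = dim_col ?R"
    by (simp_all add: dP)
  fix i l assume "i < dim_row ?R" "l < dim_col ?R"
  hence il: "i < N" "l < N" by auto
  have "?M $$ (i, l) = (\<Sum>k<n. complex_of_real (P $$ (i, k)) * complex_of_real (y k) * complex_of_real (P $$ (l, k)))"
    using il dP cP by (subst mat_diag_mult_right[OF cP]) (simp add: scalar_prod_def atLeast0LessThan)
  also have "\<dots> = complex_of_real (\<Sum>k<n. P $$ (i, k) * y k * P $$ (l, k))" by simp
  finally have e: "?M $$ (i, l) = \<dots>" .
  have "(?D - complex_of_real (- t) \<cdot>\<^sub>m ?M) $$ (i, l)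
      = complex_of_real (if i = l then x i else 0) - complex_of_real (- t) * complex_of_real (\<Sum>k<n. P $$ (i, k) * y k * P $$ (l, k))"
    unfolding e[symmetric] using il dP by (simp add: mat_diag_def)
  also have "\<dots> = complex_of_real ((if i = l then x i else 0) + t * (\<Sum>k<n. P $$ (i, k) * y k * P $$ (l, k)))"
    by (simp only: of_real_add of_real_mult of_real_minus) simp
  finally show "(?D - complex_of_real (- t) \<cdot>\<^sub>m ?M) $$ (i, l) = ?R $$ (i, l)" using il by simp
qed

lemma scale_cancel:
  fixes s :: real
  assumes "0 < s"
  shows "((if c then s * x else 0) + s * X) * (g / s) = (if c then x * g else 0) + X * g"
  using assms by (simp add: field_simps)

context
  fixes N n :: nat and A :: "real Matrix.mat" and d :: "nat \<Rightarrow> real" and s :: real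
  assumes A: "A \<in> carrier_mat N n" and s_pos: "0 < s" and d_ge: "\<And>k. k < N + n \<Longrightarrow> s \<le> d k"
begin

abbreviation (input) \<Gamma> :: "nat \<Rightarrow> nat \<Rightarrow> real" where
  "\<Gamma> \<equiv> inv_fun (N + n) (diag_plus d (skew_block N A))"

lemma \<Gamma>_right:
  "a < N + n \<Longrightarrow> c < N + n \<Longrightarrow> d a * \<Gamma> a c + (\<Sum>k<N + n. skew_block N A a k * \<Gamma> k c) = (if a = c then 1 else 0)"
  using inv_fun_right[where K = "N + n" and s = s and d = d and B = "skew_block N A" and a = a and b = c, OF s_pos d_ge skew_block_skew]
    diag_plus_mult_vec[of a "N + n" d "skew_block N A" "\<lambda>k. \<Gamma> k c"] by simp

lemma \<Gamma>_row_upper: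
  assumes "i < N" "c < N + n"
  shows "d i * \<Gamma> i c + (\<Sum>k<n. A $$ (i, k) * \<Gamma> (N + k) c) = (if i = c then 1 else 0)"
proof -
  have "d i * \<Gamma> i c + (\<Sum>k<N + n. skew_block N A i k * \<Gamma> k c) = (if i = c then 1 else 0)"
    using \<Gamma>_right assms by simp
  thus ?thesis using assms by (simp add: sum_split_block skew_block_def)
qed

lemma \<Gamma>_row_lower:
  assumes "k < n" "c < N + n"
  shows "d (N + k) * \<Gamma> (N + k) c - (\<Sum>l<N. A $$ (l, k) * \<Gamma> l c) = (if N + k = c then 1 else 0)"
proof -
  have "d (N + k) * \<Gamma> (N + k) c + (\<Sum>l<N + n. skew_block N A (N + k) l * \<Gamma> l c) = (if N + k = c then 1 else 0)"
    using \<Gamma>_right assms by simp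
  thus ?thesis using assms by (simp add: sum_split_block skew_block_def sum_negf)
qed

text \<open>Schur complement: the lower block rows express the lower part of column j by its upper
  part, and substitution into the upper block rows eliminates it. The factors s and 1 / s cancel;
  they give the matrix the form in which it appears in \<open>T_mat\<close>.\<close>

lemma \<Gamma>_upper_block:
  assumes ij: "i < N" "j < N"
  shows "(\<Sum>l<N. ((if i = l then s * d i else 0) + s * (\<Sum>k<n. A $$ (i, k) * A $$ (l, k) / d (N + k))) * (\<Gamma> l j / s))
    = (if i = j then 1 else 0)"
proof -
  have "(\<Sum>l<N. ((if i = l then s * d i else 0) + s * (\<Sum>k<n. A $$ (i, k) * A $$ (l, k) / d (N + k))) * (\<Gamma> l j / s))
     = (\<Sum>l<N. (if i = l then d i * \<Gamma> i j else 0) + (\<Sum>k<n. A $$ (i, k) / d (N + k) * (A $$ (l, k) * \<Gamma> l j)))"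
    by (simp only: scale_cancel[OF s_pos] sum_distrib_right) (auto intro!: sum.cong)
  also have "\<dots> = d i * \<Gamma> i j + (\<Sum>k<n. A $$ (i, k) / d (N + k) * (\<Sum>l<N. A $$ (l, k) * \<Gamma> l j))"
    using ij by (simp add: sum.distrib sum_distrib_left) (rule sum.swap)
  also have "(\<Sum>k<n. A $$ (i, k) / d (N + k) * (\<Sum>l<N. A $$ (l, k) * \<Gamma> l j)) = (\<Sum>k<n. A $$ (i, k) * \<Gamma> (N + k) j)"
  proof (rule sum.cong[OF refl])
    fix k assume k: "k \<in> {..<n}"
    have "(\<Sum>l<N. A $$ (l, k) * \<Gamma> l j) = d (N + k) * \<Gamma> (N + k) j"
      using \<Gamma>_row_lower[of k j] k ij by simp
    moreover have "d (N + k) \<noteq> 0" using d_ge[of "N + k"] k s_pos by auto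
    ultimately show "A $$ (i, k) / d (N + k) * (\<Sum>l<N. A $$ (l, k) * \<Gamma> l j) = A $$ (i, k) * \<Gamma> (N + k) j" by simp
  qed
  finally show ?thesis using \<Gamma>_row_upper[of i j] ij by simp
qed

lemma \<Gamma>_lower_block:
  assumes ij: "i < n" "j < n"
  shows "(\<Sum>l<n. ((if i = l then s * d (N + i) else 0) + s * (\<Sum>k<N. A $$ (k, i) * A $$ (k, l) / d k)) * (\<Gamma> (N + l) (N + j) / s))
    = (if i = j then 1 else 0)"
proof -
  have "(\<Sum>l<n. ((if i = l then s * d (N + i) else 0) + s * (\<Sum>k<N. A $$ (k, i) * A $$ (k, l) / d k)) * (\<Gamma> (N + l) (N + j) / s))
     = (\<Sum>l<n. (if i = l then d (N + i) * \<Gamma> (N + i) (N + j) else 0) + (\<Sum>k<N. A $$ (k, i) / d k * (A $$ (k, l) * \<Gamma> (N + l) (N + j))))"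
    by (simp only: scale_cancel[OF s_pos] sum_distrib_right) (auto intro!: sum.cong)
  also have "\<dots> = d (N + i) * \<Gamma> (N + i) (N + j) + (\<Sum>k<N. A $$ (k, i) / d k * (\<Sum>l<n. A $$ (k, l) * \<Gamma> (N + l) (N + j)))"
    using ij by (simp add: sum.distrib sum_distrib_left) (rule sum.swap)
  also have "(\<Sum>k<N. A $$ (k, i) / d k * (\<Sum>l<n. A $$ (k, l) * \<Gamma> (N + l) (N + j))) = (\<Sum>k<N. - (A $$ (k, i) * \<Gamma> k (N + j)))"
  proof (rule sum.cong[OF refl])
    fix k assume k: "k \<in> {..<N}"
    have "(\<Sum>l<n. A $$ (k, l) * \<Gamma> (N + l) (N + j)) = - (d k * \<Gamma> k (N + j))"
      using \<Gamma>_row_upper[of k "N + j"] k ij by simp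
    moreover have "d k \<noteq> 0" using d_ge[of k] k s_pos by auto
    ultimately show "A $$ (k, i) / d k * (\<Sum>l<n. A $$ (k, l) * \<Gamma> (N + l) (N + j)) = - (A $$ (k, i) * \<Gamma> k (N + j))" by simp
  qed
  finally show ?thesis using \<Gamma>_row_lower[of i "N + j"] ij by (simp add: sum_negf)
qed

text \<open>With psi = 1 / (s d) and z = - s^2, the matrix Psi^(-1) - z A Psi~ A^T is s times the
  Schur complement of diag d + [0, A; - A^T, 0], so the blocks of \<Gamma> divided by s are T and
  T~.\<close>

lemma T_mat_block:
  assumes \<psi>: "\<And>i. i < N \<Longrightarrow> \<psi> i (complex_of_real (- (s\<^sup>2))) = complex_of_real (1 / (s * d i))"
    and \<psi>': "\<And>j. j < n \<Longrightarrow> \<psi>' j (complex_of_real (- (s\<^sup>2))) = complex_of_real (1 / (s * d (N + j)))"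
  shows "T_mat N n A \<psi> \<psi>' (complex_of_real (- (s\<^sup>2))) = Matrix.mat N N (\<lambda>(i, j). complex_of_real (\<Gamma> i j / s))"
    and "T'_mat N n A \<psi> \<psi>' (complex_of_real (- (s\<^sup>2))) = Matrix.mat n n (\<lambda>(i, j). complex_of_real (\<Gamma> (N + i) (N + j) / s))"
proof -
  let ?z = "complex_of_real (- (s\<^sup>2))"
  have d_pos: "k < N + n \<Longrightarrow> d k > 0" for k using d_ge[of k] s_pos by auto
  have mdN: "mat_diag N (\<lambda>i. \<psi> i ?z) = mat_diag N (\<lambda>i. complex_of_real (1 / (s * d i)))"
    using \<psi> by (intro eq_matI) (auto simp: mat_diag_def)
  have mdn: "mat_diag n (\<lambda>i. \<psi>' i ?z) = mat_diag n (\<lambda>i. complex_of_real (1 / (s * d (N + i))))"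
    using \<psi>' by (intro eq_matI) (auto simp: mat_diag_def)
  have iN: "minv (mat_diag N (\<lambda>i. complex_of_real (1 / (s * d i)))) = mat_diag N (\<lambda>i. complex_of_real (s * d i))"
  proof (subst minv_mat_diag)
    show "complex_of_real (1 / (s * d i)) \<noteq> 0" if "i < N" for i
      using d_pos[of i] that s_pos by simp
  qed simp
  have inn: "minv (mat_diag n (\<lambda>i. complex_of_real (1 / (s * d (N + i))))) = mat_diag n (\<lambda>i. complex_of_real (s * d (N + i)))"
  proof (subst minv_mat_diag)
    show "complex_of_real (1 / (s * d (N + i))) \<noteq> 0" if "i < n" for i
      using d_pos[of "N + i"] that s_pos by simp
  qed simp
  have cA: "cmat A \<in> carrier_mat N n" using A by auto
  have dA: "dim_row A = N" "dim_col A = n" using A by auto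
  have cancel: "s\<^sup>2 * (\<Sum>k<m. x k * (1 / (s * g k)) * y k) = s * (\<Sum>k<m. x k * y k / g k)"
    for m and x y g :: "nat \<Rightarrow> real"
    unfolding sum_distrib_left using s_pos by (intro sum.cong refl) (simp add: power2_eq_square field_simps)
  have "minv (mat_diag N (\<lambda>i. \<psi> i ?z)) - ?z \<cdot>\<^sub>m (cmat A * mat_diag n (\<lambda>j. \<psi>' j ?z) * transpose_mat (cmat A))
     = Matrix.mat N N (\<lambda>(i, l). complex_of_real ((if i = l then s * d i else 0) + s * (\<Sum>k<n. A $$ (i, k) * A $$ (l, k) / d (N + k))))"
    unfolding mdN mdn iN diag_plus_sandwich[OF A] by (simp only: cancel)
  thus "T_mat N n A \<psi> \<psi>' ?z = Matrix.mat N N (\<lambda>(i, j). complex_of_real (\<Gamma> i j / s))"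
    unfolding T_mat_def using minv_of_real[of N "\<lambda>i l. (if i = l then s * d i else 0) + s * (\<Sum>k<n. A $$ (i, k) * A $$ (l, k) / d (N + k))" "\<lambda>l j. \<Gamma> l j / s"]
      \<Gamma>_upper_block by simp
  have At: "transpose_mat A \<in> carrier_mat n N" using A by auto
  have tr: "transpose_mat (cmat A) * X * cmat A = cmat (transpose_mat A) * X * transpose_mat (cmat (transpose_mat A))" for X
  proof -
    have "cmat (transpose_mat A) = transpose_mat (cmat A)" by (rule eq_matI) auto
    thus ?thesis by simp
  qed
  have "minv (mat_diag n (\<lambda>i. \<psi>' i ?z)) - ?z \<cdot>\<^sub>m (transpose_mat (cmat A) * mat_diag N (\<lambda>j. \<psi> j ?z) * cmat A)
     = Matrix.mat n n (\<lambda>(i, l). complex_of_real ((if i = l then s * d (N + i) else 0) + s * (\<Sum>k<N. A $$ (k, i) * A $$ (k, l) / d k)))"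
    unfolding mdN mdn inn tr diag_plus_sandwich[OF At]
    by (simp only: cancel) (rule eq_matI; simp add: dA)
  thus "T'_mat N n A \<psi> \<psi>' ?z = Matrix.mat n n (\<lambda>(i, j). complex_of_real (\<Gamma> (N + i) (N + j) / s))"
    unfolding T'_mat_def using minv_of_real[of n "\<lambda>i l. (if i = l then s * d (N + i) else 0) + s * (\<Sum>k<N. A $$ (k, i) * A $$ (k, l) / d k)" "\<lambda>l j. \<Gamma> (N + l) (N + j) / s"]
      \<Gamma>_lower_block by simp
qed

end

text \<open>The case of constant diagonal: S S^T + s^2 = s (s + S S^T / s) is s times a Schur
  complement.\<close>

lemma resolvent_block:
  fixes S :: "real Matrix.mat" and s :: real
  assumes S: "S \<in> carrier_mat N n" and s: "0 < s"
  defines "G \<equiv> inv_fun (N + n) (diag_plus (\<lambda>_. s) (skew_block N S))"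
  shows "resolvent (S * transpose_mat S) (complex_of_real (- (s\<^sup>2))) = Matrix.mat N N (\<lambda>(i, j). complex_of_real (G i j / s))"
    and "resolvent (transpose_mat S * S) (complex_of_real (- (s\<^sup>2))) = Matrix.mat n n (\<lambda>(i, j). complex_of_real (G (N + i) (N + j) / s))"
proof -
  have dS: "dim_row S = N" "dim_col S = n" using S by auto
  have "cmat (S * transpose_mat S) - complex_of_real (- (s\<^sup>2)) \<cdot>\<^sub>m 1\<^sub>m (dim_row (S * transpose_mat S))
    = Matrix.mat N N (\<lambda>(i, l). complex_of_real ((if i = l then s * s else 0) + s * (\<Sum>k<n. S $$ (i, k) * S $$ (l, k) / s)))"
    using s by (intro eq_matI) (auto simp: dS scalar_prod_def atLeast0LessThan power2_eq_square sum_distrib_left)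
  thus "resolvent (S * transpose_mat S) (complex_of_real (- (s\<^sup>2))) = Matrix.mat N N (\<lambda>(i, j). complex_of_real (G i j / s))"
    unfolding resolvent_def using minv_of_real[of N "\<lambda>i l. (if i = l then s * s else 0) + s * (\<Sum>k<n. S $$ (i, k) * S $$ (l, k) / s)" "\<lambda>l j. G l j / s"]
      \<Gamma>_upper_block[OF S s, of "\<lambda>_. s"] unfolding G_def by simp
  have "cmat (transpose_mat S * S) - complex_of_real (- (s\<^sup>2)) \<cdot>\<^sub>m 1\<^sub>m (dim_row (transpose_mat S * S))
    = Matrix.mat n n (\<lambda>(i, l). complex_of_real ((if i = l then s * s else 0) + s * (\<Sum>k<N. S $$ (k, i) * S $$ (k, l) / s)))"
    using s by (intro eq_matI) (auto simp: dS scalar_prod_def atLeast0LessThan power2_eq_square sum_distrib_left)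
  thus "resolvent (transpose_mat S * S) (complex_of_real (- (s\<^sup>2))) = Matrix.mat n n (\<lambda>(i, j). complex_of_real (G (N + i) (N + j) / s))"
    unfolding resolvent_def using minv_of_real[of n "\<lambda>i l. (if i = l then s * s else 0) + s * (\<Sum>k<N. S $$ (k, i) * S $$ (k, l) / s)" "\<lambda>l j. G (N + l) (N + j) / s"]
      \<Gamma>_lower_block[OF S s, of "\<lambda>_. s"] unfolding G_def by simp
qed

section \<open>Stieltjes transforms at negative arguments and the fixed point equation\<close>

lemma prob_on_nonneg_facts:
  assumes "prob_on_nonneg \<nu>"
  shows "prob_space \<nu>" "sets \<nu> = sets borel" "AE x in \<nu>. 0 \<le> x"
proof -
  interpret real_distribution \<nu> using assms by (simp add: prob_on_nonneg_def)
  show "prob_space \<nu>" by unfold_locales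
  show "sets \<nu> = sets borel" by simp
  have "prob {0..} = 1" using assms by (simp add: prob_on_nonneg_def)
  hence "AE x in \<nu>. x \<in> {0..}" by (subst (asm) prob_eq_1) auto
  thus "AE x in \<nu>. 0 \<le> x" by simp
qed

text \<open>Positivity allows the solution of the system to be inverted, and the upper bound becomes
  d >= s. Restricting the integral to the half-line keeps the integrand away from its pole at -
  t.\<close>

lemma stieltjes_neg:
  assumes \<nu>: "prob_on_nonneg \<nu>" and t: "0 < t"
  shows "stieltjes \<nu> (complex_of_real (- t)) = complex_of_real (LINT x:{0..}|\<nu>. 1 / (x + t))"
    and "0 < (LINT x:{0..}|\<nu>. 1 / (x + t))" and "(LINT x:{0..}|\<nu>. 1 / (x + t)) \<le> 1 / t"
proof -
  interpret prob_space \<nu> by (rule prob_on_nonneg_facts[OF \<nu>])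
  note AE = prob_on_nonneg_facts(3)[OF \<nu>] and [measurable_cong] = prob_on_nonneg_facts(2)[OF \<nu>]
  let ?f = "\<lambda>x. indicator {0..} x *\<^sub>R (1 / (x + t))"
  have "stieltjes \<nu> (complex_of_real (- t)) = (LINT x|\<nu>. complex_of_real (?f x))"
    unfolding stieltjes_def
  proof (rule integral_cong_AE)
    show "AE x in \<nu>. 1 / (complex_of_real x - complex_of_real (- t)) = complex_of_real (?f x)"
      using AE by eventually_elim simp
  qed measurable
  thus "stieltjes \<nu> (complex_of_real (- t)) = complex_of_real (LINT x:{0..}|\<nu>. 1 / (x + t))"
    unfolding set_lebesgue_integral_def by (simp only: integral_complex_of_real)
  have bd: "AE x in \<nu>. norm (?f x) \<le> 1 / t"
    using AE by eventually_elim (use t in \<open>auto intro!: divide_left_mono\<close>)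
  have int: "integrable \<nu> ?f"
    by (rule integrable_const_bound[OF bd]) measurable
  have "expectation ?f \<le> expectation (\<lambda>_. 1 / t)"
  proof (rule integral_mono_AE[OF int])
    show "AE x in \<nu>. ?f x \<le> 1 / t" using bd by eventually_elim (metis abs_le_D1 real_norm_def)
  qed simp
  thus "(LINT x:{0..}|\<nu>. 1 / (x + t)) \<le> 1 / t"
    by (simp add: set_lebesgue_integral_def prob_space)
  have ge: "0 \<le> expectation ?f" using t by (intro integral_nonneg_AE) (auto simp: indicator_def)
  have "expectation ?f \<noteq> 0"
  proof
    assume "expectation ?f = 0"
    hence "AE x in \<nu>. ?f x = 0"
      using t by (subst (asm) integral_nonneg_eq_0_iff_AE[OF int]) (auto simp: indicator_def)
    with AE have "AE x in \<nu>. False"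
      by eventually_elim (use t in auto)
    thus False using AE_False by simp
  qed
  with ge show "0 < (LINT x:{0..}|\<nu>. 1 / (x + t))"
    by (simp add: set_lebesgue_integral_def)
qed

lemma has_stieltjes_neg:
  assumes "has_stieltjes \<nu> g" "0 < t"
  shows "g (complex_of_real (- t)) = complex_of_real (LINT x:{0..}|\<nu>. 1 / (x + t))"
  using assms stieltjes_neg(1)[of \<nu> t] unfolding has_stieltjes_def by (auto simp del: of_real_minus)

lemma mtrace_diag_mult:
  assumes "\<And>i. i < n \<Longrightarrow> f i = complex_of_real (g i)"
  shows "mtrace (mat_diag n f * Matrix.mat n n (\<lambda>(i, j). complex_of_real (x i j))) = complex_of_real (\<Sum>i<n. g i * x i i)"
proof -
  have c: "Matrix.mat n n (\<lambda>(i, j). complex_of_real (x i j)) \<in> carrier_mat n n" by simp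
  show ?thesis unfolding mat_diag_mult_left[OF c] mtrace_def using assms by simp
qed

text \<open>\<open>d\<close> stacks 1 / (s psi) and 1 / (s psi~) into one vector of length N + n.
  The two coupled families of equations then become a single fixed point equation for the linearised
  matrix, with the symmetric variance profile as kernel.\<close>

theorem system_fixed_point:
  assumes A: "A \<in> carrier_mat N n" and n: "1 \<le> n" and s: "0 < s"
    and sys: "solves_system N n \<sigma> A \<psi> \<psi>'"
  obtains d where "\<And>k. k < N + n \<Longrightarrow> s \<le> d k"
    and "\<And>k. k < N + n \<Longrightarrow> d k = s + (\<Sum>l<N + n. variance_profile N n \<sigma> k l * inv_fun (N + n) (diag_plus d (skew_block N A)) l l)"
    and "mtrace (T_mat N n A \<psi> \<psi>' (complex_of_real (- (s\<^sup>2)))) = complex_of_real ((\<Sum>k<N. inv_fun (N + n) (diag_plus d (skew_block N A)) k k) / s)"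
    and "mtrace (T'_mat N n A \<psi> \<psi>' (complex_of_real (- (s\<^sup>2)))) = complex_of_real ((\<Sum>k<n. inv_fun (N + n) (diag_plus d (skew_block N A)) (N + k) (N + k)) / s)"
proof -
  let ?t = "s\<^sup>2" let ?z = "complex_of_real (- ?t)"
  have t: "0 < ?t" using s by simp
  have st: "\<exists>p. g ?z = complex_of_real p \<and> 0 < p \<and> p \<le> 1 / ?t" if "g \<in> stieltjes_class" for g
  proof -
    from that obtain \<nu> where \<nu>: "has_stieltjes \<nu> g" by (auto simp: stieltjes_class_def)
    hence "prob_on_nonneg \<nu>" by (simp add: has_stieltjes_def)
    from stieltjes_neg[OF this t] has_stieltjes_neg[OF \<nu> t] show ?thesis by auto
  qed
  have "\<forall>i<N. \<exists>p. \<psi> i ?z = complex_of_real p \<and> 0 < p \<and> p \<le> 1 / ?t"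
    using st sys by (auto simp: solves_system_def)
  then obtain p where p: "\<And>i. i < N \<Longrightarrow> \<psi> i ?z = complex_of_real (p i) \<and> 0 < p i \<and> p i \<le> 1 / ?t"
    by metis
  have "\<forall>j<n. \<exists>p. \<psi>' j ?z = complex_of_real p \<and> 0 < p \<and> p \<le> 1 / ?t"
    using st sys by (auto simp: solves_system_def)
  then obtain p' where p': "\<And>j. j < n \<Longrightarrow> \<psi>' j ?z = complex_of_real (p' j) \<and> 0 < p' j \<and> p' j \<le> 1 / ?t"
    by metis
  define d where "d k = (if k < N then 1 / (s * p k) else 1 / (s * p' (k - N)))" for k
  have inv: "s \<le> 1 / (s * q)" if "0 < q" "q \<le> 1 / ?t" for q
    using that s by (simp add: field_simps power2_eq_square)
  have d_ge: "s \<le> d k" if "k < N + n" for k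
    using inv p[of k] p'[of "k - N"] that by (auto simp: d_def)
  let ?G = "inv_fun (N + n) (diag_plus d (skew_block N A))"
  have psi: "\<psi> i ?z = complex_of_real (1 / (s * d i))" if "i < N" for i
    using p[OF that] that s by (simp add: d_def)
  have psi': "\<psi>' j ?z = complex_of_real (1 / (s * d (N + j)))" if "j < n" for j
    using p'[OF that] that s by (simp add: d_def)
  have T1: "T_mat N n A \<psi> \<psi>' ?z = Matrix.mat N N (\<lambda>(i, j). complex_of_real (?G i j / s))"
    and T2: "T'_mat N n A \<psi> \<psi>' ?z = Matrix.mat n n (\<lambda>(i, j). complex_of_real (?G (N + i) (N + j) / s))"
    using T_mat_block(1)[where s = s and d = d and N = N and n = n and A = A and \<psi> = \<psi> and \<psi>' = \<psi>', OF A s d_ge psi psi'] T_mat_block(2)[where s = s and d = d and N = N and n = n and A = A and \<psi> = \<psi> and \<psi>' = \<psi>', OF A s d_ge psi psi'] by blast+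
  have z: "?z \<in> - \<real>\<^sub>\<ge>\<^sub>0" using t by (simp del: of_real_minus)
  have solve: "1 / (s * q) = s + x / real n" if "complex_of_real q = -1 / (?z * (1 + 1 / of_nat n * complex_of_real (x / s)))" "0 < q" for q x
  proof -
    have "complex_of_real q = complex_of_real (-1 / (- ?t * (1 + 1 / real n * (x / s))))"
      using that(1) by simp
    hence "q = 1 / (?t * (1 + 1 / real n * (x / s)))" by (simp only: of_real_eq_iff) simp
    hence q: "1 / q = ?t * (1 + 1 / real n * (x / s))" by simp
    have "1 / (s * q) = (1 / q) / s" by simp
    also have "\<dots> = s * (1 + 1 / real n * (x / s))"
      unfolding q using s by (simp add: power2_eq_square)
    finally show ?thesis using s by (simp add: distrib_left)
  qed
  show ?thesis
  proof (rule that)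
    show "\<And>k. k < N + n \<Longrightarrow> s \<le> d k" by (rule d_ge)
    show "mtrace (T_mat N n A \<psi> \<psi>' ?z) = complex_of_real ((\<Sum>k<N. ?G k k) / s)"
      unfolding T1 mtrace_def by (simp add: sum_divide_distrib)
    show "mtrace (T'_mat N n A \<psi> \<psi>' ?z) = complex_of_real ((\<Sum>k<n. ?G (N + k) (N + k)) / s)"
      unfolding T2 mtrace_def by (simp add: sum_divide_distrib)
    fix k assume k: "k < N + n"
    show "d k = s + (\<Sum>l<N + n. variance_profile N n \<sigma> k l * ?G l l)"
    proof (cases "k < N")
      case True
      have "complex_of_real (p k) = \<psi> k ?z" using p[OF True] by simp
      also have "\<dots> = -1 / (?z * (1 + 1 / of_nat n * mtrace (D'_mat n \<sigma> k * T'_mat N n A \<psi> \<psi>' ?z)))"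
        using sys z True unfolding solves_system_def by blast
      also have "mtrace (D'_mat n \<sigma> k * T'_mat N n A \<psi> \<psi>' ?z) = complex_of_real (\<Sum>j<n. (\<sigma> k j)\<^sup>2 * (?G (N + j) (N + j) / s))"
        unfolding T2 D'_mat_def by (rule mtrace_diag_mult) simp
      also have "(\<Sum>j<n. (\<sigma> k j)\<^sup>2 * (?G (N + j) (N + j) / s)) = (\<Sum>j<n. (\<sigma> k j)\<^sup>2 * ?G (N + j) (N + j)) / s"
        by (simp add: sum_divide_distrib)
      finally have "1 / (s * p k) = s + (\<Sum>j<n. (\<sigma> k j)\<^sup>2 * ?G (N + j) (N + j)) / real n"
        using solve p[OF True] by blast
      thus ?thesis using True s by (simp add: d_def sum_split_block variance_profile_def sum_divide_distrib)
    next
      case False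
      define j where "j = k - N"
      have j: "j < n" "k = N + j" using k False by (auto simp: j_def)
      have "complex_of_real (p' j) = \<psi>' j ?z" using p'[OF j(1)] by simp
      also have "\<dots> = -1 / (?z * (1 + 1 / of_nat n * mtrace (D_mat N \<sigma> j * T_mat N n A \<psi> \<psi>' ?z)))"
        using sys z j(1) unfolding solves_system_def by blast
      also have "mtrace (D_mat N \<sigma> j * T_mat N n A \<psi> \<psi>' ?z) = complex_of_real (\<Sum>i<N. (\<sigma> i j)\<^sup>2 * (?G i i / s))"
        unfolding T1 D_mat_def by (rule mtrace_diag_mult) simp
      also have "(\<Sum>i<N. (\<sigma> i j)\<^sup>2 * (?G i i / s)) = (\<Sum>i<N. (\<sigma> i j)\<^sup>2 * ?G i i) / s"
        by (simp add: sum_divide_distrib)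
      finally have "1 / (s * p' j) = s + (\<Sum>i<N. (\<sigma> i j)\<^sup>2 * ?G i i) / real n"
        using solve p'[OF j(1)] by blast
      thus ?thesis using j s by (simp add: d_def sum_split_block variance_profile_def sum_divide_distrib)
    qed
  qed
qed

section \<open>Convergence of measures from Stieltjes transforms\<close>

lemma continuous_bounded_integral:
  fixes \<phi> :: "real \<Rightarrow> real"
  assumes \<nu>: "prob_on_nonneg \<nu>" and cont: "continuous_on {0..} \<phi>" and bd: "\<And>x. 0 \<le> x \<Longrightarrow> \<bar>\<phi> x\<bar> \<le> c"
  shows "set_integrable \<nu> {0..} \<phi>" and "\<bar>LINT x:{0..}|\<nu>. \<phi> x\<bar> \<le> c"
proof -
  interpret prob_space \<nu> by (rule prob_on_nonneg_facts[OF \<nu>])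
  have [measurable_cong]: "sets \<nu> = sets borel" by (rule prob_on_nonneg_facts[OF \<nu>])
  have c: "0 \<le> c" using bd[of 0] by linarith
  have m: "(\<lambda>x. indicator {0..} x *\<^sub>R \<phi> x) \<in> borel_measurable \<nu>"
    using borel_measurable_continuous_on_indicator[OF _ cont] by (simp cong: measurable_cong_sets)
  have b: "norm (indicator {0..} x *\<^sub>R \<phi> x) \<le> c" for x
    using bd c by (auto simp: indicator_def)
  show int: "set_integrable \<nu> {0..} \<phi>"
    unfolding set_integrable_def by (rule integrable_const_bound[OF _ m]) (use b in auto)
  have "\<bar>LINT x:{0..}|\<nu>. \<phi> x\<bar> \<le> expectation (\<lambda>x. \<bar>indicator {0..} x *\<^sub>R \<phi> x\<bar>)"
    unfolding set_lebesgue_integral_def by (rule integral_abs_bound)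
  also have "\<dots> \<le> expectation (\<lambda>_. c)"
    using int b by (intro integral_mono) (auto simp: set_integrable_def)
  finally show "\<bar>LINT x:{0..}|\<nu>. \<phi> x\<bar> \<le> c" by (simp add: prob_space)
qed

lemma set_integral_cong_nonneg:
  fixes f g :: "real \<Rightarrow> real"
  assumes "\<And>x. 0 \<le> x \<Longrightarrow> f x = g x"
  shows "(LINT x:{0..}|M. f x) = (LINT x:{0..}|M. g x)"
  unfolding set_lebesgue_integral_def
  by (rule Bochner_Integration.integral_cong) (auto simp: indicator_def assms)

lemma set_integral_one:
  assumes "prob_on_nonneg \<nu>"
  shows "(LINT x:{0..}|\<nu>. 1) = (1 :: real)"
proof -
  interpret real_distribution \<nu> using assms by (simp add: prob_on_nonneg_def)
  show ?thesis using assms by (simp add: prob_on_nonneg_def set_lebesgue_integral_def)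
qed

text \<open>1 - t / (x + t) = x / (x + t) is at least 1/2 for x > t, so twice its integral dominates
  the tail.\<close>

lemma tail_bound:
  assumes \<nu>: "prob_on_nonneg \<nu>" and t: "0 < t" and le: "1 - \<eta> \<le> t * (LINT x:{0..}|\<nu>. 1 / (x + t))"
  shows "measure \<nu> {t<..} \<le> 2 * \<eta>"
proof -
  interpret real_distribution \<nu> using \<nu> by (simp add: prob_on_nonneg_def)
  have int: "set_integrable \<nu> {0..} (\<lambda>x. 1 / (x + t))"
  proof (rule continuous_bounded_integral(1)[OF \<nu>])
    show "continuous_on {0..} (\<lambda>x. 1 / (x + t))" using t by (intro continuous_intros) auto
    show "\<bar>1 / (x + t)\<bar> \<le> 1 / t" if "0 \<le> x" for x
      using that t by (auto intro!: divide_left_mono)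
  qed
  have "measure \<nu> {t<..} = expectation (indicator {t<..})" by simp
  also have "\<dots> \<le> expectation (\<lambda>x. 2 * (1 - t * (indicator {0..} x *\<^sub>R (1 / (x + t)))))"
  proof (rule integral_mono)
    fix x :: real
    show "indicator {t<..} x \<le> 2 * (1 - t * (indicator {0..} x *\<^sub>R (1 / (x + t))))"
      using t by (auto simp: indicator_def field_simps)
  next
    show "integrable \<nu> (\<lambda>x. 2 * (1 - t * (indicator {0..} x *\<^sub>R (1 / (x + t)))))"
      using int unfolding set_integrable_def
      by (intro integrable_mult_right Bochner_Integration.integrable_diff integrable_const) auto
  qed (simp add: integrable_const_bound[of _ 1])
  also have "\<dots> = 2 * (1 - t * (LINT x:{0..}|\<nu>. 1 / (x + t)))"
  proof -
    have "expectation (\<lambda>x. 2 * (1 - t * g x)) = 2 * (1 - t * expectation g)" if "integrable \<nu> g" for g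
      using that prob_space by simp
    thus ?thesis using int unfolding set_lebesgue_integral_def set_integrable_def by blast
  qed
  also have "\<dots> \<le> 2 * \<eta>" using le by simp
  finally show ?thesis .
qed

lemma resolvent_quotient:
  fixes q s w :: real
  assumes "1 + s * w \<noteq> 0"
  shows "q - q / (1 + s * w) = s * (w * q) / (1 + s * w)"
  using assms by (simp add: field_simps)

text \<open>
  With \<open>u = 1 / (x + t0)\<close> one has \<open>1 / (x + t0 + s) = u / (1 + s u)\<close>; letting \<open>s\<close> tend to 0
  and dividing by \<open>s\<close> produces all powers of \<open>u\<close>, so Weierstrass' theorem applies on
  \<open>[0, 1 / t0]\<close>. Tightness then takes care of functions without a limit at infinity.
\<close>

theorem stieltjes_convergence:
  fixes P Q :: "nat \<Rightarrow> real measure" and f :: "real \<Rightarrow> real"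
  assumes P: "\<And>n. 1 \<le> n \<Longrightarrow> prob_on_nonneg (P n)" and Q: "\<And>n. 1 \<le> n \<Longrightarrow> prob_on_nonneg (Q n)"
    and t0: "0 < t0"
    and conv: "\<And>k::nat. (\<lambda>n. (LINT x:{0..}|P n. 1 / (x + (t0 + 1 / Suc k))) - (LINT x:{0..}|Q n. 1 / (x + (t0 + 1 / Suc k)))) \<longlonglongrightarrow> 0"
    and tight: "\<And>\<eta>. 0 < \<eta> \<Longrightarrow> \<exists>R\<ge>0. \<forall>n\<ge>1. measure (Q n) {R<..} \<le> \<eta>"
    and f: "continuous_on {0..} f" "bounded (f ` {0..})"
  shows "(\<lambda>n. (LINT x:{0..}|P n. f x) - (LINT x:{0..}|Q n. f x)) \<longlonglongrightarrow> 0"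
proof -
  define \<Delta> where "\<Delta> \<phi> n = (LINT x:{0..}|P n. \<phi> x) - (LINT x:{0..}|Q n. \<phi> x)" for \<phi> :: "real \<Rightarrow> real" and n
  define C where "C \<phi> \<longleftrightarrow> continuous_on {0..} \<phi> \<and> (\<exists>c. \<forall>x\<ge>0. \<bar>\<phi> x\<bar> \<le> c)" for \<phi> :: "real \<Rightarrow> real"
  \<comment> \<open>The test functions for which convergence holds. The plan is to show that
    \<open>V\<close> is a vector space closed under uniform limits and to enlarge it from the given
    functions.\<close>
  define V where "V \<phi> \<longleftrightarrow> C \<phi> \<and> \<Delta> \<phi> \<longlonglongrightarrow> 0" for \<phi>
  have V_cong: "V \<phi> = V \<zeta>" if eq: "\<And>x. 0 \<le> x \<Longrightarrow> \<phi> x = \<zeta> x" for \<phi> \<zeta>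
  proof -
    have "\<Delta> \<phi> = \<Delta> \<zeta>"
      unfolding \<Delta>_def by (intro ext arg_cong2[where f = "(-)"] set_integral_cong_nonneg eq)
    moreover have "continuous_on {0..} \<phi> = continuous_on {0..} \<zeta>"
      by (rule continuous_on_cong) (auto simp: eq)
    ultimately show ?thesis by (auto simp: V_def C_def eq)
  qed
  have C_int: "set_integrable (P n) {0..} \<phi>" "set_integrable (Q n) {0..} \<phi>" if "C \<phi>" "1 \<le> n" for \<phi> n
    using that continuous_bounded_integral(1)[OF P[OF that(2)]] continuous_bounded_integral(1)[OF Q[OF that(2)]]
    by (auto simp: C_def)
  have C_lin: "C (\<lambda>x. \<alpha> * \<phi> x + \<beta> * \<zeta> x)" if C: "C \<phi>" "C \<zeta>" for \<phi> \<zeta> \<alpha> \<beta>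
  proof -
    obtain c c' where c: "\<And>x. 0 \<le> x \<Longrightarrow> \<bar>\<phi> x\<bar> \<le> c" "\<And>x. 0 \<le> x \<Longrightarrow> \<bar>\<zeta> x\<bar> \<le> c'"
      using C unfolding C_def by auto
    have "\<bar>\<alpha> * \<phi> x + \<beta> * \<zeta> x\<bar> \<le> \<bar>\<alpha>\<bar> * c + \<bar>\<beta>\<bar> * c'" if "0 \<le> x" for x
    proof -
      have "\<bar>\<alpha> * \<phi> x + \<beta> * \<zeta> x\<bar> \<le> \<bar>\<alpha>\<bar> * \<bar>\<phi> x\<bar> + \<bar>\<beta>\<bar> * \<bar>\<zeta> x\<bar>"
        unfolding abs_mult[symmetric] by (rule abs_triangle_ineq)
      also have "\<dots> \<le> \<bar>\<alpha>\<bar> * c + \<bar>\<beta>\<bar> * c'"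
        using c that by (intro add_mono mult_left_mono) auto
      finally show ?thesis .
    qed
    moreover have "continuous_on {0..} (\<lambda>x. \<alpha> * \<phi> x + \<beta> * \<zeta> x)"
      using C unfolding C_def by (intro continuous_intros) auto
    ultimately show ?thesis unfolding C_def by blast
  qed
  have \<Delta>_lin: "\<Delta> (\<lambda>x. \<alpha> * \<phi> x + \<beta> * \<zeta> x) n = \<alpha> * \<Delta> \<phi> n + \<beta> * \<Delta> \<zeta> n" if "C \<phi>" "C \<zeta>" "1 \<le> n" for \<phi> \<zeta> \<alpha> \<beta> n
    unfolding \<Delta>_def using C_int[OF that(1,3)] C_int[OF that(2,3)]
    by (simp add: set_integral_add algebra_simps)
  have \<Delta>_le: "\<bar>\<Delta> \<phi> n\<bar> \<le> 2 * c" if "C \<phi>" "\<And>x. 0 \<le> x \<Longrightarrow> \<bar>\<phi> x\<bar> \<le> c" "1 \<le> n" for \<phi> c n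
    using continuous_bounded_integral(2)[OF P[OF that(3)] _ that(2)] continuous_bounded_integral(2)[OF Q[OF that(3)] _ that(2)] that(1)
    unfolding \<Delta>_def C_def by fastforce
  have V_lin: "V (\<lambda>x. \<alpha> * \<phi> x + \<beta> * \<zeta> x)" if "V \<phi>" "V \<zeta>" for \<phi> \<zeta> \<alpha> \<beta>
  proof -
    have "(\<lambda>n. \<alpha> * \<Delta> \<phi> n + \<beta> * \<Delta> \<zeta> n) \<longlonglongrightarrow> \<alpha> * 0 + \<beta> * 0"
      using that unfolding V_def by (intro tendsto_intros) auto
    moreover have "\<forall>\<^sub>F n in sequentially. \<alpha> * \<Delta> \<phi> n + \<beta> * \<Delta> \<zeta> n = \<Delta> (\<lambda>x. \<alpha> * \<phi> x + \<beta> * \<zeta> x) n"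
      using that by (intro eventually_mono[OF eventually_ge_at_top[of 1]]) (simp add: V_def \<Delta>_lin)
    ultimately have "\<Delta> (\<lambda>x. \<alpha> * \<phi> x + \<beta> * \<zeta> x) \<longlonglongrightarrow> \<alpha> * 0 + \<beta> * 0"
      by (rule Lim_transform_eventually)
    thus ?thesis using C_lin that by (simp add: V_def)
  qed
  \<comment> \<open>A uniform error \<eta> changes \<Delta> by at most 2 \<eta> for every n >= 1, as
    both measures have mass 1.\<close>
  have V_lim: "V \<phi>" if cont: "continuous_on {0..} \<phi>" and appr: "\<And>\<eta>. 0 < \<eta> \<Longrightarrow> \<exists>\<zeta>. V \<zeta> \<and> (\<forall>x\<ge>0. \<bar>\<phi> x - \<zeta> x\<bar> \<le> \<eta>)" for \<phi>
  proof -
    have C\<phi>: "C \<phi>"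
    proof -
      obtain \<zeta> where \<zeta>: "V \<zeta>" "\<And>x. 0 \<le> x \<Longrightarrow> \<bar>\<phi> x - \<zeta> x\<bar> \<le> 1" using appr[of 1] by auto
      then obtain c where c: "\<And>x. 0 \<le> x \<Longrightarrow> \<bar>\<zeta> x\<bar> \<le> c" unfolding V_def C_def by auto
      have "\<bar>\<phi> x\<bar> \<le> c + 1" if "0 \<le> x" for x using c[OF that] \<zeta>(2)[OF that] by linarith
      thus ?thesis using cont unfolding C_def by blast
    qed
    have "\<Delta> \<phi> \<longlonglongrightarrow> 0"
    proof (rule LIMSEQ_I)
      fix r :: real assume r: "0 < r"
      obtain \<zeta> where \<zeta>: "V \<zeta>" "\<And>x. 0 \<le> x \<Longrightarrow> \<bar>\<phi> x - \<zeta> x\<bar> \<le> r / 4" using appr[of "r / 4"] r by auto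
      hence C\<zeta>: "C \<zeta>" by (simp add: V_def)
      obtain n0 where n0: "\<And>n. n \<ge> n0 \<Longrightarrow> \<bar>\<Delta> \<zeta> n\<bar> < r / 2"
        using LIMSEQ_D[of "\<Delta> \<zeta>" 0 "r / 2"] \<zeta>(1) r by (auto simp: V_def)
      have "\<bar>\<Delta> \<phi> n\<bar> < r" if "n \<ge> max 1 n0" for n
      proof -
        have n: "1 \<le> n" "n0 \<le> n" using that by auto
        have "\<bar>\<Delta> (\<lambda>x. 1 * \<phi> x + (- 1) * \<zeta> x) n\<bar> \<le> 2 * (r / 4)"
          by (rule \<Delta>_le[OF C_lin[OF C\<phi> C\<zeta>] _ n(1)]) (use \<zeta>(2) in auto)
        hence "\<bar>\<Delta> \<phi> n - \<Delta> \<zeta> n\<bar> \<le> 2 * (r / 4)"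
          using \<Delta>_lin[OF C\<phi> C\<zeta> n(1), of 1 "-1"] by simp
        thus ?thesis using n0[OF n(2)] by linarith
      qed
      thus "\<exists>no. \<forall>n\<ge>no. norm (\<Delta> \<phi> n - 0) < r" unfolding diff_zero real_norm_def by blast
    qed
    thus ?thesis using C\<phi> by (simp add: V_def)
  qed
  have V_one: "V (\<lambda>_. 1)"
  proof -
    have "\<Delta> (\<lambda>_. 1) n = 0" if "1 \<le> n" for n
      using set_integral_one[OF P[OF that]] set_integral_one[OF Q[OF that]] by (simp add: \<Delta>_def)
    hence "\<Delta> (\<lambda>_. 1) \<longlonglongrightarrow> 0"
      by (intro tendsto_eventually eventually_mono[OF eventually_ge_at_top[of 1]]) auto
    thus ?thesis by (auto simp: V_def C_def)
  qed
  define a where "a = 1 / t0"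
  define u where "u x = 1 / (x + t0)" for x :: real
  have u: "0 < u x" "u x \<le> a" if "0 \<le> x" for x
    using that t0 by (auto simp: u_def a_def intro!: divide_left_mono)
  have u_cont: "continuous_on {0..} u"
    unfolding u_def using t0 by (intro continuous_intros) auto
  have V_h: "V (\<lambda>x. u x ^ Suc k / (1 + (1 / Suc j) * u x))" and V_u: "V (\<lambda>x. u x ^ Suc k)" for j k
  proof -
    have both: "(\<forall>j. V (\<lambda>x. u x ^ Suc k / (1 + (1 / Suc j) * u x))) \<and> V (\<lambda>x. u x ^ Suc k)"
    proof (induction k)
      \<comment> \<open>Needed in both cases of the induction: the damping 1 / (1 + s u), with s = 1
        / Suc j, tends to 1 uniformly as j grows, because u is bounded by \<open>a\<close>.\<close>
      have lim: "V (\<lambda>x. u x ^ Suc k)" if h: "\<And>j. V (\<lambda>x. u x ^ Suc k / (1 + (1 / Suc j) * u x))" for k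
      proof (rule V_lim)
        show "continuous_on {0..} (\<lambda>x. u x ^ Suc k)" by (intro continuous_intros u_cont)
        fix \<eta> :: real assume \<eta>: "0 < \<eta>"
        have a: "0 < a" using t0 by (simp add: a_def)
        obtain j :: nat where j: "a ^ (k + 2) / \<eta> < Suc j"
          using reals_Archimedean2[of "a ^ (k + 2) / \<eta>"] by (metis less_SucI of_nat_less_iff order_less_trans lessI)
        have "\<bar>u x ^ Suc k - u x ^ Suc k / (1 + (1 / Suc j) * u x)\<bar> \<le> \<eta>" if x: "0 \<le> x" for x
        proof -
          let ?s = "1 / real (Suc j)"
          have p: "1 \<le> 1 + ?s * u x" using u[OF x] by simp
          hence p0: "0 < 1 + ?s * u x" by linarith
          have "u x ^ Suc k - u x ^ Suc k / (1 + ?s * u x) = ?s * u x ^ (k + 2) / (1 + ?s * u x)"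
            using p by (subst resolvent_quotient) auto
          moreover have "0 \<le> ?s * u x ^ (k + 2) / (1 + ?s * u x)" using p u[OF x] by (intro divide_nonneg_nonneg mult_nonneg_nonneg) auto
          moreover have "?s * u x ^ (k + 2) / (1 + ?s * u x) \<le> ?s * u x ^ (k + 2) / 1"
            using u[OF x] by (intro divide_left_mono p mult_pos_pos p0) auto
          moreover have "?s * u x ^ (k + 2) \<le> ?s * a ^ (k + 2)"
            using u[OF x] by (intro mult_left_mono power_mono) auto
          moreover have "?s * a ^ (k + 2) \<le> \<eta>"
            using j \<eta> by (simp add: field_simps)
          ultimately show ?thesis by linarith
        qed
        thus "\<exists>\<zeta>. V \<zeta> \<and> (\<forall>x\<ge>0. \<bar>u x ^ Suc k - \<zeta> x\<bar> \<le> \<eta>)" using h by blast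
      qed
      {
        case 0
        have "V (\<lambda>x. u x ^ Suc 0 / (1 + (1 / Suc j) * u x))" for j
        proof -
          have e: "u x ^ Suc 0 / (1 + (1 / Suc j) * u x) = 1 / (x + (t0 + 1 / Suc j))" if "0 \<le> x" for x
          proof -
            have "x + t0 > 0" using that t0 by simp
            hence "(1 / (x + t0)) / (1 + (1 / Suc j) * (1 / (x + t0))) = 1 / ((x + t0) * (1 + (1 / Suc j) * (1 / (x + t0))))"
              by simp
            also have "(x + t0) * (1 + (1 / Suc j) * (1 / (x + t0))) = x + (t0 + 1 / Suc j)"
            proof -
              have "y * (1 + q * (1 / y)) = y + q" if "0 < y" for y q :: real
                using that by (simp add: distrib_left)
              from this[OF \<open>x + t0 > 0\<close>, of "1 / Suc j"] show ?thesis by (simp only: add.assoc)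
            qed
            finally show ?thesis by (simp add: u_def)
          qed
          have "\<Delta> (\<lambda>x. u x ^ Suc 0 / (1 + (1 / Suc j) * u x)) = (\<lambda>n. (LINT x:{0..}|P n. 1 / (x + (t0 + 1 / Suc j))) - (LINT x:{0..}|Q n. 1 / (x + (t0 + 1 / Suc j))))"
            unfolding \<Delta>_def by (intro ext arg_cong2[where f = "(-)"] set_integral_cong_nonneg e)
          moreover have "C (\<lambda>x. u x ^ Suc 0 / (1 + (1 / Suc j) * u x))"
            unfolding C_def
          proof (intro conjI exI[of _ a] allI impI)
            have "1 + (1 / Suc j) * u x \<noteq> 0" if "x \<ge> 0" for x
            proof -
              have "0 \<le> (1 / Suc j) * u x" using u[OF that] by simp
              thus ?thesis by linarith
            qed
            thus "continuous_on {0..} (\<lambda>x. u x ^ Suc 0 / (1 + (1 / Suc j) * u x))"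
              by (intro continuous_intros u_cont) auto
            fix x :: real assume x: "0 \<le> x"
            have p: "1 \<le> 1 + (1 / Suc j) * u x" using u[OF x] by simp
            hence p0: "0 < 1 + (1 / Suc j) * u x" by linarith
            have "\<bar>u x ^ Suc 0 / (1 + (1 / Suc j) * u x)\<bar> = u x / (1 + (1 / Suc j) * u x)"
              using p u[OF x] by simp
            also have "\<dots> \<le> u x / 1"
              using u[OF x] by (intro divide_left_mono p mult_pos_pos p0) auto
            also have "\<dots> \<le> a" using u[OF x] by simp
            finally show "\<bar>u x ^ Suc 0 / (1 + (1 / Suc j) * u x)\<bar> \<le> a" .
          qed
          ultimately show ?thesis using conv[of j] by (simp add: V_def)
        qed
        with lim[of 0] show ?case by blast
      next
        case (Suc k)
        have "V (\<lambda>x. u x ^ Suc (Suc k) / (1 + (1 / Suc j) * u x))" for j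
        proof -
          \<comment> \<open>With s = 1 / Suc j and q a power of u, (q - q / (1 + s u)) / s = u q /
            (1 + s u): the exponent rises by one and the damping is kept.\<close>
          have "V (\<lambda>x. real (Suc j) * u x ^ Suc k + (- real (Suc j)) * (u x ^ Suc k / (1 + (1 / Suc j) * u x)))"
            using Suc by (intro V_lin) auto
          moreover have "real (Suc j) * u x ^ Suc k + (- real (Suc j)) * (u x ^ Suc k / (1 + (1 / Suc j) * u x)) = u x ^ Suc (Suc k) / (1 + (1 / Suc j) * u x)"
            if "0 \<le> x" for x
          proof -
            define q where "q = u x ^ Suc k"
            define J where "J = real (Suc j)"
            have J: "0 < J" by (simp add: J_def)
            have "0 < 1 + (1 / J) * u x" using u[OF that] J by (intro add_pos_nonneg) auto
            hence "q - q / (1 + (1 / J) * u x) = (1 / J) * (u x * q) / (1 + (1 / J) * u x)"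
              by (intro resolvent_quotient) simp
            hence "J * (q - q / (1 + (1 / J) * u x)) = u x * q / (1 + (1 / J) * u x)"
              using J by simp
            thus ?thesis unfolding power_Suc[of "u x" "Suc k"] q_def[symmetric] J_def[symmetric]
              by (simp only: right_diff_distrib mult_minus_left add_uminus_conv_diff)
          qed
          hence "V (\<lambda>x. real (Suc j) * u x ^ Suc k + (- real (Suc j)) * (u x ^ Suc k / (1 + (1 / Suc j) * u x))) = V (\<lambda>x. u x ^ Suc (Suc k) / (1 + (1 / Suc j) * u x))"
            by (rule V_cong)
          ultimately show ?thesis by simp
        qed
        with lim[of "Suc k"] show ?case by blast
      }
    qed
    show "V (\<lambda>x. u x ^ Suc k / (1 + (1 / Suc j) * u x))" "V (\<lambda>x. u x ^ Suc k)" using both by blast+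
  qed
  have V_pow: "V (\<lambda>x. u x ^ k)" for k
    using V_one V_u[of "k - 1"] by (cases k) auto
  have V_poly: "V (\<lambda>x. \<Sum>i\<le>m. \<alpha> i * u x ^ i)" for \<alpha> :: "nat \<Rightarrow> real" and m
  proof (induction m)
    case 0
    show ?case using V_lin[OF V_one V_one, of "\<alpha> 0" 0] by simp
  next
    case (Suc m)
    show ?case using V_lin[OF Suc V_pow[of "Suc m"], of 1 "\<alpha> (Suc m)"] by simp
  qed
  have V_cont: "V (\<lambda>x. g (u x))" if g: "continuous_on {0..a} g" for g
  proof (rule V_lim)
    have "u ` {0..} \<subseteq> {0..a}" using u by (auto simp: less_imp_le)
    thus "continuous_on {0..} (\<lambda>x. g (u x))"
      by (rule continuous_on_compose2[OF g u_cont])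
    fix \<eta> :: real assume "0 < \<eta>"
    then obtain p where p: "real_polynomial_function p" "\<And>v. v \<in> {0..a} \<Longrightarrow> \<bar>g v - p v\<bar> < \<eta>"
      using Stone_Weierstrass_real_polynomial_function[OF compact_Icc g] by blast
    obtain \<alpha> m where "p = (\<lambda>v. \<Sum>i\<le>m. \<alpha> i * v ^ i)"
      using p(1) by (auto simp: real_polynomial_function_iff_sum)
    hence "V (\<lambda>x. p (u x))" using V_poly[of \<alpha> m] by simp
    moreover have "\<bar>g (u x) - p (u x)\<bar> \<le> \<eta>" if "0 \<le> x" for x
      using p(2)[of "u x"] u[OF that] by auto
    ultimately show "\<exists>\<zeta>. V \<zeta> \<and> (\<forall>x\<ge>0. \<bar>g (u x) - \<zeta> x\<bar> \<le> \<eta>)" by blast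
  qed
  have V_compact: "V \<phi>" if \<phi>: "continuous_on {0..} \<phi>" "\<And>x. R + 1 \<le> x \<Longrightarrow> \<phi> x = 0" and R: "0 \<le> R" for \<phi> R
  proof -
    define v0 where "v0 = 1 / (R + 1 + t0)"
    \<comment> \<open>\<phi> in the variable v = u x. Clamping v at v0, which corresponds to x = R +
      1, avoids the division by 0 at v = 0 and is harmless because \<phi> vanishes from R + 1
      on.\<close>
    define g where "g v = \<phi> (1 / max v v0 - t0)" for v
    have v0: "0 < v0" "v0 \<le> a" using R t0 by (auto simp: v0_def a_def intro!: divide_left_mono)
    have "continuous_on {0..a} g"
      unfolding g_def
    proof (rule continuous_on_compose2[OF \<phi>(1)])
      show "continuous_on {0..a} (\<lambda>v. 1 / max v v0 - t0)"
        using v0 by (intro continuous_intros) auto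
      show "(\<lambda>v. 1 / max v v0 - t0) ` {0..a} \<subseteq> {0..}"
      proof (rule image_subsetI)
        fix v assume v: "v \<in> {0..a}"
        have "1 / a \<le> 1 / max v v0" using v v0 by (intro divide_left_mono) auto
        thus "1 / max v v0 - t0 \<in> {0..}" by (simp add: a_def)
      qed
    qed
    from V_cont[OF this] have "V (\<lambda>x. g (u x))" .
    moreover have "g (u x) = \<phi> x" if x: "0 \<le> x" for x
    proof (cases "x \<le> R + 1")
      case True
      hence "v0 \<le> u x" using x t0 by (auto simp: v0_def u_def intro!: divide_left_mono)
      hence "max (u x) v0 = u x" by simp
      thus ?thesis by (simp add: g_def u_def)
    next
      case False
      hence "u x \<le> v0" using x t0 R by (auto simp: v0_def u_def intro!: divide_left_mono)
      hence "max (u x) v0 = v0" by simp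
      thus ?thesis using \<phi>(2)[of "R + 1"] \<phi>(2)[of x] False by (simp add: g_def v0_def)
    qed
    hence "V (\<lambda>x. g (u x)) = V \<phi>"
      by (rule V_cong)
    ultimately show ?thesis by simp
  qed
  obtain F where F: "\<And>x. 0 \<le> x \<Longrightarrow> \<bar>f x\<bar> \<le> F" "0 < F"
    using f(2) unfolding bounded_pos by auto
  have Cf: "C f" using f(1) F unfolding C_def by auto
  have "\<Delta> f \<longlonglongrightarrow> 0"
  proof (rule LIMSEQ_I)
    fix r :: real assume r: "0 < r"
    \<comment> \<open>The error splits into four quarters of r: one for the truncated function, and
      for the remainder F \<eta> from each measure plus the discrepancy between their tails.\<close>
    define \<eta> where "\<eta> = r / (4 * F)"
    have \<eta>: "0 < \<eta>" using r F by (simp add: \<eta>_def)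
    obtain R where R: "0 \<le> R" "\<And>n. 1 \<le> n \<Longrightarrow> measure (Q n) {R<..} \<le> \<eta>" using tight[OF \<eta>] by auto
    define \<zeta> where "\<zeta> x = max 0 (min 1 (R + 1 - x))" for x :: real
    have \<zeta>: "0 \<le> \<zeta> x" "\<zeta> x \<le> 1" "R + 1 \<le> x \<Longrightarrow> \<zeta> x = 0" "x \<le> R \<Longrightarrow> \<zeta> x = 1" for x
      by (auto simp: \<zeta>_def)
    have \<zeta>_cont: "continuous_on {0..} \<zeta>" unfolding \<zeta>_def by (intro continuous_intros)
    have V\<zeta>: "V \<zeta>" by (rule V_compact[OF \<zeta>_cont \<zeta>(3) R(1)])
    have Vf\<zeta>: "V (\<lambda>x. f x * \<zeta> x)"
      by (rule V_compact[OF _ _ R(1)]) (auto intro!: continuous_intros f \<zeta>_cont simp: \<zeta>(3))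
    \<comment> \<open>Tightness is assumed for \<open>Q\<close> only. Convergence on 1 - \<zeta>,
      which has no compact support but differs from \<zeta> by a constant and a sign, carries it
      over to \<open>P\<close>.\<close>
    have V1: "V (\<lambda>x. 1 - \<zeta> x)" using V_lin[OF V_one V\<zeta>, of 1 "-1"] by simp
    hence C1: "C (\<lambda>x. 1 - \<zeta> x)" by (simp add: V_def)
    obtain n1 where n1: "\<And>n. n \<ge> n1 \<Longrightarrow> \<bar>\<Delta> (\<lambda>x. f x * \<zeta> x) n\<bar> < r / 4"
      using LIMSEQ_D[of "\<Delta> (\<lambda>x. f x * \<zeta> x)" 0 "r / 4"] Vf\<zeta> r by (auto simp: V_def)
    obtain n2 where n2: "\<And>n. n \<ge> n2 \<Longrightarrow> \<bar>\<Delta> (\<lambda>x. 1 - \<zeta> x) n\<bar> < r / (4 * F)"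
      using LIMSEQ_D[of "\<Delta> (\<lambda>x. 1 - \<zeta> x)" 0 "r / (4 * F)"] V1 r F by (auto simp: V_def)
    have Cf\<zeta>: "C (\<lambda>x. f x * \<zeta> x)" using Vf\<zeta> by (simp add: V_def)
    define \<rho> where "\<rho> x = f x - f x * \<zeta> x" for x
    have C\<rho>: "C \<rho>" using C_lin[OF Cf Cf\<zeta>, of 1 "-1"] by (simp add: \<rho>_def[abs_def])
    have \<rho>_le: "\<bar>LINT x:{0..}|\<nu>. \<rho> x\<bar> \<le> F * (LINT x:{0..}|\<nu>. 1 - \<zeta> x)"
      if i: "set_integrable \<nu> {0..} \<rho>" "set_integrable \<nu> {0..} (\<lambda>x. 1 - \<zeta> x)" for \<nu>
    proof -
      have "\<bar>LINT x:{0..}|\<nu>. \<rho> x\<bar> \<le> (LINT x|\<nu>. \<bar>indicator {0..} x *\<^sub>R \<rho> x\<bar>)"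
        unfolding set_lebesgue_integral_def by (rule integral_abs_bound)
      also have "\<dots> \<le> (LINT x|\<nu>. F * (indicator {0..} x *\<^sub>R (1 - \<zeta> x)))"
      proof (rule integral_mono)
        fix x :: real
        have "\<bar>f x * (1 - \<zeta> x)\<bar> \<le> F * (1 - \<zeta> x)" if "0 \<le> x"
          using F(1)[OF that] \<zeta>[of x] by (simp add: abs_mult mult_right_mono)
        thus "\<bar>indicator {0..} x *\<^sub>R \<rho> x\<bar> \<le> F * (indicator {0..} x *\<^sub>R (1 - \<zeta> x))"
          by (auto simp: indicator_def \<rho>_def right_diff_distrib)
      qed (use i in \<open>auto simp: set_integrable_def\<close>)
      finally show ?thesis by (simp add: set_lebesgue_integral_def)
    qed
    have "\<bar>\<Delta> f n\<bar> < r" if "n \<ge> max 1 (max n1 n2)" for n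
    proof -
      have n: "1 \<le> n" "n1 \<le> n" "n2 \<le> n" using that by auto
      interpret Qn: real_distribution "Q n" using Q[OF n(1)] by (simp add: prob_on_nonneg_def)
      have split: "\<Delta> f n = \<Delta> (\<lambda>x. f x * \<zeta> x) n + \<Delta> \<rho> n"
        using \<Delta>_lin[OF Cf\<zeta> C\<rho> n(1), of 1 1] by (simp add: \<rho>_def)
      have "(LINT x:{0..}|Q n. 1 - \<zeta> x) \<le> Qn.expectation (indicator {R<..})"
        unfolding set_lebesgue_integral_def
      proof (rule integral_mono)
        fix x :: real
        show "indicator {0..} x *\<^sub>R (1 - \<zeta> x) \<le> indicator {R<..} x"
          using \<zeta>[of x] by (cases "x \<le> R") (auto simp: indicator_def)
      next
        show "integrable (Q n) (indicat_real {R<..})" by (simp add: Qn.integrable_const_bound[of _ 1])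
      qed (use C_int(2)[OF C1 n(1)] in \<open>auto simp: set_integrable_def\<close>)
      also have "\<dots> \<le> \<eta>" using R(2)[OF n(1)] by simp
      finally have q: "(LINT x:{0..}|Q n. 1 - \<zeta> x) \<le> \<eta>" .
      have p: "(LINT x:{0..}|P n. 1 - \<zeta> x) < \<eta> + r / (4 * F)"
        using n2[OF n(3)] q unfolding \<Delta>_def by linarith
      have "\<bar>\<Delta> \<rho> n\<bar> \<le> F * (LINT x:{0..}|P n. 1 - \<zeta> x) + F * (LINT x:{0..}|Q n. 1 - \<zeta> x)"
        using \<rho>_le[OF C_int(1)[OF C\<rho> n(1)] C_int(1)[OF C1 n(1)]] \<rho>_le[OF C_int(2)[OF C\<rho> n(1)] C_int(2)[OF C1 n(1)]]
        unfolding \<Delta>_def by linarith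
      also have "\<dots> \<le> F * (\<eta> + r / (4 * F)) + F * \<eta>"
        using p q F(2) by (intro add_mono mult_left_mono) auto
      also have "\<dots> = 3 * r / 4" using F(2) by (simp add: \<eta>_def field_simps)
      finally show ?thesis using n1[OF n(2)] unfolding split by linarith
    qed
    thus "\<exists>no. \<forall>n\<ge>no. norm (\<Delta> f n - 0) < r" unfolding diff_zero real_norm_def by blast
  qed
  thus ?thesis unfolding \<Delta>_def .
qed

section \<open>The random model\<close>

text \<open>The sum of the series has finite expectation, so it is finite almost surely and its
  terms tend to 0.\<close>

lemma AE_tendsto_zero_summable:
  fixes Z :: "nat \<Rightarrow> 'a \<Rightarrow> real"
  assumes int: "\<And>n. integrable M (Z n)" and nn: "\<And>n x. 0 \<le> Z n x" and sm: "summable (\<lambda>n. LINT x|M. Z n x)"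
  shows "AE x in M. (\<lambda>n. Z n x) \<longlonglongrightarrow> 0"
proof -
  have [measurable]: "Z n \<in> borel_measurable M" for n using int by auto
  have "(\<integral>\<^sup>+ x. (\<Sum>n. ennreal (Z n x)) \<partial>M) = (\<Sum>n. \<integral>\<^sup>+ x. ennreal (Z n x) \<partial>M)"
    by (rule nn_integral_suminf) measurable
  also have "\<dots> = (\<Sum>n. ennreal (LINT x|M. Z n x))"
    by (simp add: nn_integral_eq_integral[OF int] nn)
  also have "\<dots> = ennreal (\<Sum>n. LINT x|M. Z n x)"
    by (rule suminf_ennreal2) (auto intro!: integral_nonneg_AE simp: nn sm)
  finally have "(\<integral>\<^sup>+ x. (\<Sum>n. ennreal (Z n x)) \<partial>M) \<noteq> \<infinity>" by simp
  hence "AE x in M. (\<Sum>n. ennreal (Z n x)) \<noteq> \<infinity>"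
    by (intro nn_integral_PInf_AE) measurable
  thus ?thesis
  proof eventually_elim
    case (elim x)
    hence "summable (\<lambda>n. Z n x)" by (intro summable_suminf_not_top) (auto simp: nn)
    thus ?case by (rule summable_LIMSEQ_zero)
  qed
qed

lemma inv_fun_cong:
  assumes "\<And>i j. i < K \<Longrightarrow> j < K \<Longrightarrow> L i j = L' i j"
  shows "inv_fun K L = inv_fun K L'"
proof -
  have "Matrix.mat K K (\<lambda>(i, j). L i j) = Matrix.mat K K (\<lambda>(i, j). L' i j)"
    by (rule eq_matI) (auto simp: assms)
  thus ?thesis by (intro ext) (simp add: inv_fun_def)
qed

text \<open>Positions in the upper right block of the linearised matrix; position (p, q) carries the
  entry in row p and column q - N.\<close>

definition edges :: "nat \<Rightarrow> nat \<Rightarrow> (nat \<times> nat) set" where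
  "edges N n = {(p, q). p < N \<and> N \<le> q \<and> q < N + n}"

text \<open>Transfers the results of \<open>skew_ensemble\<close> from a product law to the given
  probability space: independence identifies the joint law of the scaled entries with the product
  measure, and \<open>G\<close> depends on the sample point only through these entries. One
  \<gamma>, the diagonal of the deterministic inverse, serves all weights \<open>D\<close>.\<close>

theorem trace_estimates:
  fixes M :: "'a measure" and X :: "nat \<Rightarrow> nat \<Rightarrow> 'a \<Rightarrow> real"
  assumes "prob_space M" and Nn: "1 \<le> N" "1 \<le> n"
    and A: "A \<in> carrier_mat N n" and sys: "solves_system N n \<sigma> A \<psi> \<psi>'"
    and indep: "prob_space.indep_vars M (\<lambda>_. borel) (\<lambda>e. X (fst e) (snd e - N)) (edges N n)"
    and mean: "\<And>i j. i < N \<Longrightarrow> j < n \<Longrightarrow> (LINT \<omega>|M. X i j \<omega>) = 0"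
    and var: "\<And>i j. i < N \<Longrightarrow> j < n \<Longrightarrow> (LINT \<omega>|M. (X i j \<omega>)\<^sup>2) = 1"
    and int4: "\<And>i j. i < N \<Longrightarrow> j < n \<Longrightarrow> integrable M (\<lambda>\<omega>. (X i j \<omega>) ^ 4)"
    and mom4: "\<And>i j. i < N \<Longrightarrow> j < n \<Longrightarrow> (LINT \<omega>|M. (X i j \<omega>) ^ 4) \<le> \<kappa> - 1"
    and \<sigma>: "\<And>i j. i < N \<Longrightarrow> j < n \<Longrightarrow> \<bar>\<sigma> i j\<bar> \<le> \<sigma>m" and \<sigma>m: "0 < \<sigma>m"
    and b: "real (N + n) / real n * \<sigma>m\<^sup>2 \<le> b" and s: "0 < s" and bs: "2 * b \<le> s\<^sup>2"
  defines "h \<equiv> \<sigma>m / sqrt (real n)"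
    and "G \<equiv> \<lambda>\<omega>. inv_fun (N + n) (diag_plus (\<lambda>_. s) (skew_block N (sigma_mat N n \<sigma> A (\<lambda>i j. X i j \<omega>))))"
    and "V \<equiv> 8 * b / s ^ 4 + (256 + 32 * \<kappa>) * b\<^sup>2 / s ^ 6"
  obtains \<gamma> :: "nat \<Rightarrow> real" where
    "mtrace (T_mat N n A \<psi> \<psi>' (complex_of_real (- (s\<^sup>2)))) = complex_of_real ((\<Sum>k<N. \<gamma> k) / s)"
    "mtrace (T'_mat N n A \<psi> \<psi>' (complex_of_real (- (s\<^sup>2)))) = complex_of_real ((\<Sum>k<n. \<gamma> (N + k)) / s)"
    "\<And>D. \<forall>k. \<bar>D k\<bar> \<le> 1 \<Longrightarrow> integrable M (\<lambda>\<omega>. \<Sum>k<N + n. D k * G \<omega> k k)"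
    "\<And>D. \<forall>k. \<bar>D k\<bar> \<le> 1 \<Longrightarrow>
       integrable M (\<lambda>\<omega>. ((\<Sum>k<N + n. D k * G \<omega> k k) - (LINT \<omega>|M. (\<Sum>k<N + n. D k * G \<omega> k k)))\<^sup>2)"
    "\<And>D. \<forall>k. \<bar>D k\<bar> \<le> 1 \<Longrightarrow>
       (LINT \<omega>|M. ((\<Sum>k<N + n. D k * G \<omega> k k) - (LINT \<omega>|M. (\<Sum>k<N + n. D k * G \<omega> k k)))\<^sup>2) \<le> V"
    "\<And>D. \<forall>k. \<bar>D k\<bar> \<le> 1 \<Longrightarrow>
       \<bar>(LINT \<omega>|M. (\<Sum>k<N + n. D k * G \<omega> k k)) - (\<Sum>k<N + n. D k * \<gamma> k)\<bar>
         \<le> 2 * (b\<^sup>2 * (8 * \<kappa> + 16) / (s ^ 4 * h) + b * (V + 1) / (2 * s\<^sup>2) + b / s ^ 3)"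
proof -
  interpret M: prob_space M by fact
  define E where "E = edges N n"
  define Y where "Y e \<omega> = \<sigma> (fst e) (snd e - N) / sqrt (real n) * X (fst e) (snd e - N) \<omega>" for e \<omega>
  \<comment> \<open>The point mass off the edges makes \<mu> a family of probability measures over
    all index pairs, as the locale demands.\<close>
  define \<mu> where "\<mu> e = (if e \<in> E then distr M borel (Y e) else return borel 0)" for e
  have X_meas: "X (fst e) (snd e - N) \<in> borel_measurable M" if "e \<in> E" for e
    using indep that unfolding M.indep_vars_def E_def by auto
  have Y_meas: "Y e \<in> borel_measurable M" if "e \<in> E" for e
    unfolding Y_def using X_meas[OF that] by measurable
  have "(0, N) \<in> E" using Nn by (simp add: E_def edges_def)
  hence E_ne: "E \<noteq> {}" by blast
  have E_ij: "fst e < N" "snd e - N < n" if "e \<in> E" for e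
    using that by (auto simp: E_def edges_def)
  have h_pos: "0 < h" using \<sigma>m Nn by (simp add: h_def)
  have h2: "h\<^sup>2 = \<sigma>m\<^sup>2 / real n" using Nn by (simp add: h_def power_divide)
  have cof: "\<bar>\<sigma> (fst e) (snd e - N) / sqrt (real n)\<bar> \<le> h" if "e \<in> E" for e
    using \<sigma>[OF E_ij[OF that]] Nn by (simp add: h_def divide_right_mono)
  have cofk: "\<bar>\<sigma> (fst e) (snd e - N) / sqrt (real n)\<bar> ^ k \<le> h ^ k" if "e \<in> E" for e k
    by (rule power_mono[OF cof[OF that]]) simp
  have mu_int: "integral\<^sup>L (\<mu> e) g = (LINT \<omega>|M. g (Y e \<omega>))" if "e \<in> E" "g \<in> borel_measurable borel" for e and g :: "real \<Rightarrow> real"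
    using that Y_meas[OF that(1)] by (simp add: \<mu>_def integral_distr)
  have X_int: "integrable M (\<lambda>\<omega>. \<bar>X i j \<omega>\<bar> ^ 3)" "(LINT \<omega>|M. \<bar>X i j \<omega>\<bar> ^ 3) \<le> \<kappa>" if "i < N" "j < n" for i j
  proof -
    have "X i j \<in> borel_measurable M" using X_meas[of "(i, N + j)"] that by (simp add: E_def edges_def)
    hence [measurable]: "X i j \<in> borel_measurable M" .
    have le: "\<bar>x\<bar> ^ 3 \<le> 1 + x ^ 4" for x :: real
    proof (cases "\<bar>x\<bar> \<le> 1")
      case True
      hence "\<bar>x\<bar> ^ 3 \<le> 1" by (intro power_le_one) auto
      moreover have "0 \<le> x ^ 4" by simp
      ultimately show ?thesis by linarith
    next
      case False
      hence "\<bar>x\<bar> ^ 3 \<le> \<bar>x\<bar> ^ 4" by (intro power_increasing) auto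
      thus ?thesis by simp
    qed
    show int3: "integrable M (\<lambda>\<omega>. \<bar>X i j \<omega>\<bar> ^ 3)"
    proof (rule Bochner_Integration.integrable_bound)
      show "integrable M (\<lambda>\<omega>. 1 + X i j \<omega> ^ 4)" using int4[OF that] by simp
      show "AE \<omega> in M. norm (\<bar>X i j \<omega>\<bar> ^ 3) \<le> norm (1 + X i j \<omega> ^ 4)"
        using le by (intro AE_I2) (simp add: power_abs[symmetric])
    qed measurable
    have "(LINT \<omega>|M. \<bar>X i j \<omega>\<bar> ^ 3) \<le> (LINT \<omega>|M. 1 + X i j \<omega> ^ 4)"
      by (rule integral_mono[OF int3]) (use int4[OF that] le in auto)
    also have "\<dots> = 1 + (LINT \<omega>|M. X i j \<omega> ^ 4)" using int4[OF that] by (simp add: M.prob_space)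
    finally show "(LINT \<omega>|M. \<bar>X i j \<omega>\<bar> ^ 3) \<le> \<kappa>" using mom4[OF that] by linarith
  qed
  have \<kappa>: "1 \<le> \<kappa>"
  proof -
    have "0 \<le> (LINT \<omega>|M. (X 0 0 \<omega>) ^ 4)" by (intro integral_nonneg_AE) simp
    also have "\<dots> \<le> \<kappa> - 1" by (rule mom4) (use Nn in auto)
    finally show ?thesis by simp
  qed
  have second_eq: "(\<integral>x. x\<^sup>2 \<partial>\<mu> e) = (\<sigma> (fst e) (snd e - N))\<^sup>2 / real n" if "e \<in> E" for e
    using mu_int[OF that, of "\<lambda>x. x\<^sup>2"] var[OF E_ij[OF that]] by (simp add: Y_def power_mult_distrib power_divide)
  interpret skew_ensemble "N + n" s "skew_block N A" E \<mu> h \<kappa> b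
  proof (rule skew_ensemble.intro)
    show "0 < s" by fact
    show "\<And>i j. skew_block N A i j = - skew_block N A j i" by (rule skew_block_skew)
    show "\<And>p q. (p, q) \<in> E \<Longrightarrow> p < q \<and> q < N + n" by (auto simp: E_def edges_def)
    show "\<And>e. prob_space (\<mu> e)" using Y_meas by (auto simp: \<mu>_def intro!: M.prob_space_distr prob_space_return)
    show "\<And>e. sets (\<mu> e) = sets borel" by (simp add: \<mu>_def)
    show "0 < h" "0 \<le> \<kappa>" using h_pos \<kappa> by auto
    show "real (N + n) * h\<^sup>2 \<le> b" using b by (simp add: h2)
    fix e assume e: "e \<in> E"
    show "(\<integral>x. x \<partial>\<mu> e) = 0"
      using mu_int[OF e, of "\<lambda>x. x"] mean[OF E_ij[OF e]] by (simp add: Y_def)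
    show "(\<integral>x. x\<^sup>2 \<partial>\<mu> e) \<le> h\<^sup>2"
      unfolding second_eq[OF e] using cofk[OF e, of 2] by (simp add: power_divide)
    show "(\<integral>x. \<bar>x\<bar> ^ 3 \<partial>\<mu> e) \<le> \<kappa> * h ^ 3"
    proof -
      have "(\<integral>x. \<bar>x\<bar> ^ 3 \<partial>\<mu> e) = \<bar>\<sigma> (fst e) (snd e - N) / sqrt (real n)\<bar> ^ 3 * (LINT \<omega>|M. \<bar>X (fst e) (snd e - N) \<omega>\<bar> ^ 3)"
        using mu_int[OF e, of "\<lambda>x. \<bar>x\<bar> ^ 3"] by (simp only: Y_def abs_mult power_mult_distrib integral_mult_right_zero) simp
      also have "\<dots> \<le> h ^ 3 * \<kappa>"
        using cofk[OF e] X_int(2)[OF E_ij[OF e]] h_pos by (intro mult_mono) (auto intro!: integral_nonneg_AE)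
      finally show ?thesis by (simp add: mult.commute)
    qed
    show "(\<integral>x. x ^ 4 \<partial>\<mu> e) \<le> \<kappa> * h ^ 4"
    proof -
      have "(\<integral>x. x ^ 4 \<partial>\<mu> e) = (\<sigma> (fst e) (snd e - N) / sqrt (real n)) ^ 4 * (LINT \<omega>|M. X (fst e) (snd e - N) \<omega> ^ 4)"
        using mu_int[OF e, of "\<lambda>x. x ^ 4"] by (simp only: Y_def power_mult_distrib integral_mult_right_zero) simp
      also have "\<dots> \<le> h ^ 4 * \<kappa>"
      proof (rule mult_mono)
        show "(\<sigma> (fst e) (snd e - N) / sqrt (real n)) ^ 4 \<le> h ^ 4"
          using cofk[OF e, of 4] abs_ge_self[of "(\<sigma> (fst e) (snd e - N) / sqrt (real n)) ^ 4"]
          unfolding power_abs by linarith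
        show "(LINT \<omega>|M. X (fst e) (snd e - N) \<omega> ^ 4) \<le> \<kappa>" using mom4[OF E_ij[OF e]] by simp
      qed (auto intro!: integral_nonneg_AE simp: h_pos less_imp_le)
      finally show ?thesis by (simp add: mult.commute)
    qed
    show "integrable (\<mu> e) (\<lambda>x. x ^ 4)"
    proof -
      have "integrable M (\<lambda>\<omega>. Y e \<omega> ^ 4)"
        unfolding Y_def power_mult_distrib by (intro integrable_mult_right int4[OF E_ij[OF e]])
      thus ?thesis using e Y_meas[OF e] by (simp add: \<mu>_def integrable_distr_eq)
    qed
  qed
  define yy where "yy \<omega> = (\<lambda>e\<in>E. Y e \<omega>)" for \<omega>
  have indepY: "M.indep_vars (\<lambda>_. borel) Y E"
    unfolding Y_def[abs_def]
    by (rule M.indep_vars_compose2[OF indep[folded E_def], of "\<lambda>e x. \<sigma> (fst e) (snd e - N) / sqrt (real n) * x"]) simp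
  have yy_meas: "yy \<in> measurable M (PiM E (\<lambda>_. borel))"
    unfolding yy_def[abs_def] using Y_meas by (intro measurable_restrict) auto
  have P_distr: "\<P> = distr M (PiM E (\<lambda>_. borel)) yy"
  proof -
    have "distr M (PiM E (\<lambda>_. borel)) yy = PiM E (\<lambda>e. distr M borel (Y e))"
      using M.indep_vars_iff_distr_eq_PiM'[where M' = "\<lambda>_. borel" and X = Y, OF E_ne] Y_meas indepY by (simp add: yy_def[abs_def])
    also have "\<dots> = \<P>" unfolding \<P>_def by (rule PiM_cong) (auto simp: \<mu>_def)
    finally show ?thesis ..
  qed
  have Geq: "G \<omega> = skew_ensemble.G (N + n) s (skew_block N A) E (yy \<omega>)" for \<omega>
  proof -
    have "skew_block N (sigma_mat N n \<sigma> A (\<lambda>i j. X i j \<omega>)) i j = S (yy \<omega>) i j" if "i < N + n" "j < N + n" for i j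
      unfolding S_def using that A by (auto simp: skew_block_def sigma_mat_def yy_def E_def edges_def Y_def)
    thus ?thesis unfolding assms(17) skew_ensemble.G_def[OF skew_ensemble_axioms]
      by (intro inv_fun_cong) (simp add: diag_plus_def)
  qed
  have fsum: "(\<Sum>k<N + n. D k * G \<omega> k k) = diag_stat D (yy \<omega>)" for D \<omega>
    by (simp add: diag_stat_def Geq)
  have meas_eq: "borel_measurable \<P> = borel_measurable (PiM E (\<lambda>_. borel))"
    unfolding P_distr by simp
  have tr_int: "integrable M (\<lambda>\<omega>. g (yy \<omega>))" if "integrable \<P> g" for g :: "_ \<Rightarrow> real"
    using that yy_meas unfolding P_distr by (rule integrable_distr[rotated])
  have tr_eq: "(LINT \<omega>|M. g (yy \<omega>)) = P.expectation g" if "g \<in> borel_measurable \<P>" for g :: "_ \<Rightarrow> real"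
    using that unfolding meas_eq by (subst P_distr, subst integral_distr[OF yy_meas]) auto
  obtain d where d: "\<And>k. k < N + n \<Longrightarrow> s \<le> d k"
    "\<And>k. k < N + n \<Longrightarrow> d k = s + (\<Sum>l<N + n. variance_profile N n \<sigma> k l * inv_fun (N + n) (diag_plus d (skew_block N A)) l l)"
    "mtrace (T_mat N n A \<psi> \<psi>' (complex_of_real (- (s\<^sup>2)))) = complex_of_real ((\<Sum>k<N. inv_fun (N + n) (diag_plus d (skew_block N A)) k k) / s)"
    "mtrace (T'_mat N n A \<psi> \<psi>' (complex_of_real (- (s\<^sup>2)))) = complex_of_real ((\<Sum>k<n. inv_fun (N + n) (diag_plus d (skew_block N A)) (N + k) (N + k)) / s)"
    by (rule system_fixed_point[OF A Nn(2) s sys]) blast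
  have v_eq: "v p q = variance_profile N n \<sigma> p q" if "p < N + n" "q < N + n" for p q
    unfolding v_def w_def using that second_eq[of "(p, q)"] second_eq[of "(q, p)"]
    by (auto simp: variance_profile_def E_def edges_def)
  have fixpt: "d p = s + (\<Sum>q<N + n. v p q * inv_fun (N + n) (diag_plus d (skew_block N A)) q q)" if "p < N + n" for p
    unfolding d(2)[OF that] using v_eq[OF that] by (intro arg_cong2[where f = "(+)"] sum.cong refl) auto
  show ?thesis
  proof (rule that[of "\<lambda>k. inv_fun (N + n) (diag_plus d (skew_block N A)) k k"])
    fix D :: "nat \<Rightarrow> real" assume D: "\<forall>k. \<bar>D k\<bar> \<le> 1"
    have fi: "integrable \<P> (diag_stat D)" by (rule bounded_integrable[OF diag_stat_measurable diag_stat_abs_le[OF D]])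
    have Ef: "(LINT \<omega>|M. diag_stat D (yy \<omega>)) = P.expectation (diag_stat D)" by (rule tr_eq[OF diag_stat_measurable])
    have f_bd: "\<bar>diag_stat D y - P.expectation (diag_stat D)\<bar> \<le> real (N + n) / s + \<bar>P.expectation (diag_stat D)\<bar>" for y
      using diag_stat_abs_le[OF D, of y] by linarith
    have f2i: "integrable \<P> (\<lambda>y. (diag_stat D y - P.expectation (diag_stat D))\<^sup>2)"
    proof (rule bounded_integrable)
      fix y show "\<bar>(diag_stat D y - P.expectation (diag_stat D))\<^sup>2\<bar> \<le> (real (N + n) / s + \<bar>P.expectation (diag_stat D)\<bar>)\<^sup>2"
        unfolding abs_power2 using f_bd[of y] s by (subst abs_le_square_iff[symmetric]) simp
    qed measurable
    show "integrable M (\<lambda>\<omega>. \<Sum>k<N + n. D k * G \<omega> k k)"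
      unfolding fsum by (rule tr_int[OF fi])
    show "integrable M (\<lambda>\<omega>. ((\<Sum>k<N + n. D k * G \<omega> k k) - (LINT \<omega>|M. (\<Sum>k<N + n. D k * G \<omega> k k)))\<^sup>2)"
      unfolding fsum Ef by (rule tr_int[OF f2i])
    show "(LINT \<omega>|M. ((\<Sum>k<N + n. D k * G \<omega> k k) - (LINT \<omega>|M. (\<Sum>k<N + n. D k * G \<omega> k k)))\<^sup>2) \<le> V"
      unfolding fsum Ef using variance_bound[OF D] f2i by (subst tr_eq) (auto simp: assms(18) var_const_def)
    show "\<bar>(LINT \<omega>|M. (\<Sum>k<N + n. D k * G \<omega> k k)) - (\<Sum>k<N + n. D k * inv_fun (N + n) (diag_plus d (skew_block N A)) k k)\<bar>
       \<le> 2 * (b\<^sup>2 * (8 * \<kappa> + 16) / (s ^ 4 * h) + b * (V + 1) / (2 * s\<^sup>2) + b / s ^ 3)"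
      unfolding fsum Ef using deterministic_equivalent[where d = d, OF d(1) fixpt bs D]
      by (simp add: bias_const_def var_const_def assms(18))
  qed (use d(3,4) in auto)
qed

text \<open>Carries independence from the triples (n, i, j) to the edges of the n-th linearised
  matrix; injectivity lets a finite product over the new indices be read as one over the old
  ones.\<close>

lemma (in prob_space) indep_vars_reindex:
  assumes f: "inj_on f I" and X: "indep_vars M' X (f ` I)"
  shows "indep_vars (\<lambda>i. M' (f i)) (\<lambda>i. X (f i)) I"
proof -
  let ?F = "\<lambda>i. {X i -` A \<inter> space M |A. A \<in> sets (M' i)}"
  have ind: "indep_sets ?F (f ` I)" and rv: "\<And>i. i \<in> f ` I \<Longrightarrow> random_variable (M' i) (X i)"
    using X unfolding indep_vars_def2 by auto
  have "indep_sets (\<lambda>i. ?F (f i)) I"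
    unfolding indep_sets_def
  proof (intro conjI ballI allI impI)
    show "?F (f i) \<subseteq> events" if "i \<in> I" for i using ind that unfolding indep_sets_def by blast
    fix J A assume J: "J \<subseteq> I" "J \<noteq> {}" "finite J" and A: "A \<in> Pi J (\<lambda>i. ?F (f i))"
    have fJ: "inj_on f J" using f J(1) by (rule inj_on_subset)
    define A' where "A' k = A (the_inv_into J f k)" for k
    have A': "A' (f j) = A j" if "j \<in> J" for j
      using the_inv_into_f_f[OF fJ that] by (simp add: A'_def)
    have "A' \<in> Pi (f ` J) ?F"
    proof (rule Pi_I)
      fix k assume "k \<in> f ` J"
      then obtain j where "j \<in> J" "k = f j" by blast
      thus "A' k \<in> ?F k" using A A'[of j] by (simp only: Pi_iff)
    qed
    moreover have "f ` J \<subseteq> f ` I" "f ` J \<noteq> {}" "finite (f ` J)" using J by auto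
    ultimately have "prob (\<Inter>k\<in>f ` J. A' k) = (\<Prod>k\<in>f ` J. prob (A' k))"
      using ind unfolding indep_sets_def by blast
    also have "(\<Inter>k\<in>f ` J. A' k) = (\<Inter>j\<in>J. A j)" using A' by auto
    also have "(\<Prod>k\<in>f ` J. prob (A' k)) = (\<Prod>j\<in>J. prob (A j))"
      by (simp add: prod.reindex[OF fJ] A')
    finally show "prob (\<Inter>j\<in>J. A j) = (\<Prod>j\<in>J. prob (A j))" .
  qed
  thus ?thesis unfolding indep_vars_def2 using rv by auto
qed

text \<open>Row k of the equation for the inverse reads s \<Gamma> k k = 1 - (d k - s) \<Gamma> k k
  - (skew part). The fixed point equation bounds the second term by b / s^2, and Cauchy-Schwarz
  against a column of \<Gamma> bounds the last by a / s, so a norm of one row or column of A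
  suffices.\<close>

lemma resolvent_diag_lower:
  assumes n: "1 \<le> n" and s: "0 < s" and d_ge: "\<And>k. k < N + n \<Longrightarrow> s \<le> d k"
    and fixpt: "\<And>k. k < N + n \<Longrightarrow> d k = s + (\<Sum>l<N + n. variance_profile N n \<sigma> k l * inv_fun (N + n) (diag_plus d (skew_block N A)) l l)"
    and \<sigma>: "\<And>i j. i < N \<Longrightarrow> j < n \<Longrightarrow> \<bar>\<sigma> i j\<bar> \<le> \<sigma>m" and b: "real (N + n) / real n * \<sigma>m\<^sup>2 \<le> b"
    and a: "0 \<le> a" "(\<Sum>l<N + n. (skew_block N A k l)\<^sup>2) \<le> a\<^sup>2" and k: "k < N + n"
  shows "1 - (b / s\<^sup>2 + a / s) \<le> s * inv_fun (N + n) (diag_plus d (skew_block N A)) k k"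
proof -
  let ?\<Gamma> = "inv_fun (N + n) (diag_plus d (skew_block N A))"
  note kf = s d_ge skew_block_skew
  have G0: "0 \<le> ?\<Gamma> l l" for l
    by (rule inv_fun_diag_nonneg[where d = d and B = "skew_block N A" and K = "N + n" and s = s, OF kf])
  have G1: "?\<Gamma> l l \<le> 1 / s" for l
    using inv_fun_abs_le[where d = d and B = "skew_block N A" and K = "N + n" and s = s, OF kf, of l l] by linarith
  have "d k * ?\<Gamma> k k + (\<Sum>l<N + n. skew_block N A k l * ?\<Gamma> l k) = 1"
    using inv_fun_right[where d = d and B = "skew_block N A" and K = "N + n" and s = s, OF kf k k]
      diag_plus_mult_vec[OF k, of d "skew_block N A" "\<lambda>l. ?\<Gamma> l k"] by simp
  moreover have "(\<Sum>l<N + n. skew_block N A k l * ?\<Gamma> l k) \<le> a / s"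
  proof -
    have "(\<Sum>l<N + n. skew_block N A k l * ?\<Gamma> l k)\<^sup>2 \<le> (\<Sum>l<N + n. (skew_block N A k l)\<^sup>2) * (\<Sum>l<N + n. (?\<Gamma> l k)\<^sup>2)"
      by (rule Cauchy_Schwarz_ineq_sum)
    also have "\<dots> \<le> a\<^sup>2 * (1 / s\<^sup>2)"
      using inv_fun_col_bound[where d = d and B = "skew_block N A" and K = "N + n" and s = s, OF kf] a
      by (intro mult_mono) (auto intro!: sum_nonneg)
    also have "\<dots> = (a / s)\<^sup>2" by (simp add: power_divide)
    finally have "\<bar>\<Sum>l<N + n. skew_block N A k l * ?\<Gamma> l k\<bar> \<le> \<bar>a / s\<bar>"
      by (simp only: abs_le_square_iff)
    thus ?thesis using a s by simp
  qed
  moreover have "(d k - s) * ?\<Gamma> k k \<le> b / s\<^sup>2"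
  proof -
    have sq: "(\<sigma> i j)\<^sup>2 / real n \<le> \<sigma>m\<^sup>2 / real n" if "i < N" "j < n" for i j
    proof (rule divide_right_mono)
      have "\<bar>\<sigma> i j\<bar> \<le> \<bar>\<sigma>m\<bar>" using \<sigma>[OF that] by linarith
      thus "(\<sigma> i j)\<^sup>2 \<le> \<sigma>m\<^sup>2" by (simp only: abs_le_square_iff)
    qed simp
    have v: "0 \<le> variance_profile N n \<sigma> k l \<and> variance_profile N n \<sigma> k l \<le> \<sigma>m\<^sup>2 / real n" if "l < N + n" for l
      using k that by (auto simp: variance_profile_def intro!: sq)
    have "d k - s = (\<Sum>l<N + n. variance_profile N n \<sigma> k l * ?\<Gamma> l l)" using fixpt[OF k] by simp
    also have "\<dots> \<le> (\<Sum>l<N + n. \<sigma>m\<^sup>2 / real n * (1 / s))"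
      using v G0 G1 by (intro sum_mono mult_mono) auto
    also have "\<dots> = (real (N + n) / real n * \<sigma>m\<^sup>2) / s" by simp
    also have "\<dots> \<le> b / s" using b s by (intro divide_right_mono) auto
    finally have "d k - s \<le> b / s" .
    moreover have "0 \<le> d k - s" using d_ge[OF k] by simp
    ultimately have "(d k - s) * ?\<Gamma> k k \<le> (b / s) * (1 / s)"
      using G0 G1 by (intro mult_mono) auto
    thus ?thesis by (simp add: power2_eq_square)
  qed
  ultimately show ?thesis by (simp add: left_diff_distrib)
qed

lemma average_stieltjes:
  assumes "has_stieltjes \<nu> (\<lambda>z. 1 / of_nat m * g z)" "g (complex_of_real (- (s\<^sup>2))) = complex_of_real x" "0 < s"
  shows "(LINT x:{0..}|\<nu>. 1 / (x + s\<^sup>2)) = x / real m"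
proof -
  have "complex_of_real (LINT x:{0..}|\<nu>. 1 / (x + s\<^sup>2)) = 1 / of_nat m * complex_of_real x"
    using has_stieltjes_neg[OF assms(1), of "s\<^sup>2"] assms(2,3) by simp
  also have "\<dots> = complex_of_real (x / real m)" by simp
  finally show ?thesis by (simp only: of_real_eq_iff)
qed

lemma scalar_prod_self_le:
  "euclid_norm v \<le> a \<Longrightarrow> scalar_prod v v \<le> a\<^sup>2 \<and> 0 \<le> a"
proof -
  assume v: "euclid_norm v \<le> a"
  have "0 \<le> scalar_prod v v" by (auto simp: scalar_prod_def intro!: sum_nonneg)
  hence "0 \<le> euclid_norm v" by (simp add: euclid_norm_def)
  hence "0 \<le> a" using v by linarith
  moreover have "scalar_prod v v \<le> a\<^sup>2" using v unfolding euclid_norm_def by (rule sqrt_le_D)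
  ultimately show "scalar_prod v v \<le> a\<^sup>2 \<and> 0 \<le> a" by simp
qed

text \<open>s^2 times the transform at - s^2 is an average of the quantities s \<Gamma> k k, which
  are close to 1 for large s; \<open>tail_bound\<close> converts this. The bound depends on s, a and
  b alone, so it gives tightness uniformly in n.\<close>

lemma deterministic_tails:
  assumes A: "A \<in> carrier_mat N n" and Nn: "1 \<le> N" "1 \<le> n" and s: "0 < s"
    and sys: "solves_system N n \<sigma> A \<psi> \<psi>'"
    and \<sigma>: "\<And>i j. i < N \<Longrightarrow> j < n \<Longrightarrow> \<bar>\<sigma> i j\<bar> \<le> \<sigma>m" and b: "real (N + n) / real n * \<sigma>m\<^sup>2 \<le> b"
    and col: "\<And>k. k < n \<Longrightarrow> euclid_norm (Matrix.col A k) \<le> a"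
    and row: "\<And>l. l < N \<Longrightarrow> euclid_norm (Matrix.row A l) \<le> a"
  shows "has_stieltjes \<pi> (\<lambda>z. 1 / of_nat N * mtrace (T_mat N n A \<psi> \<psi>' z)) \<Longrightarrow> measure \<pi> {s\<^sup>2<..} \<le> 2 * (b / s\<^sup>2 + a / s)"
    and "has_stieltjes \<pi>' (\<lambda>z. 1 / of_nat n * mtrace (T'_mat N n A \<psi> \<psi>' z)) \<Longrightarrow> measure \<pi>' {s\<^sup>2<..} \<le> 2 * (b / s\<^sup>2 + a / s)"
proof -
  obtain d where d: "\<And>k. k < N + n \<Longrightarrow> s \<le> d k"
    "\<And>k. k < N + n \<Longrightarrow> d k = s + (\<Sum>l<N + n. variance_profile N n \<sigma> k l * inv_fun (N + n) (diag_plus d (skew_block N A)) l l)"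
    "mtrace (T_mat N n A \<psi> \<psi>' (complex_of_real (- (s\<^sup>2)))) = complex_of_real ((\<Sum>k<N. inv_fun (N + n) (diag_plus d (skew_block N A)) k k) / s)"
    "mtrace (T'_mat N n A \<psi> \<psi>' (complex_of_real (- (s\<^sup>2)))) = complex_of_real ((\<Sum>k<n. inv_fun (N + n) (diag_plus d (skew_block N A)) (N + k) (N + k)) / s)"
    by (rule system_fixed_point[OF A Nn(2) s sys]) blast
  let ?\<Gamma> = "inv_fun (N + n) (diag_plus d (skew_block N A))"
  have dA: "dim_row A = N" "dim_col A = n" using A by auto
  have a: "0 \<le> a" using scalar_prod_self_le[OF col[of 0]] Nn by auto
  have blk2: "(\<Sum>l<N + n. (skew_block N A k l)\<^sup>2) \<le> a\<^sup>2" if k: "k < N + n" for k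
  proof (cases "k < N")
    case True
    have "(\<Sum>l<N + n. (skew_block N A k l)\<^sup>2) = scalar_prod (Matrix.row A k) (Matrix.row A k)"
      using True dA by (simp add: sum_split_block skew_block_def scalar_prod_def atLeast0LessThan power2_eq_square)
    thus ?thesis using scalar_prod_self_le[OF row[OF True]] by simp
  next
    case False
    hence k': "k - N < n" using k by auto
    have "(\<Sum>l<N + n. (skew_block N A k l)\<^sup>2) = scalar_prod (Matrix.col A (k - N)) (Matrix.col A (k - N))"
      using False dA k' by (simp add: sum_split_block skew_block_def scalar_prod_def atLeast0LessThan power2_eq_square)
    thus ?thesis using scalar_prod_self_le[OF col[OF k']] by simp
  qed
  have lower: "1 - (b / s\<^sup>2 + a / s) \<le> s * ?\<Gamma> k k" if "k < N + n" for k
    by (rule resolvent_diag_lower[OF Nn(2) s d(1,2) \<sigma> b a blk2[OF that] that])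
  have mean: "1 - (b / s\<^sup>2 + a / s) \<le> s\<^sup>2 * ((\<Sum>i<m. g i) / s / real m)"
    if "1 \<le> m" "\<And>i. i < m \<Longrightarrow> 1 - (b / s\<^sup>2 + a / s) \<le> s * g i" for m and g :: "nat \<Rightarrow> real"
  proof -
    have "(\<Sum>i<m. 1 - (b / s\<^sup>2 + a / s)) \<le> (\<Sum>i<m. s * g i)" using that by (intro sum_mono) auto
    hence "real m * (1 - (b / s\<^sup>2 + a / s)) \<le> s * (\<Sum>i<m. g i)" by (simp add: sum_distrib_left)
    hence "1 - (b / s\<^sup>2 + a / s) \<le> s * (\<Sum>i<m. g i) / real m"
      using that(1) by (simp add: pos_le_divide_eq mult.commute)
    also have "\<dots> = s\<^sup>2 * ((\<Sum>i<m. g i) / s / real m)" using s by (simp add: power2_eq_square)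
    finally show ?thesis .
  qed
  have s2: "0 < s\<^sup>2" using s by simp
  show "measure \<pi> {s\<^sup>2<..} \<le> 2 * (b / s\<^sup>2 + a / s)"
    if p: "has_stieltjes \<pi> (\<lambda>z. 1 / of_nat N * mtrace (T_mat N n A \<psi> \<psi>' z))"
  proof (rule tail_bound[OF _ s2])
    show "prob_on_nonneg \<pi>" using p by (simp add: has_stieltjes_def)
    show "1 - (b / s\<^sup>2 + a / s) \<le> s\<^sup>2 * (LINT x:{0..}|\<pi>. 1 / (x + s\<^sup>2))"
      unfolding average_stieltjes[OF p d(3) s] by (rule mean) (use lower Nn in auto)
  qed
  show "measure \<pi>' {s\<^sup>2<..} \<le> 2 * (b / s\<^sup>2 + a / s)"
    if p: "has_stieltjes \<pi>' (\<lambda>z. 1 / of_nat n * mtrace (T'_mat N n A \<psi> \<psi>' z))"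
  proof (rule tail_bound[OF _ s2])
    show "prob_on_nonneg \<pi>'" using p by (simp add: has_stieltjes_def)
    show "1 - (b / s\<^sup>2 + a / s) \<le> s\<^sup>2 * (LINT x:{0..}|\<pi>'. 1 / (x + s\<^sup>2))"
      unfolding average_stieltjes[OF p d(4) s] by (rule mean) (use lower Nn in auto)
  qed
qed

theorem corollary2p7:
  fixes M :: "'a measure"
    and N :: "nat \<Rightarrow> nat" and c :: real
    and X :: "nat \<Rightarrow> nat \<Rightarrow> nat \<Rightarrow> 'a \<Rightarrow> real"
    and \<sigma> :: "nat \<Rightarrow> nat \<Rightarrow> nat \<Rightarrow> real" and \<sigma>max a_max \<epsilon> :: real
    and A :: "nat \<Rightarrow> real Matrix.mat"
    and \<psi> \<psi>' :: "nat \<Rightarrow> nat \<Rightarrow> complex \<Rightarrow> complex"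
    and \<Sigma> :: "nat \<Rightarrow> 'a \<Rightarrow> real Matrix.mat"
    and P P' :: "nat \<Rightarrow> 'a \<Rightarrow> real measure"
    and \<pi> \<pi>' :: "nat \<Rightarrow> real measure"
  defines "I \<equiv> {(n, i, j). 1 \<le> n \<and> i < N n \<and> j < n}"
    and "\<Sigma> \<equiv> \<lambda>n \<omega>. sigma_mat (N n) n (\<sigma> n) (A n) (\<lambda>i j. X n i j \<omega>)"
  assumes prob: "prob_space M"
    and N_pos: "\<And>n. 1 \<le> n \<Longrightarrow> 1 \<le> N n"
    and c_pos: "0 < c"
    and N_lim: "(\<lambda>n. real (N n) / real n) \<longlonglongrightarrow> c"
    and A1_indep: "prob_space.indep_vars M (\<lambda>_. borel) (\<lambda>(n, i, j). X n i j) I"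
    and A1_ident: "\<And>n i j n' i' j'. (n, i, j) \<in> I \<Longrightarrow> (n', i', j') \<in> I \<Longrightarrow>
          distr M borel (X n i j) = distr M borel (X n' i' j')"
    and A1_int: "\<And>n i j. (n, i, j) \<in> I \<Longrightarrow> integrable M (X n i j)"
    and A1_mean: "\<And>n i j. (n, i, j) \<in> I \<Longrightarrow> (LINT \<omega>|M. X n i j \<omega>) = 0"
    and A1_var: "\<And>n i j. (n, i, j) \<in> I \<Longrightarrow> (LINT \<omega>|M. (X n i j \<omega>)\<^sup>2) = 1"
    and \<epsilon>_pos: "0 < \<epsilon>"
    and A1_moment: "\<And>n i j. (n, i, j) \<in> I \<Longrightarrow>
          integrable M (\<lambda>\<omega>. \<bar>X n i j \<omega>\<bar> powr (4 + \<epsilon>))"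
    and A2: "\<And>n i j. (n, i, j) \<in> I \<Longrightarrow> \<bar>\<sigma> n i j\<bar> \<le> \<sigma>max"
    and A3_dim: "\<And>n. 1 \<le> n \<Longrightarrow> A n \<in> carrier_mat (N n) n"
    and A3_col: "\<And>n k. 1 \<le> n \<Longrightarrow> k < n \<Longrightarrow> euclid_norm (Matrix.col (A n) k) \<le> a_max"
    and A3_row: "\<And>n l. 1 \<le> n \<Longrightarrow> l < N n \<Longrightarrow> euclid_norm (Matrix.row (A n) l) \<le> a_max"
    and system: "\<And>n. 1 \<le> n \<Longrightarrow> solves_system (N n) n (\<sigma> n) (A n) (\<psi> n) (\<psi>' n)"
    and P: "\<And>n \<omega>. 1 \<le> n \<Longrightarrow> \<omega> \<in> space M \<Longrightarrow> has_stieltjes (P n \<omega>)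
          (\<lambda>z. 1 / of_nat (N n) * mtrace (resolvent (\<Sigma> n \<omega> * transpose_mat (\<Sigma> n \<omega>)) z))"
    and P': "\<And>n \<omega>. 1 \<le> n \<Longrightarrow> \<omega> \<in> space M \<Longrightarrow> has_stieltjes (P' n \<omega>)
          (\<lambda>z. 1 / of_nat n * mtrace (resolvent (transpose_mat (\<Sigma> n \<omega>) * \<Sigma> n \<omega>) z))"
    and \<pi>: "\<And>n. 1 \<le> n \<Longrightarrow> has_stieltjes (\<pi> n)
          (\<lambda>z. 1 / of_nat (N n) * mtrace (T_mat (N n) n (A n) (\<psi> n) (\<psi>' n) z))"
    and \<pi>': "\<And>n. 1 \<le> n \<Longrightarrow> has_stieltjes (\<pi>' n)
          (\<lambda>z. 1 / of_nat n * mtrace (T'_mat (N n) n (A n) (\<psi> n) (\<psi>' n) z))"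
  shows "(\<forall>f :: real \<Rightarrow> real. continuous_on {0..} f \<longrightarrow> bounded (f ` {0..}) \<longrightarrow>
            (AE \<omega> in M. (\<lambda>n. (LINT x:{0..}|P n \<omega>. f x) - (LINT x:{0..}|\<pi> n. f x))
               \<longlonglongrightarrow> 0)) \<and>
         (\<forall>f :: real \<Rightarrow> real. continuous_on {0..} f \<longrightarrow> bounded (f ` {0..}) \<longrightarrow>
            (AE \<omega> in M. (\<lambda>n. (LINT x:{0..}|P' n \<omega>. f x) - (LINT x:{0..}|\<pi>' n. f x))
               \<longlonglongrightarrow> 0))"
proof -
  interpret M: prob_space M by (rule prob)
  \<comment> \<open>Made positive so that \<open>h\<close>, which occurs in denominators, is nonzero
    even when all variances vanish.\<close>
  define \<sigma>m where "\<sigma>m = \<bar>\<sigma>max\<bar> + 1"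
  have \<sigma>m: "0 < \<sigma>m" by (simp add: \<sigma>m_def)
  have I_iff: "(n, i, j) \<in> I \<longleftrightarrow> 1 \<le> n \<and> i < N n \<and> j < n" for n i j by (simp add: I_def)
  have \<sigma>_le: "\<bar>\<sigma> n i j\<bar> \<le> \<sigma>m" if "1 \<le> n" "i < N n" "j < n" for n i j
    using A2[of n i j] that by (simp add: I_iff \<sigma>m_def)
  obtain c1 where c1: "\<And>n. \<bar>real (N n) / real n\<bar> \<le> c1"
    using convergent_imp_Bseq[OF convergentI[OF N_lim]] by (auto simp: Bseq_def)
  \<comment> \<open>The average over N terms needs n / N bounded as well; this is where the
    positivity of \<open>c\<close> enters.\<close>
  have "(\<lambda>n. inverse (real (N n) / real n)) \<longlonglongrightarrow> inverse c"
    using N_lim c_pos by (intro tendsto_inverse) auto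
  from convergent_imp_Bseq[OF convergentI[OF this]]
  obtain c2 where c2: "\<And>n. \<bar>inverse (real (N n) / real n)\<bar> \<le> c2" by (auto simp: Bseq_def)
  \<comment> \<open>Bounds K h^2 for all n >= 1 at once, so that one range of s, given by 2 b <=
    s^2, serves every n.\<close>
  define b where "b = (c1 + 1) * \<sigma>m\<^sup>2"
  have c1_nn: "0 \<le> c1" using c1[of 0] by simp
  have b_pos: "0 < b" using c1_nn \<sigma>m by (simp add: b_def)
  have b: "real (N n + n) / real n * \<sigma>m\<^sup>2 \<le> b" if "1 \<le> n" for n
    unfolding b_def using c1[of n] that by (intro mult_right_mono) (auto simp: add_divide_distrib)
  have X_meas: "X n i j \<in> borel_measurable M" if "(n, i, j) \<in> I" for n i j
    using A1_indep that unfolding M.indep_vars_def by auto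
  have X4: "integrable M (\<lambda>\<omega>. X n i j \<omega> ^ 4)" if "(n, i, j) \<in> I" for n i j
  proof (rule Bochner_Integration.integrable_bound)
    show "integrable M (\<lambda>\<omega>. 1 + \<bar>X n i j \<omega>\<bar> powr (4 + \<epsilon>))" using A1_moment[OF that] by simp
    show "(\<lambda>\<omega>. X n i j \<omega> ^ 4) \<in> borel_measurable M" using X_meas[OF that] by measurable
    show "AE \<omega> in M. norm (X n i j \<omega> ^ 4) \<le> norm (1 + \<bar>X n i j \<omega>\<bar> powr (4 + \<epsilon>))"
    proof (rule AE_I2)
      fix \<omega>
      let ?x = "\<bar>X n i j \<omega>\<bar>"
      have "?x ^ 4 \<le> 1 + ?x powr (4 + \<epsilon>)"
      proof (cases "?x \<le> 1")
        case True
        hence "?x ^ 4 \<le> 1" by (intro power_le_one) auto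
        thus ?thesis using powr_ge_zero[of ?x "4 + \<epsilon>"] by linarith
      next
        case False
        have "?x ^ 4 = ?x powr real 4" using False by (subst powr_realpow) auto
        also have "\<dots> \<le> ?x powr (4 + \<epsilon>)" using False \<epsilon>_pos by (intro powr_mono) auto
        finally show ?thesis by simp
      qed
      thus "norm (X n i j \<omega> ^ 4) \<le> norm (1 + ?x powr (4 + \<epsilon>))" by (simp add: power_abs[symmetric])
    qed
  qed
  \<comment> \<open>Identical distribution makes one constant serve all entries; the added 1 pays
    for |x|^3 <= 1 + x^4 in \<open>trace_estimates\<close>.\<close>
  define \<kappa> where "\<kappa> = (LINT \<omega>|M. X 1 0 0 \<omega> ^ 4) + 1"
  have I100: "(1, 0, 0) \<in> I" using N_pos[of 1] by (simp add: I_iff)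
  have mom4: "(LINT \<omega>|M. X n i j \<omega> ^ 4) = \<kappa> - 1" if "(n, i, j) \<in> I" for n i j
  proof -
    have "(LINT \<omega>|M. X n i j \<omega> ^ 4) = (LINT x|distr M borel (X n i j). x ^ 4)"
      by (subst integral_distr[OF X_meas[OF that]]) auto
    also have "distr M borel (X n i j) = distr M borel (X 1 0 0)" by (rule A1_ident[OF that I100])
    also have "(LINT x|distr M borel (X 1 0 0). x ^ 4) = (LINT \<omega>|M. X 1 0 0 \<omega> ^ 4)"
      by (subst integral_distr[OF X_meas[OF I100]]) auto
    finally show ?thesis by (simp add: \<kappa>_def)
  qed
  have indep_n: "M.indep_vars (\<lambda>_. borel) (\<lambda>e. X n (fst e) (snd e - N n)) (edges (N n) n)" if n: "1 \<le> n" for n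
  proof -
    define \<tau> where "\<tau> e = (n, fst e, snd e - N n)" for e :: "nat \<times> nat"
    have inj: "inj_on \<tau> (edges (N n) n)"
      by (rule inj_onI) (auto simp: \<tau>_def edges_def)
    have "\<tau> ` edges (N n) n \<subseteq> I" using n by (auto simp: \<tau>_def edges_def I_iff)
    from M.indep_vars_reindex[OF inj M.indep_vars_subset[OF A1_indep this]]
    show ?thesis by (simp add: \<tau>_def)
  qed
  define G where "G s n \<omega> = inv_fun (N n + n) (diag_plus (\<lambda>_. s) (skew_block (N n) (\<Sigma> n \<omega>)))" for s n \<omega>
  have \<Sigma>_carrier: "\<Sigma> n \<omega> \<in> carrier_mat (N n) n" if "1 \<le> n" for n \<omega>
    using A3_dim[OF that] by (simp add: \<Sigma>_def sigma_mat_def)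
  have key: "AE \<omega> in M.
        (\<lambda>n. (LINT x:{0..}|P n \<omega>. 1 / (x + s\<^sup>2)) - (LINT x:{0..}|\<pi> n. 1 / (x + s\<^sup>2))) \<longlonglongrightarrow> 0 \<and>
        (\<lambda>n. (LINT x:{0..}|P' n \<omega>. 1 / (x + s\<^sup>2)) - (LINT x:{0..}|\<pi>' n. 1 / (x + s\<^sup>2))) \<longlonglongrightarrow> 0"
    if s: "0 < s" and bs: "2 * b \<le> s\<^sup>2" for s
  proof -
    define V where "V = 8 * b / s ^ 4 + (256 + 32 * \<kappa>) * b\<^sup>2 / s ^ 6"
    define F where "F D n \<omega> = (\<Sum>k<N n + n. D n k * G s n \<omega> k k)" for D :: "nat \<Rightarrow> nat \<Rightarrow> real" and n \<omega>
    define \<beta> where "\<beta> n = 2 * (b\<^sup>2 * (8 * \<kappa> + 16) / (s ^ 4 * (\<sigma>m / sqrt (real n))) + b * (V + 1) / (2 * s\<^sup>2) + b / s ^ 3)" for n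
    have ex: "\<exists>\<gamma>. 1 \<le> n \<longrightarrow>
        mtrace (T_mat (N n) n (A n) (\<psi> n) (\<psi>' n) (complex_of_real (- (s\<^sup>2)))) = complex_of_real ((\<Sum>k<N n. \<gamma> k) / s) \<and>
        mtrace (T'_mat (N n) n (A n) (\<psi> n) (\<psi>' n) (complex_of_real (- (s\<^sup>2)))) = complex_of_real ((\<Sum>k<n. \<gamma> (N n + k)) / s) \<and>
        (\<forall>D. (\<forall>n k. \<bar>D n k\<bar> \<le> 1) \<longrightarrow>
          integrable M (F D n) \<and> integrable M (\<lambda>\<omega>. (F D n \<omega> - M.expectation (F D n))\<^sup>2) \<and>
          (LINT \<omega>|M. (F D n \<omega> - M.expectation (F D n))\<^sup>2) \<le> V \<and>
          \<bar>M.expectation (F D n) - (\<Sum>k<N n + n. D n k * \<gamma> k)\<bar> \<le> \<beta> n)" (is "\<exists>\<gamma>. ?Q n \<gamma>") for n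
    proof (cases "1 \<le> n")
      case n: True
      have mean': "(LINT \<omega>|M. X n i j \<omega>) = 0" "(LINT \<omega>|M. (X n i j \<omega>)\<^sup>2) = 1"
        "integrable M (\<lambda>\<omega>. X n i j \<omega> ^ 4)" "(LINT \<omega>|M. X n i j \<omega> ^ 4) \<le> \<kappa> - 1" "\<bar>\<sigma> n i j\<bar> \<le> \<sigma>m"
        if "i < N n" "j < n" for i j
      proof -
        have "(n, i, j) \<in> I" using that n by (simp add: I_iff)
        thus "(LINT \<omega>|M. X n i j \<omega>) = 0" "(LINT \<omega>|M. (X n i j \<omega>)\<^sup>2) = 1"
          "integrable M (\<lambda>\<omega>. X n i j \<omega> ^ 4)" "(LINT \<omega>|M. X n i j \<omega> ^ 4) \<le> \<kappa> - 1"
          using A1_mean A1_var X4 mom4 by simp_all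
        show "\<bar>\<sigma> n i j\<bar> \<le> \<sigma>m" by (rule \<sigma>_le[OF n that])
      qed
      show ?thesis
        by (rule trace_estimates[OF prob N_pos[OF n] n A3_dim[OF n] system[OF n] indep_n[OF n] mean' \<sigma>m b[OF n] s bs],
            assumption+)
          (auto simp: F_def[abs_def] G_def[abs_def] \<Sigma>_def \<beta>_def V_def)
    qed simp
    have "\<forall>n. \<exists>\<gamma>. ?Q n \<gamma>" by (rule allI) (rule ex)
    from choice[OF this] obtain \<gamma> where \<gamma>: "\<And>n. 1 \<le> n \<Longrightarrow>
        mtrace (T_mat (N n) n (A n) (\<psi> n) (\<psi>' n) (complex_of_real (- (s\<^sup>2)))) = complex_of_real ((\<Sum>k<N n. \<gamma> n k) / s)"
      "\<And>n. 1 \<le> n \<Longrightarrow> mtrace (T'_mat (N n) n (A n) (\<psi> n) (\<psi>' n) (complex_of_real (- (s\<^sup>2)))) = complex_of_real ((\<Sum>k<n. \<gamma> n (N n + k)) / s)"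
      and est: "\<And>n D. 1 \<le> n \<Longrightarrow> \<forall>n k. \<bar>D n k\<bar> \<le> 1 \<Longrightarrow>
          integrable M (F D n) \<and> integrable M (\<lambda>\<omega>. (F D n \<omega> - M.expectation (F D n))\<^sup>2) \<and>
          (LINT \<omega>|M. (F D n \<omega> - M.expectation (F D n))\<^sup>2) \<le> V \<and>
          \<bar>M.expectation (F D n) - (\<Sum>k<N n + n. D n k * \<gamma> n k)\<bar> \<le> \<beta> n"
      by blast
    have conv: "AE \<omega> in M. (\<lambda>n. (F D n \<omega> - (\<Sum>k<N n + n. D n k * \<gamma> n k)) / r n) \<longlonglongrightarrow> 0"
      if D: "\<forall>n k. \<bar>D n k\<bar> \<le> 1" and r: "\<And>n. 1 \<le> n \<Longrightarrow> 0 < r n \<and> real n / r n \<le> c3" for D r c3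
    proof -
      have r': "1 / r n \<le> c3 / real n" if "1 \<le> n" for n
        using r[OF that] that by (simp add: field_simps)
      \<comment> \<open>Shifted by one because the estimates hold for n >= 1 only;
        \<open>LIMSEQ_imp_Suc\<close> undoes the shift. The expectation of \<open>Z n\<close> is at
        most a constant times 1 / (n + 1)^2.\<close>
      define Z where "Z n \<omega> = ((F D (Suc n) \<omega> - M.expectation (F D (Suc n))) / r (Suc n))\<^sup>2" for n \<omega>
      have Z: "AE \<omega> in M. (\<lambda>n. Z n \<omega>) \<longlonglongrightarrow> 0"
      proof (rule AE_tendsto_zero_summable)
        show "integrable M (Z n)" for n
          unfolding Z_def power_divide using est[of "Suc n" D] D by simp
        show "0 \<le> Z n \<omega>" for n \<omega> by (simp add: Z_def)
        show "summable (\<lambda>n. LINT \<omega>|M. Z n \<omega>)"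
        proof (rule summable_comparison_test')
          have "summable (\<lambda>n. inverse (real (Suc n) ^ 2))"
            using inverse_power_summable[of 2, where ?'a = real] by (subst summable_Suc_iff) simp
          thus "summable (\<lambda>n. V * c3\<^sup>2 * inverse (real (Suc n) ^ 2))" by (rule summable_mult)
          fix n :: nat
          have "(LINT \<omega>|M. Z n \<omega>) = (LINT \<omega>|M. (F D (Suc n) \<omega> - M.expectation (F D (Suc n)))\<^sup>2) * (1 / r (Suc n))\<^sup>2"
            by (simp add: Z_def power_divide)
          also have "\<dots> \<le> V * (c3 / real (Suc n))\<^sup>2"
          proof (rule mult_mono)
            show le: "(LINT \<omega>|M. (F D (Suc n) \<omega> - M.expectation (F D (Suc n)))\<^sup>2) \<le> V"
              using est[of "Suc n" D] D by simp
            have "0 \<le> (LINT \<omega>|M. (F D (Suc n) \<omega> - M.expectation (F D (Suc n)))\<^sup>2)"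
              by (intro integral_nonneg_AE) simp
            with le show "0 \<le> V" by linarith
            show "(1 / r (Suc n))\<^sup>2 \<le> (c3 / real (Suc n))\<^sup>2"
              using r'[of "Suc n"] r[of "Suc n"] by (intro power_mono) (auto simp: less_imp_le)
          qed simp
          also have "\<dots> = V * c3\<^sup>2 * inverse (real (Suc n) ^ 2)" by (simp only: power_divide divide_inverse mult.assoc power_mult_distrib power_inverse)
          finally have "(LINT \<omega>|M. Z n \<omega>) \<le> V * c3\<^sup>2 * inverse (real (Suc n) ^ 2)" .
          moreover have "0 \<le> (LINT \<omega>|M. Z n \<omega>)" by (intro integral_nonneg_AE) (simp add: Z_def)
          ultimately show "norm (LINT \<omega>|M. Z n \<omega>) \<le> V * c3\<^sup>2 * inverse (real (Suc n) ^ 2)" by simp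
        qed
      qed
      have bias: "(\<lambda>n. (M.expectation (F D n) - (\<Sum>k<N n + n. D n k * \<gamma> n k)) / r n) \<longlonglongrightarrow> 0"
      proof (rule Lim_null_comparison)
        show "\<forall>\<^sub>F n in sequentially. norm ((M.expectation (F D n) - (\<Sum>k<N n + n. D n k * \<gamma> n k)) / r n) \<le> \<beta> n * (c3 / real n)"
        proof (rule eventually_mono[OF eventually_ge_at_top[of 1]])
          fix n :: nat assume n: "1 \<le> n"
          have e: "\<bar>M.expectation (F D n) - (\<Sum>k<N n + n. D n k * \<gamma> n k)\<bar> \<le> \<beta> n" using est[OF n D] by blast
          have "norm ((M.expectation (F D n) - (\<Sum>k<N n + n. D n k * \<gamma> n k)) / r n)
              = \<bar>M.expectation (F D n) - (\<Sum>k<N n + n. D n k * \<gamma> n k)\<bar> * (1 / r n)"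
            using r[OF n] by simp
          also have "\<dots> \<le> \<beta> n * (c3 / real n)"
            using e r'[OF n] r[OF n] by (intro mult_mono) auto
          finally show "norm ((M.expectation (F D n) - (\<Sum>k<N n + n. D n k * \<gamma> n k)) / r n) \<le> \<beta> n * (c3 / real n)" .
        qed
        \<comment> \<open>\<beta> n grows like sqrt n, since h = \<sigma>m / sqrt n stands in a
          denominator, and is divided by a multiple of n.\<close>
        define B1 where "B1 = 2 * (b\<^sup>2 * (8 * \<kappa> + 16) / (s ^ 4 * \<sigma>m)) * c3"
        define B2 where "B2 = 2 * (b * (V + 1) / (2 * s\<^sup>2) + b / s ^ 3) * c3"
        have "(\<lambda>n. (B1 * sqrt (real n) + B2) / real n) \<longlonglongrightarrow> 0" by real_asymp
        moreover have "\<forall>\<^sub>F n in sequentially. (B1 * sqrt (real n) + B2) / real n = \<beta> n * (c3 / real n)"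
          using eventually_gt_at_top[of 0]
        proof eventually_elim
          case (elim n)
          have "\<beta> n = 2 * (b\<^sup>2 * (8 * \<kappa> + 16) / (s ^ 4 * \<sigma>m)) * sqrt (real n) + 2 * (b * (V + 1) / (2 * s\<^sup>2) + b / s ^ 3)"
            unfolding \<beta>_def distrib_left[of 2] by (simp add: distrib_left)
          thus ?case unfolding B1_def B2_def by (simp add: algebra_simps add_divide_distrib)
        qed
        ultimately show "(\<lambda>n. \<beta> n * (c3 / real n)) \<longlonglongrightarrow> 0" by (rule Lim_transform_eventually)
      qed
      from Z show ?thesis
      proof eventually_elim
        case (elim \<omega>)
        have "(\<lambda>n. sqrt (Z n \<omega>)) \<longlonglongrightarrow> sqrt 0" by (intro tendsto_real_sqrt elim)
        hence "(\<lambda>n. \<bar>(F D (Suc n) \<omega> - M.expectation (F D (Suc n))) / r (Suc n)\<bar>) \<longlonglongrightarrow> 0"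
          by (simp add: Z_def)
        hence "(\<lambda>n. (F D (Suc n) \<omega> - M.expectation (F D (Suc n))) / r (Suc n)) \<longlonglongrightarrow> 0"
          by (rule tendsto_rabs_zero_cancel)
        hence "(\<lambda>n. (F D n \<omega> - M.expectation (F D n)) / r n) \<longlonglongrightarrow> 0"
          by (rule LIMSEQ_imp_Suc)
        from tendsto_add[OF this bias] show ?case
          by (simp add: add_divide_distrib[symmetric])
      qed
    qed
    \<comment> \<open>Indicators of the two diagonal blocks: the weighted traces become s Tr Q and s
      Tr Q~.\<close>
    define D1 where "D1 n k = (if k < N n then 1 else 0 :: real)" for n k
    define D2 where "D2 n k = (if N n \<le> k then 1 else 0 :: real)" for n k
    have s1: "(\<Sum>k<N n + n. D1 n k * g k) = (\<Sum>k<N n. g k)" and s2: "(\<Sum>k<N n + n. D2 n k * g k) = (\<Sum>k<n. g (N n + k))"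
      for n and g :: "nat \<Rightarrow> real"
      by (simp_all add: sum_split_block D1_def D2_def)
    have c1': "AE \<omega> in M. (\<lambda>n. (F D1 n \<omega> - (\<Sum>k<N n + n. D1 n k * \<gamma> n k)) / (s * real (N n))) \<longlonglongrightarrow> 0"
    proof (rule conv)
      show "\<forall>n k. \<bar>D1 n k\<bar> \<le> 1" by (simp add: D1_def)
      fix n :: nat assume n: "1 \<le> n"
      have "real n / real (N n) \<le> c2" using c2[of n] by simp
      hence "real n / real (N n) / s \<le> c2 / s" using s by (intro divide_right_mono) auto
      thus "0 < s * real (N n) \<and> real n / (s * real (N n)) \<le> c2 / s"
        using s N_pos[OF n] by (simp add: mult.commute)
    qed
    have c2': "AE \<omega> in M. (\<lambda>n. (F D2 n \<omega> - (\<Sum>k<N n + n. D2 n k * \<gamma> n k)) / (s * real n)) \<longlonglongrightarrow> 0"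
    proof (rule conv)
      show "\<forall>n k. \<bar>D2 n k\<bar> \<le> 1" by (simp add: D2_def)
      fix n :: nat assume n: "1 \<le> n"
      thus "0 < s * real n \<and> real n / (s * real n) \<le> 1 / s" using s by simp
    qed
    show ?thesis
      using c1' c2' AE_space
    proof eventually_elim
      case (elim \<omega>)
      have mt: "mtrace (Matrix.mat m m (\<lambda>(i, j). complex_of_real (g i j / s))) = complex_of_real ((\<Sum>i<m. g i i) / s)"
        for m and g :: "nat \<Rightarrow> nat \<Rightarrow> real"
        by (simp add: mtrace_def sum_divide_distrib)
      have e1: "(F D1 n \<omega> - (\<Sum>k<N n + n. D1 n k * \<gamma> n k)) / (s * real (N n)) =
          (LINT x:{0..}|P n \<omega>. 1 / (x + s\<^sup>2)) - (LINT x:{0..}|\<pi> n. 1 / (x + s\<^sup>2))" if n: "1 \<le> n" for n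
      proof -
        have "mtrace (resolvent (\<Sigma> n \<omega> * transpose_mat (\<Sigma> n \<omega>)) (complex_of_real (- (s\<^sup>2)))) = complex_of_real ((\<Sum>k<N n. G s n \<omega> k k) / s)"
          unfolding resolvent_block(1)[OF \<Sigma>_carrier[OF n] s] G_def by (rule mt)
        from average_stieltjes[OF P[OF n elim(3)] this s] average_stieltjes[OF \<pi>[OF n] \<gamma>(1)[OF n] s]
        show ?thesis unfolding F_def s1 by (simp add: diff_divide_distrib)
      qed
      have e2: "(F D2 n \<omega> - (\<Sum>k<N n + n. D2 n k * \<gamma> n k)) / (s * real n) =
          (LINT x:{0..}|P' n \<omega>. 1 / (x + s\<^sup>2)) - (LINT x:{0..}|\<pi>' n. 1 / (x + s\<^sup>2))" if n: "1 \<le> n" for n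
      proof -
        have "mtrace (resolvent (transpose_mat (\<Sigma> n \<omega>) * \<Sigma> n \<omega>) (complex_of_real (- (s\<^sup>2)))) = complex_of_real ((\<Sum>k<n. G s n \<omega> (N n + k) (N n + k)) / s)"
          unfolding resolvent_block(2)[OF \<Sigma>_carrier[OF n] s] G_def by (rule mt)
        from average_stieltjes[OF P'[OF n elim(3)] this s] average_stieltjes[OF \<pi>'[OF n] \<gamma>(2)[OF n] s]
        show ?thesis unfolding F_def s2 by (simp add: diff_divide_distrib)
      qed
      show ?case
        using Lim_transform_eventually[OF elim(1) eventually_mono[OF eventually_ge_at_top[of 1] e1]]
          Lim_transform_eventually[OF elim(2) eventually_mono[OF eventually_ge_at_top[of 1] e2]] by blast
    qed
  qed
  have a: "0 \<le> a_max" using scalar_prod_self_le[OF A3_col[of 1 0]] by simp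
  have tight: "\<exists>R\<ge>0. (\<forall>n\<ge>1. measure (\<pi> n) {R<..} \<le> \<eta>) \<and> (\<forall>n\<ge>1. measure (\<pi>' n) {R<..} \<le> \<eta>)" if \<eta>: "0 < \<eta>" for \<eta>
  proof -
    \<comment> \<open>For s >= 1 one has b / s^2 <= b / s, so the tail bound is at most 2 (b +
      a_max) / s; the second argument of the maximum makes this at most \<eta>.\<close>
    define s where "s = max 1 (2 * (b + a_max) / \<eta>)"
    have s: "1 \<le> s" "2 * (b + a_max) / \<eta> \<le> s" by (simp_all add: s_def)
    have "b / s\<^sup>2 \<le> b / s" using s(1) b_pos by (intro divide_left_mono) (auto simp: power2_eq_square)
    hence "2 * (b / s\<^sup>2 + a_max / s) \<le> 2 * (b + a_max) / s" by (simp add: add_divide_distrib)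
    also have "\<dots> \<le> \<eta>" using s \<eta> by (simp add: field_simps)
    finally have le: "2 * (b / s\<^sup>2 + a_max / s) \<le> \<eta>" .
    have s0: "0 < s" using s(1) by simp
    note dt = deterministic_tails[OF A3_dim N_pos _ s0 system \<sigma>_le b A3_col A3_row]
    have "measure (\<pi> n) {s\<^sup>2<..} \<le> \<eta>" "measure (\<pi>' n) {s\<^sup>2<..} \<le> \<eta>" if n: "1 \<le> n" for n
      using dt(1)[OF n n n n n _ _ n n _ n _ \<pi>[OF n]] dt(2)[OF n n n n n _ _ n n _ n _ \<pi>'[OF n]] le by fastforce+
    thus ?thesis by (intro exI[of _ "s\<^sup>2"]) auto
  qed
  \<comment> \<open>The values s^2 = 2 b + 1 / (k + 1) lie in the contraction range and accumulate
    at t0 = 2 b, as \<open>stieltjes_convergence\<close> requires. They are countably many, so one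
    null set serves them all, and it is fixed before \<open>f\<close>.\<close>
  have all: "AE \<omega> in M. \<forall>k::nat.
        (\<lambda>n. (LINT x:{0..}|P n \<omega>. 1 / (x + (2 * b + 1 / Suc k))) - (LINT x:{0..}|\<pi> n. 1 / (x + (2 * b + 1 / Suc k)))) \<longlonglongrightarrow> 0 \<and>
        (\<lambda>n. (LINT x:{0..}|P' n \<omega>. 1 / (x + (2 * b + 1 / Suc k))) - (LINT x:{0..}|\<pi>' n. 1 / (x + (2 * b + 1 / Suc k)))) \<longlonglongrightarrow> 0"
    unfolding AE_all_countable
  proof
    fix k :: nat
    have pos: "0 < 2 * b + 1 / Suc k" using b_pos by (intro add_pos_pos) auto
    have "(sqrt (2 * b + 1 / Suc k))\<^sup>2 = 2 * b + 1 / Suc k" using pos by simp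
    moreover have "2 * b \<le> 2 * b + 1 / Suc k" by simp
    ultimately show "AE \<omega> in M.
        (\<lambda>n. (LINT x:{0..}|P n \<omega>. 1 / (x + (2 * b + 1 / Suc k))) - (LINT x:{0..}|\<pi> n. 1 / (x + (2 * b + 1 / Suc k)))) \<longlonglongrightarrow> 0 \<and>
        (\<lambda>n. (LINT x:{0..}|P' n \<omega>. 1 / (x + (2 * b + 1 / Suc k))) - (LINT x:{0..}|\<pi>' n. 1 / (x + (2 * b + 1 / Suc k)))) \<longlonglongrightarrow> 0"
      using key[of "sqrt (2 * b + 1 / Suc k)"] pos by (simp only: real_sqrt_gt_0_iff)
  qed
  have b2: "0 < 2 * b" using b_pos by simp
  have pr: "\<And>n. 1 \<le> n \<Longrightarrow> prob_on_nonneg (\<pi> n)" "\<And>n. 1 \<le> n \<Longrightarrow> prob_on_nonneg (\<pi>' n)"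
    "\<And>n \<omega>. 1 \<le> n \<Longrightarrow> \<omega> \<in> space M \<Longrightarrow> prob_on_nonneg (P n \<omega>)" "\<And>n \<omega>. 1 \<le> n \<Longrightarrow> \<omega> \<in> space M \<Longrightarrow> prob_on_nonneg (P' n \<omega>)"
    using \<pi> \<pi>' P P' by (auto simp: has_stieltjes_def)
  show ?thesis
  proof (intro conjI allI impI)
    fix f :: "real \<Rightarrow> real" assume f: "continuous_on {0..} f" "bounded (f ` {0..})"
    show "AE \<omega> in M. (\<lambda>n. (LINT x:{0..}|P n \<omega>. f x) - (LINT x:{0..}|\<pi> n. f x)) \<longlonglongrightarrow> 0"
      using all AE_space
    proof eventually_elim
      case (elim \<omega>)
      show ?case
        by (rule stieltjes_convergence[OF pr(3)[OF _ elim(2)] pr(1) b2 _ _ f]) (use elim(1) tight in blast)+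
    qed
    show "AE \<omega> in M. (\<lambda>n. (LINT x:{0..}|P' n \<omega>. f x) - (LINT x:{0..}|\<pi>' n. f x)) \<longlonglongrightarrow> 0"
      using all AE_space
    proof eventually_elim
      case (elim \<omega>)
      show ?case
        by (rule stieltjes_convergence[OF pr(4)[OF _ elim(2)] pr(2) b2 _ _ f]) (use elim(1) tight in blast)+
    qed
  qed
qed

end
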